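(* Let $m\ge 2$. The set consisting of the following three families of elements forms an $\mathbb F_q$-basis of the invariant subspace $\mathcal Q_m(2)^{G_2}$, $G_2=GL_2(\mathbb F_q)$: 1. $\delta_{1;m}(\delta_{1;m}(1))=x_1^{q^m-1}x_2^{q^m-1}$; 2. $\delta_{2;m}(f)$ for $f\in\Delta^m_1$; 3. the elements of $\Delta^m_2$.
   Context: Let $\mathbb F_q$ be the field with $q$ elements, $q$ a power of a prime. $S(n)=\mathbb F_q[x_1,\ldots,x_n]$, $I_m(n)=(x_1^{q^m},\ldots,x_n^{q^m})$, $\mathcal Q_m(n)=S(n)/I_m(n)$. $G_n=GL_n(\mathbb F_q)$ acts on $S(n)$ by linear substitutions of the variables, hence on $\mathcal Q_m(n)$. Polynomials are identified with their classes in $\mathcal Q_m(n)$; the listed elements are polynomials. Dickson invariants: for $s\ge1$, $Q_{s,i}=Q_{s,i}(x_1,\ldots,x_s)$, $0\le i\le s-1$, are defined by $\prod_{\lambda\in\mathbb F_q^{s}}(X+\lambda_1x_1+\cdots+\lambda_sx_s)=X^{q^s}+\sum_{i=0}^{s-1}(-1)^{s-i}Q_{s,i}X^{q^i}$. The sets $\Delta^m_s$: for $1\le s\le m$, $\Delta^m_s$ is the set of monomials $Q_{s,s-1}^{e_1}Q_{s,s-2}^{e_2}\cdots Q_{s,0}^{e_s}$ for which there is a partition $m-s\ge\lambda_1\ge\cdots\ge\lambda_s\ge0$ (with $\lambda_{s+1}=0$) such that $\frac{q^{\lambda_i}-q^{\lambda_{i+1}}}{q-1}\le e_i<\frac{q^{\lambda_i+1}-q^{\lambda_{i+1}}}{q-1}$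 for all $1\le i\le s$. Delta operator: for integers $b\ge1$, $c\ge 0$, $1\le a\le c+1$ and a rational function $f$ in $c$ variables (a constant if $c=0$), $\delta_{a;b}(f)$ is the function of $c+1$ variables $x_1,\dots,x_{c+1}$ equal to the quotient of two $a\times a$ determinants. The numerator matrix has $(i,j)$ entry $x_j^{q^{i-1}}$ for $1\le i\le a-1$ and $(a,j)$ entry $x_j^{q^b}f(x_1,\ldots,\widehat{x_j},\ldots,x_{c+1})$; the denominator is $\det(x_j^{q^{i-1}})_{1\le i,j\le a}$. Polynomials in the $Q_{s,i}$ are viewed as polynomials in $x_1,\ldots,x_s$. *)

theory Defs
  imports
    "HOL-Library.Poly_Mapping"
    "HOL-Library.FuncSet"
    "HOL-Library.Cardinality"
    "HOL-Computational_Algebra.Polynomial_Factorial"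
    "HOL-Algebra.QuotRing"
    "Jordan_Normal_Form.Determinant"
    "Jordan_Normal_Form.VS_Connect"
begin

text \<open>
  The ground field is a type \<open>'a :: {field, finite}\<close>, and \<open>q\<close> is \<open>CARD('a)\<close>. Polynomials over it are
  finitely supported maps from exponent vectors to coefficients; the variables are
  \<open>x\<^sub>1, x\<^sub>2, \<dots>\<close>, counted from 1, and \<open>S(n)\<close>, here \<open>mp_ring n\<close>, consists of the polynomials that only
  involve \<open>x\<^sub>1, \<dots>, x\<^sub>n\<close>.
\<close>

type_synonym 'a mp = "(nat \<Rightarrow>\<^sub>0 nat) \<Rightarrow>\<^sub>0 'a"

definition mp_const :: "'a::comm_ring_1 \<Rightarrow> 'a mp" where
  "mp_const c = Poly_Mapping.single 0 c"

definition mp_var :: "nat \<Rightarrow> 'a::comm_ring_1 mp" where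
  "mp_var i = Poly_Mapping.single (Poly_Mapping.single i 1) 1"

definition mp_ring :: "nat \<Rightarrow> 'a::comm_ring_1 mp ring" where
  "mp_ring n = \<lparr>carrier = {p. \<forall>t\<in>Poly_Mapping.keys p. Poly_Mapping.keys t \<subseteq> {1..n}},
          mult = (*), one = 1, zero = 0, add = (+)\<rparr>"

definition mp_subst :: "(nat \<Rightarrow> 'a::comm_ring_1 mp) \<Rightarrow> 'a mp \<Rightarrow> 'a mp" where
  "mp_subst \<phi> p =
     (\<Sum>t\<in>Poly_Mapping.keys p. mp_const (Poly_Mapping.lookup p t) *
       (\<Prod>i\<in>Poly_Mapping.keys t. \<phi> i ^ Poly_Mapping.lookup t i))"

lemma mp_subst_superset:
  assumes "finite K" "Poly_Mapping.keys p \<subseteq> K"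
  shows "mp_subst \<phi> p = (\<Sum>t\<in>K. mp_const (Poly_Mapping.lookup p t) *
       (\<Prod>i\<in>Poly_Mapping.keys t. \<phi> i ^ Poly_Mapping.lookup t i))"
  unfolding mp_subst_def
  by (rule sum.mono_neutral_left) (use assms in \<open>auto simp: mp_const_def in_keys_iff\<close>)

lemma mp_subst_add: "mp_subst \<phi> (p + p') = mp_subst \<phi> p + mp_subst \<phi> p'"
proof -
  let ?K = "Poly_Mapping.keys p \<union> Poly_Mapping.keys p'"
  have "Poly_Mapping.keys (p + p') \<subseteq> ?K" by (rule Poly_Mapping.keys_add)
  then show ?thesis
    by (simp add: mp_subst_superset[of ?K] lookup_add mp_const_def single_add
        distrib_right sum.distrib)
qed

lemma mp_subst_0: "mp_subst \<phi> 0 = 0" by (simp add: mp_subst_def)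

lemma mp_subst_sum: "mp_subst \<phi> (sum f A) = (\<Sum>x\<in>A. mp_subst \<phi> (f x))"
  by (induction A rule: infinite_finite_induct) (auto simp: mp_subst_add mp_subst_0)

lemma mp_subst_single:
  "mp_subst \<phi> (Poly_Mapping.single t c)
     = mp_const c * (\<Prod>i\<in>Poly_Mapping.keys t. \<phi> i ^ Poly_Mapping.lookup t i)"
  by (subst mp_subst_superset[of "{t}"]) (auto)

lemma mp_monomial_add:
  fixes \<phi> :: "nat \<Rightarrow> 'a::comm_ring_1 mp"
  shows "(\<Prod>i\<in>Poly_Mapping.keys (s + t). \<phi> i ^ Poly_Mapping.lookup (s + t) i)
    = (\<Prod>i\<in>Poly_Mapping.keys s. \<phi> i ^ Poly_Mapping.lookup s i) *
      (\<Prod>i\<in>Poly_Mapping.keys t. \<phi> i ^ Poly_Mapping.lookup t i)"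
proof -
  let ?K = "Poly_Mapping.keys s \<union> Poly_Mapping.keys t"
  have *: "(\<Prod>i\<in>Poly_Mapping.keys u. \<phi> i ^ Poly_Mapping.lookup u i) =
      (\<Prod>i\<in>?K. \<phi> i ^ Poly_Mapping.lookup u i)"
    if "Poly_Mapping.keys u \<subseteq> ?K" for u
    by (rule prod.mono_neutral_left) (use that in \<open>auto simp: in_keys_iff\<close>)
  show ?thesis
    by (subst (1 2 3) *)
      (use Poly_Mapping.keys_add[of s t] in \<open>auto simp: lookup_add power_add prod.distrib\<close>)
qed

lemma mp_sum_single:
  "p = (\<Sum>t\<in>Poly_Mapping.keys p. Poly_Mapping.single t (Poly_Mapping.lookup p t))"
  by (rule poly_mapping_eqI)
    (simp add: lookup_sum lookup_single when_def in_keys_iff)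

lemma mp_subst_mult: "mp_subst \<phi> (p * p') = mp_subst \<phi> p * mp_subst \<phi> p'"
proof -
  let ?m = "\<lambda>p t. Poly_Mapping.single t (Poly_Mapping.lookup p t)"
  have "mp_subst \<phi> (p * p')
      = mp_subst \<phi> ((\<Sum>t\<in>Poly_Mapping.keys p. ?m p t) * (\<Sum>t\<in>Poly_Mapping.keys p'. ?m p' t))"
    using mp_sum_single[of p] mp_sum_single[of p'] by simp
  also have "\<dots> = mp_subst \<phi> p * mp_subst \<phi> p'"
    by (simp only: sum_product mp_subst_sum mult_single mp_subst_single mp_monomial_add)
      (simp add: mp_subst_def sum_product mp_const_def mult_single[of 0 _ 0, simplified, symmetric] ac_simps)
  finally show ?thesis .
qed

subsection \<open>The truncated polynomial algebra and its invariants\<close>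

definition pow_ideal :: "nat \<Rightarrow> nat \<Rightarrow> 'a::{field,finite} mp set" where
  "pow_ideal m n = genideal (mp_ring n) ((\<lambda>i. mp_var i ^ (CARD('a) ^ m)) ` {1..n})"

definition cls :: "nat \<Rightarrow> nat \<Rightarrow> 'a::{field,finite} mp \<Rightarrow> 'a mp set" where
  "cls m n p = pow_ideal m n +>\<^bsub>mp_ring n\<^esub> p"

text \<open>
  \<open>Q_alg m n\<close> is the quotient of \<open>S(n)\<close> by the ideal generated by the \<open>x\<^sub>i\<close> to the power
  \<open>q^m\<close>, and \<open>cls m n p\<close> is the class of \<open>p\<close>. The vector space structure on the quotient ring is the one induced by its structure of an
  algebra over the ground field.
\<close>

definition Q_alg :: "nat \<Rightarrow> nat \<Rightarrow> ('a::{field,finite}, 'a mp set) module" where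
  "Q_alg m n =
     (let R = mp_ring n Quot pow_ideal m n in
      \<lparr>carrier = carrier R, mult = mult R, one = one R, zero = zero R, add = add R,
       smult = (\<lambda>c A. cls m n (mp_const c) \<otimes>\<^bsub>R\<^esub> A)\<rparr>)"

definition GL :: "nat \<Rightarrow> 'a::{field,finite} mat set" where
  "GL n = {g \<in> carrier_mat n n. invertible_mat g}"

text \<open>
  The left action \<open>g \<cdot> x\<^sub>j = \<Sum>\<^sub>i g\<^sub>i\<^sub>j x\<^sub>i\<close>. Matrix indices of the library start at 0, hence the shifts.
\<close>

definition act :: "nat \<Rightarrow> 'a::{field,finite} mat \<Rightarrow> 'a mp \<Rightarrow> 'a mp" where
  "act n g = mp_subst (\<lambda>j. \<Sum>i\<in>{1..n}. mp_const (g $$ (i - 1, j - 1)) * mp_var i)"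

text \<open>
  The ideal is stable under the action, so a group element maps a coset, taken as a set of
  polynomials, onto a coset; this is the induced action on the quotient.
\<close>

definition invariants :: "nat \<Rightarrow> nat \<Rightarrow> 'a::{field,finite} mp set set" where
  "invariants m n = {A \<in> carrier (Q_alg m n). \<forall>g\<in>GL n. act n g ` A = A}"

subsection \<open>Dickson invariants\<close>

definition dickson_poly :: "nat \<Rightarrow> 'a::{field,finite} mp poly" where
  "dickson_poly s =
     (\<Prod>\<mu>\<in>{1..s} \<rightarrow>\<^sub>E (UNIV :: 'a set). [:\<Sum>i\<in>{1..s}. mp_const (\<mu> i) * mp_var i, 1:])"

definition dickson :: "nat \<Rightarrow> nat \<Rightarrow> 'a::{field,finite} mp" where
  "dickson s i = (-1) ^ (s - i) * poly.coeff (dickson_poly s) (CARD('a) ^ i)"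

text \<open>
  The sets \<open>\<Delta>\<^sup>m\<^sub>s\<close>, for \<open>1 \<le> s \<le> m\<close>. The divisions below are exact and the subtractions do
  not truncate, because \<open>l\<close> is nonincreasing, and \<open>m - s\<close> does not because \<open>s \<le> m\<close>.
\<close>

definition Delta_set :: "nat \<Rightarrow> nat \<Rightarrow> 'a::{field,finite} mp set" where
  "Delta_set m s =
     {\<Prod>i\<in>{1..s}. dickson s (s - i) ^ e i | e :: nat \<Rightarrow> nat.
        \<exists>l :: nat \<Rightarrow> nat. l 1 \<le> m - s \<and> (\<forall>i\<in>{1..s}. l (i + 1) \<le> l i) \<and> l (s + 1) = 0 \<and>
          (\<forall>i\<in>{1..s}.
             (CARD('a) ^ l i - CARD('a) ^ l (i + 1)) div (CARD('a) - 1) \<le> e i \<and>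
             e i < (CARD('a) ^ (l i + 1) - CARD('a) ^ l (i + 1)) div (CARD('a) - 1))}"

subsection \<open>The delta operator\<close>

text \<open>
  Substitution of polynomials for the variables of a rational function. By
  \<open>rat_subst_Fract\<close> below, the value does not depend on the chosen fraction, as long as
  the substitution does not kill the denominator.
\<close>

definition rat_subst ::
    "(nat \<Rightarrow> 'a::{field,finite} mp) \<Rightarrow> 'a mp fract \<Rightarrow> 'a mp fract" where
  "rat_subst \<phi> r = (THE v. \<exists>a b. b \<noteq> 0 \<and> mp_subst \<phi> b \<noteq> 0 \<and> r = Fract a b \<and>
     v = Fract (mp_subst \<phi> a) (mp_subst \<phi> b))"

lemma rat_subst_Fract:
  assumes "b \<noteq> 0" "mp_subst \<phi> b \<noteq> 0"
  shows "rat_subst \<phi> (Fract a b) = Fract (mp_subst \<phi> a) (mp_subst \<phi> b)"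
  unfolding rat_subst_def
proof (rule the_equality)
  show "\<exists>a' b'. b' \<noteq> 0 \<and> mp_subst \<phi> b' \<noteq> 0 \<and> Fract a b = Fract a' b' \<and>
      Fract (mp_subst \<phi> a) (mp_subst \<phi> b) = Fract (mp_subst \<phi> a') (mp_subst \<phi> b')"
    using assms by blast
next
  fix v
  assume "\<exists>a' b'. b' \<noteq> 0 \<and> mp_subst \<phi> b' \<noteq> 0 \<and> Fract a b = Fract a' b' \<and>
      v = Fract (mp_subst \<phi> a') (mp_subst \<phi> b')"
  then obtain a' b' where *: "b' \<noteq> 0" "mp_subst \<phi> b' \<noteq> 0" "Fract a b = Fract a' b'"
    and v: "v = Fract (mp_subst \<phi> a') (mp_subst \<phi> b')" by blast
  from * assms have "a * b' = a' * b" by (simp add: eq_fract)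
  then have "mp_subst \<phi> a * mp_subst \<phi> b' = mp_subst \<phi> a' * mp_subst \<phi> b"
    by (simp flip: mp_subst_mult)
  then show "v = Fract (mp_subst \<phi> a) (mp_subst \<phi> b)"
    using * assms v by (simp add: eq_fract)
qed

text \<open>\<open>f(x\<^sub>1, \<dots>, x\<^sub>c)\<close> becomes \<open>f(x\<^sub>1, \<dots>, x\<^sub>j\<^sub>-\<^sub>1, x\<^sub>j\<^sub>+\<^sub>1, \<dots>, x\<^sub>c\<^sub>+\<^sub>1)\<close>.\<close>

definition omit_var :: "nat \<Rightarrow> 'a::{field,finite} mp fract \<Rightarrow> 'a mp fract" where
  "omit_var j = rat_subst (\<lambda>i. mp_var (if i < j then i else i + 1))"

text \<open>
  The formula for \<open>\<delta>\<^sub>a\<^sub>;\<^sub>b(f)\<close> does not mention the number \<open>c\<close> of variables of \<open>f\<close>.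
  Row \<open>i\<close> and column \<open>j\<close> of the matrices below are row \<open>i + 1\<close> and column \<open>j + 1\<close> in the
  usual counting.
\<close>

definition delta :: "nat \<Rightarrow> nat \<Rightarrow> 'a::{field,finite} mp fract \<Rightarrow> 'a mp fract" where
  "delta a b f =
     det (mat a a (\<lambda>(i, j).
       if i < a - 1 then to_fract (mp_var (j + 1)) ^ (CARD('a) ^ i)
       else to_fract (mp_var (j + 1)) ^ (CARD('a) ^ b) * omit_var (j + 1) f))
     / det (mat a a (\<lambda>(i, j). to_fract (mp_var (j + 1)) ^ (CARD('a) ^ i)))"

end

theory Submission
  imports Defs
begin

text \<open>
  Write \<open>x\<close>, \<open>y\<close> for the variables, \<open>u = x^(q - 1)\<close>, \<open>v = y^(q - 1)\<close>, \<open>[k] = (q^k - 1) / (q - 1)\<close>, \<open>M = [m]\<close>,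
  \<open>N = q^m\<close>, let \<open>I\<close> be the ideal of \<open>x^N\<close> and \<open>y^N\<close>, and let \<open>L = x y^q - x^q y\<close>, which is the
  product of one linear form for each line of the plane. Besides the top monomial \<open>u^M v^M\<close>, the
  list consists of the sums \<open>d\<^sub>e = \<Sum> u^i v^(M + e - 1 - i)\<close> over \<open>e \<le> i < M\<close>, for \<open>e < M\<close>, and of the
  monomials \<open>Q\<^sub>1^a Q\<^sub>0^b\<close> in the two Dickson invariants for which some \<open>s \<le> m - 2\<close> satisfies
  \<open>[s] \<le> b < [s + 1]\<close> and \<open>a + [s] < [m - 1]\<close>.

  The list spans. By the diagonal matrices, an invariant class only involves monomials in \<open>u\<close> and \<open>v\<close>.
  A class of this kind that is also fixed by \<open>y \<mapsto> y + x\<close> is a combination of two sorts of monomials: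
  those in \<open>u\<close> and \<open>V\<close>, where \<open>V\<close> is the \<open>(q - 1)\<close>-st power of the product of the forms \<open>y + c x\<close>, and the
  \<open>u^M v^k\<close> (\<open>borel_decomposition\<close>). The plane has \<open>q + 1\<close> lines and \<open>q + 1 = 1\<close> in the field, so summing over
  all lines does not change an invariant class. But it maps polynomials in \<open>u\<close> and \<open>V\<close> to polynomials in the
  Dickson invariants, and \<open>u^M v^k\<close>, modulo \<open>I\<close>, to \<open>- d\<^sub>k\<^sub>+\<^sub>1\<close> (an empty sum if \<open>k = M - 1\<close>) or, if \<open>k = M\<close>, to the
  top monomial (\<open>line_trace_top\<close>). Hence every
  invariant class comes from a polynomial in \<open>Q\<^sub>0\<close> and \<open>Q\<^sub>1\<close>, the \<open>d\<^sub>e\<close> and the top monomial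
  (\<open>invariants_lift\<close>).

  Multiplication by \<open>L\<close> sends the \<open>d\<^sub>e\<close> and the top monomial into \<open>I\<close>, and an invariant class with this property
  is a combination of them (\<open>annihilator_of_moore\<close>). So all that remains is to find a basis of the Dickson
  algebra modulo the polynomials \<open>p\<close> with \<open>L p \<in> I\<close>. The quotient \<open>\<beta> = (x y^(q^k) - x^(q^k) y) / L\<close> is a
  polynomial in \<open>Q\<^sub>0\<close> and \<open>Q\<^sub>1\<close>, congruent to \<open>Q\<^sub>1^[k - 1]\<close> modulo \<open>Q\<^sub>0\<close> (\<open>beta_leading_term\<close>). For \<open>b \<ge> [s]\<close>,
  \<open>L Q\<^sub>0^b\<close> is a multiple of \<open>L^(q^s)\<close>, and \<open>(L \<beta>)^(q^s)\<close> lies in \<open>I\<close> if \<open>s + k = m\<close>; therefore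
  \<open>Q\<^sub>1^([m - 1] - [s]) Q\<^sub>0^b\<close> can be traded for multiples of \<open>Q\<^sub>0^(b + 1)\<close>, and the listed monomials suffice
  (\<open>q0_power_mult_dickson_span\<close>).

  The list is independent. In a relation, multiplication by \<open>L\<close> leaves only the Dickson monomials. Let
  \<open>Q\<^sub>0^b\<close> be the least power of \<open>Q\<^sub>0\<close> in it, on the layer \<open>[s] \<le> b < [s + 1]\<close>. Then \<open>L Q\<^sub>0^b\<close> is a power of \<open>L\<close> with
  exponent less than \<open>q^(s + 1)\<close>, and this power can be cancelled at the cost of a factor \<open>x^(q^(s + 1))\<close>
  if the other factor is restricted to the line \<open>y = 0\<close> (\<open>moore_power_mult_trunc\<close>). There \<open>Q\<^sub>0\<close> vanishes and
  \<open>Q\<^sub>1\<close> is a power of \<open>x\<close>, and the remaining powers of \<open>x\<close> are distinct with exponents less than \<open>N\<close>.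
  Finally the \<open>d\<^sub>e\<close> and the top monomial are independent because no monomial occurs in two of them.
\<close>

section \<open>Finite fields\<close>

lemma card_field_gt_1: "1 < CARD('a::{field,finite})"
proof -
  have "card {0, 1 :: 'a} \<le> CARD('a)" by (rule card_mono) auto
  then show ?thesis by simp
qed

lemma power_card_eq: "c ^ CARD('a) = (c :: 'a::{field,finite})"
proof (cases "c = 0")
  case False
  have "c * (\<Prod>y\<in>UNIV-{0}. c * y) = c * c ^ (CARD('a) - 1) * \<Prod>(UNIV-{0})"
    by (simp add: prod.distrib mult_ac)
  also have "c * c ^ (CARD('a) - 1) = c ^ CARD('a)"
    by (metis card_field_gt_1 le_less_trans power_eq_if le0 not_less_zero less_irrefl)
  also have "(\<Prod>y\<in>UNIV-{0}. c * y) = (\<Prod>y\<in>UNIV-{0}. y)"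
    by (rule prod.reindex_bij_witness[of _ "\<lambda>y. y / c" "\<lambda>y. c * y"]) (use False in auto)
  finally show ?thesis by simp
qed (use card_field_gt_1[where 'a='a] in auto)

lemma power_card_power_eq: "c ^ (CARD('a) ^ k) = (c :: 'a::{field,finite})"
  by (induction k) (simp_all add: power_card_eq power_mult)

lemma power_card_minus_1_eq:
  assumes "c \<noteq> (0::'a::{field,finite})"
  shows "c ^ (CARD('a) - 1) = 1"
proof -
  have "c * c ^ (CARD('a) - 1) = c * 1"
    using power_card_eq[of c] card_field_gt_1[where 'a='a] by (simp flip: power_Suc)
  then show ?thesis using assms by simp
qed

lemma minus_one_power_card: "(-1) ^ (CARD('a) - 1) = (1 :: 'a::{field,finite})"
  by (rule power_card_minus_1_eq) simp

lemma of_nat_card_field: "of_nat CARD('a) = (0 :: 'a::{field,finite})"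
proof -
  have "(\<Sum>x\<in>UNIV. x + 1) = (\<Sum>x\<in>UNIV. x :: 'a)"
    by (rule sum.reindex_bij_witness[of _ "\<lambda>x. x - 1" "\<lambda>x. x + 1"]) auto
  then show ?thesis by (simp add: sum.distrib)
qed

text \<open>
  The remainder \<open>r\<close> of \<open>n\<close> modulo \<open>q - 1\<close> has the same property, and \<open>T^r - 1\<close> with \<open>0 < r < q - 1\<close> has too few
  roots for it.
\<close>

lemma dvd_exponent:
  assumes "\<And>c :: 'a::{field,finite}. c \<noteq> 0 \<Longrightarrow> c ^ n = 1"
  shows "CARD('a) - 1 dvd n"
proof (rule ccontr)
  assume *: "\<not> ?thesis"
  define r where "r = n mod (CARD('a) - 1)"
  have r: "0 < r" "r < CARD('a) - 1"
    using * card_field_gt_1[where 'a='a] by (auto simp: r_def dvd_eq_mod_eq_0)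
  have n: "n = (CARD('a) - 1) * (n div (CARD('a) - 1)) + r" by (simp add: r_def)
  have root: "c ^ r = 1" if "c \<noteq> 0" for c :: 'a
  proof -
    have "c ^ n = (c ^ (CARD('a) - 1)) ^ (n div (CARD('a) - 1)) * c ^ r"
      by (subst n) (simp only: power_add power_mult)
    then show ?thesis using assms[OF that] power_card_minus_1_eq[OF that] by simp
  qed
  have "monom 1 r = (1 :: 'a poly)"
  proof (rule poly_eqI_degree[where A = "UNIV - {0}"])
    show "poly (monom 1 r) c = poly 1 c" if "c \<in> UNIV - {0}" for c :: 'a
      using that root by (simp add: poly_monom)
  qed (use r in \<open>simp_all add: degree_monom_eq card_Diff_singleton\<close>)
  then have "degree (monom 1 r :: 'a poly) = degree (1 :: 'a poly)" by simp
  then show False using r by (simp add: degree_monom_eq)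
qed

lemma sum_powers_field:
  "(\<Sum>c\<in>UNIV. c ^ t) = (if 0 < t \<and> CARD('a) - 1 dvd t then -1 else (0 :: 'a::{field,finite}))"
proof (cases "CARD('a) - 1 dvd t")
  case True
  then obtain k where k: "t = (CARD('a) - 1) * k" ..
  have "c ^ t = 1" if "c \<noteq> 0" for c :: 'a
    by (simp only: k power_mult power_card_minus_1_eq[OF that] power_one)
  then have "(\<Sum>c\<in>UNIV - {0::'a}. c ^ t) = (\<Sum>c\<in>UNIV - {0::'a}. 1)"
    by (intro sum.cong) auto
  also have "\<dots> = -1"
    using card_field_gt_1[where 'a='a] of_nat_card_field[where 'a='a]
    by (simp add: card_Diff_singleton of_nat_diff)
  finally have "(\<Sum>c\<in>UNIV. c ^ t) = 0 ^ t - (1::'a)"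
    by (subst sum.remove[of _ 0]) auto
  then show ?thesis using True by (cases "t = 0") auto
next
  case False
  then obtain d :: 'a where d: "d \<noteq> 0" "d ^ t \<noteq> 1" using dvd_exponent by blast
  have "d ^ t * (\<Sum>c\<in>UNIV. c ^ t) = (\<Sum>c\<in>UNIV. (d * c) ^ t)"
    by (simp add: sum_distrib_left power_mult_distrib)
  also have "\<dots> = (\<Sum>c\<in>UNIV. c ^ t)"
    by (rule sum.reindex_bij_witness[of _ "\<lambda>c. c / d" "\<lambda>c. d * c"]) (use d in auto)
  finally have "(d ^ t - 1) * (\<Sum>c\<in>UNIV. c ^ t) = 0" by (simp add: algebra_simps)
  then show ?thesis using d False by auto
qed

text \<open>
  Two monic polynomials of degree \<open>q\<close> that agree on all \<open>q\<close> elements of the field.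
\<close>

lemma binomial_poly_card:
  "[:1, 1:] ^ CARD('a) = monom 1 CARD('a) + (1 :: 'a::{field,finite} poly)"
proof (rule poly_eqI_degree_lead_coeff[where A = UNIV and n = "CARD('a)"])
  show "Polynomial.coeff ([:1, 1:] ^ CARD('a)) CARD('a)
      = Polynomial.coeff (monom 1 CARD('a) + (1 :: 'a poly)) CARD('a)"
    using card_field_gt_1[where 'a='a] by (subst coeff_linear_poly_power) auto
  show "degree ([:1, 1:] ^ CARD('a) :: 'a poly) \<le> CARD('a)"
    using degree_power_le[of "[:1,1::'a:]" "CARD('a)"] by simp
  show "degree (monom 1 CARD('a) + (1 :: 'a poly)) \<le> CARD('a)"
    by (intro degree_add_le) (auto simp: degree_monom_le)
  show "poly ([:1, 1:] ^ CARD('a)) z = poly (monom 1 CARD('a) + 1) z" for z :: 'a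
    by (simp add: poly_monom power_card_eq del: card_UNIV_unit)
qed simp

lemma binomial_card_eq_0:
  assumes "0 < i" "i < CARD('a)"
  shows "of_nat (CARD('a) choose i) = (0 :: 'a::{field,finite})"
proof -
  have "of_nat (CARD('a) choose i) = Polynomial.coeff ([:1, 1 :: 'a:] ^ CARD('a)) i"
    using assms by (subst coeff_linear_poly_power) auto
  also have "\<dots> = 0" using assms by (simp only: binomial_poly_card) (simp add: coeff_1)
  finally show ?thesis .
qed

text \<open>
  Modulo the characteristic, \<open>(1 + T)\<close> to the power \<open>q a + b\<close> is \<open>(1 + T\<^sup>q)\<^sup>a (1 + T)\<^sup>b\<close>, and for
  \<open>b < q\<close> the second factor cannot reach from one multiple of \<open>q\<close> to the next. This is the part of
  the theorem of Lucas that only looks at the last digit in base \<open>q\<close>.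
\<close>

lemma binomial_last_digit:
  fixes n k :: nat
  defines "q \<equiv> CARD('a::{field,finite})"
  shows "n mod q < k mod q \<Longrightarrow> of_nat (n choose k) = (0 :: 'a)"
    and "of_nat (n choose (n mod q)) = (1 :: 'a)"
proof -
  have q: "1 < q" using card_field_gt_1[where 'a='a] by (simp add: q_def)
  define A where "A = (monom 1 q + (1 :: 'a poly)) ^ (n div q)"
  define B where "B = [:1, 1 :: 'a:] ^ (n mod q)"
  have "[:1, 1 :: 'a:] ^ n = ([:1, 1:] ^ q) ^ (n div q) * B"
    unfolding B_def by (simp flip: power_mult power_add)
  then have AB: "[:1, 1 :: 'a:] ^ n = A * B"
    by (simp add: A_def q_def binomial_poly_card)
  have A: "q dvd i" if "Polynomial.coeff A i \<noteq> 0" for i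
  proof -
    have "Polynomial.coeff ((monom 1 q + (1 :: 'a poly)) ^ m) i \<noteq> 0 \<Longrightarrow> q dvd i" for m
    proof (induction m arbitrary: i)
      case (Suc m)
      have "Polynomial.coeff ((monom 1 q + 1) ^ Suc m) i =
         (if i < q then 0 else Polynomial.coeff ((monom 1 q + (1 :: 'a poly)) ^ m) (i - q)) +
          Polynomial.coeff ((monom 1 q + (1 :: 'a poly)) ^ m) i"
        by (simp add: distrib_right coeff_monom_mult)
      then have *: "Polynomial.coeff ((monom 1 q + (1 :: 'a poly)) ^ m) i \<noteq> 0 \<or>
          q \<le> i \<and> Polynomial.coeff ((monom 1 q + (1 :: 'a poly)) ^ m) (i - q) \<noteq> 0"
        using Suc.prems by (cases "i < q") auto
      show ?case
      proof (cases "Polynomial.coeff ((monom 1 q + (1 :: 'a poly)) ^ m) i = 0")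
        case True
        then have "q \<le> i" "q dvd i - q" using * Suc.IH by blast+
        then show ?thesis by (metis dvd_diffD dvd_refl)
      qed (rule Suc.IH)
    qed (auto simp: coeff_1 split: if_splits)
    then show ?thesis using that unfolding A_def by blast
  qed
  have B: "j \<le> n mod q" if "Polynomial.coeff B j \<noteq> 0" for j
  proof -
    have "degree B \<le> n mod q" unfolding B_def using degree_power_le[of "[:1, 1 :: 'a:]" "n mod q"] by simp
    then show ?thesis using that le_degree le_trans by blast
  qed
  have choose: "of_nat (n choose k) = (\<Sum>i\<le>k. Polynomial.coeff A i * Polynomial.coeff B (k - i))" for k
  proof (cases "k \<le> n")
    case True
    then have "of_nat (n choose k) = Polynomial.coeff ([:1, 1 :: 'a:] ^ n) k"
      by (subst coeff_linear_poly_power) auto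
    then show ?thesis by (simp add: AB coeff_mult)
  next
    case False
    have "degree ([:1, 1 :: 'a:] ^ n) \<le> n" using degree_power_le[of "[:1, 1 :: 'a:]" n] by simp
    then have "Polynomial.coeff ([:1, 1 :: 'a:] ^ n) k = 0" using False by (intro coeff_eq_0) auto
    then show ?thesis using False by (simp add: AB coeff_mult binomial_eq_0)
  qed
  show "of_nat (n choose k) = (0 :: 'a)" if less: "n mod q < k mod q"
    unfolding choose
  proof (rule sum.neutral, intro ballI)
    fix i assume i: "i \<in> {..k}"
    show "Polynomial.coeff A i * Polynomial.coeff B (k - i) = 0"
    proof (rule ccontr)
      assume "Polynomial.coeff A i * Polynomial.coeff B (k - i) \<noteq> 0"
      then have "q dvd i" "k - i \<le> n mod q" using A B by auto
      then have "(k - i) mod q = k mod q" using i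
        by (metis atMost_iff dvdE le_add_diff_inverse mod_mult_self4)
      moreover have "(k - i) mod q \<le> k - i" by (rule mod_less_eq_dividend)
      ultimately show False using less \<open>k - i \<le> n mod q\<close> by linarith
    qed
  qed
  have r: "n mod q < q" using q by simp
  have "(\<Sum>i\<le>n mod q. Polynomial.coeff A i * Polynomial.coeff B (n mod q - i))
      = (\<Sum>i\<in>{0}. Polynomial.coeff A i * Polynomial.coeff B (n mod q - i))"
  proof (rule sum.mono_neutral_right)
    show "\<forall>i\<in>{..n mod q} - {0}. Polynomial.coeff A i * Polynomial.coeff B (n mod q - i) = 0"
    proof
      fix i assume "i \<in> {..n mod q} - {0}"
      then have "0 < i" "i < q" using r by auto
      then have "\<not> q dvd i" by (auto dest: dvd_imp_le)
      then show "Polynomial.coeff A i * Polynomial.coeff B (n mod q - i) = 0" using A by auto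
    qed
  qed auto
  also have "\<dots> = 1"
  proof -
    have "Polynomial.coeff A 0 = 1"
      using q by (simp add: A_def coeff_0_power)
    moreover have "Polynomial.coeff B (n mod q) = 1"
      unfolding B_def by (rule coeff_linear_power)
    ultimately show ?thesis by simp
  qed
  finally show "of_nat (n choose (n mod q)) = (1 :: 'a)" unfolding choose .
qed

section \<open>Polynomials and substitutions\<close>

lemma mp_const_0 [simp]: "mp_const 0 = 0" by (simp add: mp_const_def)
lemma mp_const_1 [simp]: "mp_const 1 = 1" by (simp add: mp_const_def)
lemma mp_const_add: "mp_const (c + d) = mp_const c + mp_const d"
  by (simp add: mp_const_def single_add)
lemma mp_const_uminus: "mp_const (- c) = - mp_const c"
  by (simp add: mp_const_def single_uminus)
lemma mp_const_diff: "mp_const (c - d) = mp_const c - mp_const d"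
  by (simp add: mp_const_def single_diff)
lemma mp_const_mult: "mp_const (c * d) = mp_const c * mp_const d"
  by (simp add: mp_const_def mult_single)
lemma mp_const_power: "mp_const (c ^ n) = mp_const c ^ n"
  by (induction n) (simp_all add: mp_const_mult)
lemma mp_const_of_nat: "mp_const (of_nat n) = of_nat n"
  by (induction n) (simp_all add: mp_const_add)
lemma mp_const_sum: "mp_const (sum f A) = (\<Sum>x\<in>A. mp_const (f x))"
  by (induction A rule: infinite_finite_induct) (simp_all add: mp_const_add)
lemma mp_const_inject [simp]: "mp_const c = mp_const d \<longleftrightarrow> c = d"
  unfolding mp_const_def by (metis lookup_single_eq)

lemma mp_subst_const [simp]: "mp_subst \<phi> (mp_const c) = mp_const c"
  by (simp add: mp_const_def mp_subst_single)
lemma mp_subst_var [simp]: "mp_subst \<phi> (mp_var i) = \<phi> i"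
  by (simp add: mp_var_def mp_subst_single)
lemma mp_subst_1 [simp]: "mp_subst \<phi> 1 = 1"
  using mp_subst_const[of \<phi> 1] by simp
lemma mp_subst_diff: "mp_subst \<phi> (p - p') = mp_subst \<phi> p - mp_subst \<phi> p'"
  using mp_subst_add[of \<phi> "p - p'" p'] by simp
lemma mp_subst_uminus: "mp_subst \<phi> (- p) = - mp_subst \<phi> p"
  using mp_subst_diff[of \<phi> 0 p] by (simp add: mp_subst_0)
lemma mp_subst_power: "mp_subst \<phi> (p ^ n) = mp_subst \<phi> p ^ n"
  by (induction n) (simp_all add: mp_subst_mult)
lemmas mp_subst_hom =
  mp_subst_add mp_subst_diff mp_subst_uminus mp_subst_mult mp_subst_power mp_subst_0 mp_subst_sum

lemma mp_var_power: "mp_var i ^ n = Poly_Mapping.single (Poly_Mapping.single i n) 1"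
  by (induction n) (simp_all add: mp_var_def mult_single flip: single_add)

lemma mp_subst_mp_var [simp]: "mp_subst mp_var p = p"
proof -
  have mono: "(\<Prod>i\<in>K. mp_var i ^ n i) = (Poly_Mapping.single (\<Sum>i\<in>K. Poly_Mapping.single i (n i)) 1 :: 'a mp)"
    if "finite K" for K and n :: "nat \<Rightarrow> nat"
    using that
  proof (induction K rule: finite_induct)
    case (insert k K)
    then show ?case by (simp add: mp_var_power mult_single)
  qed simp
  have "mp_subst mp_var (Poly_Mapping.single t c) = Poly_Mapping.single t c" for t and c :: 'a
    unfolding mp_subst_single mono[OF finite_keys] mp_sum_single[symmetric]
    by (simp add: mp_const_def mult_single)
  then show ?thesis
    by (subst (1 2) mp_sum_single[of p]) (simp add: mp_subst_sum)
qed

lemma mp_induct [case_names const var add mult]: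
  fixes p :: "'a::comm_ring_1 mp"
  assumes const: "\<And>c. P (mp_const c)" and var: "\<And>i. P (mp_var i)"
    and add: "\<And>p p'. P p \<Longrightarrow> P p' \<Longrightarrow> P (p + p')" and mult: "\<And>p p'. P p \<Longrightarrow> P p' \<Longrightarrow> P (p * p')"
  shows "P p"
proof -
  have zero: "P 0" and one: "P 1" using const[of 0] const[of 1] by auto
  have pow: "P (r ^ n)" if "P r" for r n using that by (induction n) (auto intro: one mult)
  have prods: "P (prod f K)" if "\<And>i. i \<in> K \<Longrightarrow> P (f i)" for f :: "nat \<Rightarrow> 'a mp" and K
    using that by (induction K rule: infinite_finite_induct) (auto intro: one mult)
  have sums: "P (sum f K)" if "\<And>i. i \<in> K \<Longrightarrow> P (f i)" for f :: "(nat \<Rightarrow>\<^sub>0 nat) \<Rightarrow> 'a mp" and K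
    using that by (induction K rule: infinite_finite_induct) (auto intro: zero add)
  have "P (mp_subst mp_var p)"
    unfolding mp_subst_def by (rule sums, rule mult, rule const, rule prods, rule pow, rule var)
  then show ?thesis by simp
qed

lemma mp_subst_comp: "mp_subst \<phi> (mp_subst \<psi> p) = mp_subst (\<lambda>i. mp_subst \<phi> (\<psi> i)) p"
  by (induction p rule: mp_induct) (simp_all add: mp_subst_hom)

lemma mp_power_card_add:
  fixes a b :: "'a::{field,finite} mp"
  shows "(a + b) ^ CARD('a) = a ^ CARD('a) + b ^ CARD('a)"
proof -
  let ?q = "CARD('a)"
  have "of_nat (?q choose i) = (0 :: 'a mp)" if "0 < i" "i < ?q" for i
    using binomial_card_eq_0[OF that] by (simp flip: mp_const_of_nat)
  then have "(\<Sum>i\<le>?q. of_nat (?q choose i) * a ^ i * b ^ (?q - i))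
      = (\<Sum>i\<in>{0, ?q}. of_nat (?q choose i) * a ^ i * b ^ (?q - i))"
    by (intro sum.mono_neutral_right) auto
  then show ?thesis
    using card_field_gt_1[where 'a='a] by (simp add: binomial_ring add.commute)
qed

lemma mp_frobenius_add:
  "(a + b :: 'a::{field,finite} mp) ^ (CARD('a) ^ k) = a ^ (CARD('a) ^ k) + b ^ (CARD('a) ^ k)"
proof (induction k)
  case (Suc k)
  then show ?case by (simp only: power_Suc2 power_mult mp_power_card_add)
qed simp

lemma mp_frobenius_diff:
  "(a - b :: 'a::{field,finite} mp) ^ (CARD('a) ^ k) = a ^ (CARD('a) ^ k) - b ^ (CARD('a) ^ k)"
  using mp_frobenius_add[of "a - b" b k] by simp

lemma mp_frobenius_const: "mp_const c ^ (CARD('a) ^ k) = mp_const (c :: 'a::{field,finite})"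
  by (simp add: power_card_power_eq flip: mp_const_power)

lemma mp_of_nat_card: "of_nat CARD('a) = (0 :: 'a::{field,finite} mp)"
  by (simp add: of_nat_card_field flip: mp_const_of_nat)

section \<open>Polynomials in two variables modulo powers of the variables\<close>

definition vx :: "'a::comm_ring_1 mp" where "vx = mp_var 1"
definition vy :: "'a::comm_ring_1 mp" where "vy = mp_var 2"

definition expo :: "nat \<Rightarrow> nat \<Rightarrow> nat \<Rightarrow>\<^sub>0 nat" where
  "expo i j = Poly_Mapping.single 1 i + Poly_Mapping.single 2 j"

definition coef :: "'a::comm_ring_1 mp \<Rightarrow> nat \<Rightarrow> nat \<Rightarrow> 'a" where
  "coef p i j = Poly_Mapping.lookup p (expo i j)"

definition subst2 :: "'a::comm_ring_1 mp \<Rightarrow> 'a mp \<Rightarrow> 'a mp \<Rightarrow> 'a mp" where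
  "subst2 P Q = mp_subst (\<lambda>i. if i = 1 then P else Q)"

lemma subst2_vx [simp]: "subst2 P Q vx = P" and subst2_vy [simp]: "subst2 P Q vy = Q"
  and subst2_const [simp]: "subst2 P Q (mp_const c) = mp_const c"
  and subst2_1 [simp]: "subst2 P Q 1 = 1" and subst2_0 [simp]: "subst2 P Q 0 = 0"
  by (simp_all add: subst2_def mp_subst_0 vx_def vy_def)

lemma subst2_hom: "subst2 P Q (p + p') = subst2 P Q p + subst2 P Q p'" "subst2 P Q (p - p') = subst2 P Q p - subst2 P Q p'"
  "subst2 P Q (- p) = - subst2 P Q p" "subst2 P Q (p * p') = subst2 P Q p * subst2 P Q p'"
  "subst2 P Q (p ^ n) = subst2 P Q p ^ n" "subst2 P Q (sum f A) = (\<Sum>x\<in>A. subst2 P Q (f x))"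
  by (simp_all add: subst2_def mp_subst_hom)

lemma mp_subst_subst2: "mp_subst \<phi> (subst2 P Q p) = subst2 (mp_subst \<phi> P) (mp_subst \<phi> Q) p"
  by (simp add: subst2_def mp_subst_comp if_distrib)

lemma subst2_subst2: "subst2 P Q (subst2 P' Q' p) = subst2 (subst2 P Q P') (subst2 P Q Q') p"
  unfolding subst2_def[of P Q] by (rule mp_subst_subst2)

lemma expo_eq_iff [simp]: "expo a b = expo i j \<longleftrightarrow> a = i \<and> b = j"
proof
  assume *: "expo a b = expo i j"
  from arg_cong[OF *, of "\<lambda>t. Poly_Mapping.lookup t 1"] arg_cong[OF *, of "\<lambda>t. Poly_Mapping.lookup t 2"]
  show "a = i \<and> b = j" by (simp add: expo_def lookup_add lookup_single)
qed auto

lemma coef_add: "coef (p + p') i j = coef p i j + coef p' i j"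
  and coef_diff: "coef (p - p') i j = coef p i j - coef p' i j"
  and coef_0 [simp]: "coef 0 i j = 0"
  by (simp_all add: coef_def lookup_add lookup_minus)

lemma coef_sum: "coef (sum f A) i j = (\<Sum>x\<in>A. coef (f x) i j)"
  by (simp add: coef_def lookup_sum)

lemma coef_monomial:
  "coef (mp_const c * vx ^ a * vy ^ b) i j = (if a = i \<and> b = j then c else 0)"
proof -
  have "mp_const c * vx ^ a * vy ^ b = Poly_Mapping.single (expo a b) c"
    by (simp add: vx_def vy_def mp_var_power mp_const_def mult_single expo_def)
  then show ?thesis by (simp add: coef_def lookup_single when_def)
qed

lemma coef_const_mult: "coef (mp_const c * p) i j = c * coef p i j"
proof -
  have "mp_const c * p = Poly_Mapping.map ((*) c) p"
    by (simp add: mp_const_def mult_map_scale_conv_mult)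
  then show ?thesis by (simp add: coef_def map.rep_eq when_def)
qed

lemma subst2_vx_vy_monomials:
  fixes p :: "'a::comm_ring_1 mp"
  shows "subst2 vx vy p = (\<Sum>t\<in>Poly_Mapping.keys p. mp_const (Poly_Mapping.lookup p t) *
     vx ^ Poly_Mapping.lookup t 1 * vy ^ (\<Sum>i\<in>Poly_Mapping.keys t - {1}. Poly_Mapping.lookup t i))"
  unfolding subst2_def mp_subst_def
proof (rule sum.cong[OF refl])
  fix t assume "t \<in> Poly_Mapping.keys p"
  let ?f = "\<lambda>i. (if i = 1 then vx else vy :: 'a mp) ^ Poly_Mapping.lookup t i"
  have "(\<Prod>i\<in>Poly_Mapping.keys t. ?f i) = (\<Prod>i\<in>insert 1 (Poly_Mapping.keys t). ?f i)"
    by (rule prod.mono_neutral_left) (auto simp: in_keys_iff)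
  also have "\<dots> = vx ^ Poly_Mapping.lookup t 1 * (\<Prod>i\<in>Poly_Mapping.keys t - {1}. ?f i)"
    by (simp add: prod.insert_remove)
  also have "(\<Prod>i\<in>Poly_Mapping.keys t - {1}. ?f i)
      = (\<Prod>i\<in>Poly_Mapping.keys t - {1}. vy ^ Poly_Mapping.lookup t i)"
    by (rule prod.cong) auto
  also have "\<dots> = vy ^ (\<Sum>i\<in>Poly_Mapping.keys t - {1}. Poly_Mapping.lookup t i)"
    by (rule power_sum[symmetric])
  finally show "mp_const (Poly_Mapping.lookup p t) * (\<Prod>i\<in>Poly_Mapping.keys t. ?f i)
      = mp_const (Poly_Mapping.lookup p t) * vx ^ Poly_Mapping.lookup t 1 *
        vy ^ (\<Sum>i\<in>Poly_Mapping.keys t - {1}. Poly_Mapping.lookup t i)"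
    by (simp add: mult.assoc)
qed

lemma mp_ring_simps:
  "p \<otimes>\<^bsub>mp_ring n\<^esub> p' = p * p'" "p \<oplus>\<^bsub>mp_ring n\<^esub> p' = p + p'" "\<one>\<^bsub>mp_ring n\<^esub> = 1" "\<zero>\<^bsub>mp_ring n\<^esub> = 0"
  by (simp_all add: mp_ring_def)

lemma mp_ring_closed:
  "0 \<in> carrier (mp_ring n)" "1 \<in> carrier (mp_ring n)" "mp_const c \<in> carrier (mp_ring n)"
  "i \<in> {1..n} \<Longrightarrow> mp_var i \<in> carrier (mp_ring n)"
  "p \<in> carrier (mp_ring n) \<Longrightarrow> - p \<in> carrier (mp_ring n)"
  "p \<in> carrier (mp_ring n) \<Longrightarrow> p' \<in> carrier (mp_ring n) \<Longrightarrow> p + p' \<in> carrier (mp_ring n)"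
  "p \<in> carrier (mp_ring n) \<Longrightarrow> p' \<in> carrier (mp_ring n) \<Longrightarrow> p * p' \<in> carrier (mp_ring n)"
proof -
  show "0 \<in> carrier (mp_ring n)" "1 \<in> carrier (mp_ring n)"
    by (auto simp: mp_ring_def simp flip: single_one)
  show "mp_const c \<in> carrier (mp_ring n)" by (auto simp: mp_ring_def mp_const_def)
  show "i \<in> {1..n} \<Longrightarrow> mp_var i \<in> carrier (mp_ring n)" by (auto simp: mp_ring_def mp_var_def)
  show "p \<in> carrier (mp_ring n) \<Longrightarrow> - p \<in> carrier (mp_ring n)" by (auto simp: mp_ring_def in_keys_iff)
  show "p + p' \<in> carrier (mp_ring n)" if "p \<in> carrier (mp_ring n)" "p' \<in> carrier (mp_ring n)"
    using that Poly_Mapping.keys_add[of p p'] by (auto simp: mp_ring_def)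
  show "p * p' \<in> carrier (mp_ring n)" if "p \<in> carrier (mp_ring n)" "p' \<in> carrier (mp_ring n)"
  proof -
    have "Poly_Mapping.keys t \<subseteq> {1..n}" if "t \<in> Poly_Mapping.keys (p * p')" for t
    proof -
      from that obtain a b where "t = a + b" "a \<in> Poly_Mapping.keys p" "b \<in> Poly_Mapping.keys p'"
        using keys_mult by blast
      then show ?thesis
        using \<open>p \<in> carrier (mp_ring n)\<close> \<open>p' \<in> carrier (mp_ring n)\<close> Poly_Mapping.keys_add[of a b]
        by (fastforce simp: mp_ring_def)
    qed
    then show ?thesis by (auto simp: mp_ring_def)
  qed
qed

lemma mp_ring_closed_more:
  "p \<in> carrier (mp_ring n) \<Longrightarrow> p' \<in> carrier (mp_ring n) \<Longrightarrow> p - p' \<in> carrier (mp_ring n)"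
  "p \<in> carrier (mp_ring n) \<Longrightarrow> p ^ k \<in> carrier (mp_ring n)"
  "(\<And>x. x \<in> A \<Longrightarrow> f x \<in> carrier (mp_ring n)) \<Longrightarrow> sum f A \<in> carrier (mp_ring n)"
proof -
  show "p - p' \<in> carrier (mp_ring n)" if "p \<in> carrier (mp_ring n)" "p' \<in> carrier (mp_ring n)"
    using mp_ring_closed(6)[of p n "- p'"] mp_ring_closed(5)[of p' n] that by simp
  show "p \<in> carrier (mp_ring n) \<Longrightarrow> p ^ k \<in> carrier (mp_ring n)"
    by (induction k) (auto intro: mp_ring_closed)
  show "(\<And>x. x \<in> A \<Longrightarrow> f x \<in> carrier (mp_ring n)) \<Longrightarrow> sum f A \<in> carrier (mp_ring n)"
    by (induction A rule: infinite_finite_induct) (auto intro: mp_ring_closed)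
qed

lemmas mp_ring_intros = mp_ring_closed mp_ring_closed_more

lemma vx_vy_closed: "vx \<in> carrier (mp_ring 2)" "vy \<in> carrier (mp_ring 2)"
  by (auto simp: vx_def vy_def intro: mp_ring_closed)

lemma cring_mp_ring: "cring (mp_ring n)"
proof (rule cringI)
  show "abelian_group (mp_ring n)"
  proof (rule abelian_groupI)
    fix p assume "p \<in> carrier (mp_ring n)"
    then show "\<exists>p'\<in>carrier (mp_ring n). p' \<oplus>\<^bsub>mp_ring n\<^esub> p = \<zero>\<^bsub>mp_ring n\<^esub>"
      by (intro bexI[of _ "- p"]) (auto simp: mp_ring_simps intro: mp_ring_closed)
  qed (auto simp: mp_ring_simps intro: mp_ring_closed)
  show "comm_monoid (mp_ring n)"
    by (rule comm_monoidI) (auto simp: mp_ring_simps mult_ac intro: mp_ring_closed)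
qed (auto simp: mp_ring_simps distrib_right)

lemma subst2_closed:
  "P \<in> carrier (mp_ring n) \<Longrightarrow> Q \<in> carrier (mp_ring n) \<Longrightarrow> subst2 P Q p \<in> carrier (mp_ring n)"
proof (induction p rule: mp_induct)
  case (var i)
  then show ?case by (simp add: subst2_def)
qed (auto simp: subst2_hom intro: mp_ring_closed)

lemma subst2_vx_vy:
  assumes "p \<in> carrier (mp_ring 2)"
  shows "subst2 vx vy p = p"
proof -
  have "subst2 vx vy p = mp_subst mp_var p"
    unfolding subst2_def mp_subst_def
  proof (intro sum.cong refl arg_cong2[of _ _ _ _ "(*)"] prod.cong)
    fix t i assume "t \<in> Poly_Mapping.keys p" "i \<in> Poly_Mapping.keys t"
    then have "i \<in> {1..2}" using assms by (fastforce simp: mp_ring_def)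
    then have "i = 1 \<or> i = 2" by auto
    then show "(if i = 1 then vx else vy) ^ Poly_Mapping.lookup t i = mp_var i ^ Poly_Mapping.lookup t i"
      by (auto simp: vx_def vy_def)
  qed
  then show ?thesis by simp
qed

lemma mp_subst_eq_subst2:
  assumes "p \<in> carrier (mp_ring 2)"
  shows "mp_subst \<phi> p = subst2 (\<phi> 1) (\<phi> 2) p"
  using mp_subst_subst2[of \<phi> vx vy p] subst2_vx_vy[OF assms] by (simp add: vx_def vy_def)

text \<open>
  The ideal is taken among the polynomials in all variables, so that membership carries no condition on
  the cofactors; \<open>pow_ideal_eq\<close> cuts it down to the polynomials in \<open>x\<close> and \<open>y\<close>.
\<close>

definition trunc :: "nat \<Rightarrow> 'a::comm_ring_1 mp set" where
  "trunc N = {vx ^ N * a + vy ^ N * b | a b. True}"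

lemma truncI: "vx ^ N * a + vy ^ N * b \<in> trunc N"
  by (auto simp: trunc_def)

lemma trunc_0 [simp]: "0 \<in> trunc N" using truncI[of N 0 0] by simp

lemma trunc_add: "p \<in> trunc N \<Longrightarrow> p' \<in> trunc N \<Longrightarrow> p + p' \<in> trunc N"
proof -
  assume "p \<in> trunc N" "p' \<in> trunc N"
  then obtain a b a' b' where "p = vx ^ N * a + vy ^ N * b" "p' = vx ^ N * a' + vy ^ N * b'"
    by (auto simp: trunc_def)
  then have "p + p' = vx ^ N * (a + a') + vy ^ N * (b + b')" by (simp add: algebra_simps)
  then show ?thesis by (simp only: truncI)
qed

lemma trunc_mult: "p \<in> trunc N \<Longrightarrow> p' * p \<in> trunc N"
proof -
  assume "p \<in> trunc N"
  then obtain a b where "p = vx ^ N * a + vy ^ N * b" by (auto simp: trunc_def)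
  then have "p' * p = vx ^ N * (p' * a) + vy ^ N * (p' * b)" by (simp add: algebra_simps)
  then show ?thesis by (simp only: truncI)
qed

lemma trunc_mult_right: "p \<in> trunc N \<Longrightarrow> p * p' \<in> trunc N"
  using trunc_mult[of p N p'] by (simp add: mult.commute)

lemma trunc_uminus: "p \<in> trunc N \<Longrightarrow> - p \<in> trunc N"
  using trunc_mult[of p N "- 1"] by simp

lemma trunc_diff: "p \<in> trunc N \<Longrightarrow> p' \<in> trunc N \<Longrightarrow> p - p' \<in> trunc N"
  using trunc_add[of p N "- p'"] trunc_uminus[of p' N] by simp

lemma trunc_sum: "(\<And>x. x \<in> A \<Longrightarrow> f x \<in> trunc N) \<Longrightarrow> sum f A \<in> trunc N"
  by (induction A rule: infinite_finite_induct) (auto intro: trunc_add)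

lemma trunc_trans: "p - p' \<in> trunc N \<Longrightarrow> p' - p'' \<in> trunc N \<Longrightarrow> p - p'' \<in> trunc N"
  using trunc_add[of "p - p'" N "p' - p''"] by simp

lemma trunc_sym: "p - p' \<in> trunc N \<Longrightarrow> p' - p \<in> trunc N"
  using trunc_uminus[of "p - p'" N] by simp

lemma vx_power_trunc: "N \<le> n \<Longrightarrow> vx ^ n \<in> trunc N"
proof -
  assume "N \<le> n"
  then have "(vx :: 'a mp) ^ n = vx ^ N * vx ^ (n - N) + vy ^ N * 0" by (simp flip: power_add)
  then show "(vx :: 'a mp) ^ n \<in> trunc N" by (simp only: truncI)
qed

lemma vy_power_trunc: "N \<le> n \<Longrightarrow> vy ^ n \<in> trunc N"
proof -
  assume "N \<le> n"
  then have "(vy :: 'a mp) ^ n = vx ^ N * 0 + vy ^ N * vy ^ (n - N)" by (simp flip: power_add)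
  then show "(vy :: 'a mp) ^ n \<in> trunc N" by (simp only: truncI)
qed

lemma subst2_trunc:
  assumes "p \<in> trunc N" "P ^ N \<in> trunc N" "Q ^ N \<in> trunc N"
  shows "subst2 P Q p \<in> trunc N"
proof -
  from assms(1) obtain a b where "p = vx ^ N * a + vy ^ N * b" by (auto simp: trunc_def)
  then show ?thesis using assms by (auto simp: subst2_hom intro!: trunc_add trunc_mult_right)
qed

lemma coef_trunc:
  assumes "p \<in> trunc N" "i < N" "j < N"
  shows "coef p i j = 0"
proof -
  have "coef (mp_var k ^ N * a) i j = 0" if "k = 1 \<or> k = 2" for k and a :: "'a mp"
  proof -
    have *: "mp_var k ^ N * a = (\<Sum>t\<in>Poly_Mapping.keys a.
        Poly_Mapping.single (Poly_Mapping.single k N + t) (Poly_Mapping.lookup a t))"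
      by (subst mp_sum_single[of a]) (simp add: mp_var_power sum_distrib_left mult_single)
    have "Poly_Mapping.single k N + t \<noteq> expo i j" for t
    proof
      assume "Poly_Mapping.single k N + t = expo i j"
      from arg_cong[OF this, of "\<lambda>t. Poly_Mapping.lookup t k"] show False
        using that assms by (auto simp: expo_def lookup_add lookup_single)
    qed
    then show ?thesis
      unfolding * by (simp add: coef_def lookup_sum lookup_single when_def)
  qed
  from this[of 1] this[of 2] show ?thesis
    using assms(1) by (auto simp: trunc_def coef_add vx_def vy_def)
qed

lemma reduce_mod_trunc:
  assumes "p \<in> carrier (mp_ring 2)"
  shows "p - (\<Sum>i<N. \<Sum>j<N. mp_const (coef p i j) * vx ^ i * vy ^ j) \<in> trunc N"
proof -
  let ?r = "\<lambda>p. \<Sum>i<N. \<Sum>j<N. mp_const (coef p i j) * vx ^ i * vy ^ j"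
  have mono: "mp_const c * vx ^ a * vy ^ b - ?r (mp_const c * vx ^ a * vy ^ b) \<in> trunc N" for c a b
  proof (cases "a < N \<and> b < N")
    case True
    have "?r (mp_const c * vx ^ a * vy ^ b)
        = (\<Sum>i<N. \<Sum>j<N. if i = a \<and> j = b then mp_const c * vx ^ i * vy ^ j else 0)"
      by (intro sum.cong refl) (auto simp: coef_monomial)
    also have "\<dots> = (\<Sum>i<N. if i = a then mp_const c * vx ^ i * vy ^ b else 0)"
      using True by (intro sum.cong refl) auto
    also have "\<dots> = mp_const c * vx ^ a * vy ^ b" using True by auto
    finally show ?thesis by simp
  next
    case False
    then have "vx ^ a \<in> trunc N \<or> vy ^ b \<in> trunc N"
      using vx_power_trunc[of N a] vy_power_trunc[of N b] by auto
    then have "mp_const c * vx ^ a * vy ^ b \<in> trunc N"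
      by (auto intro: trunc_mult trunc_mult_right)
    moreover have "?r (mp_const c * vx ^ a * vy ^ b) = 0"
      using False by (intro sum.neutral ballI) (auto simp: coef_monomial)
    ultimately show ?thesis by simp
  qed
  have add: "sum f A - ?r (sum f A) = (\<Sum>x\<in>A. f x - ?r (f x))" for f :: "(nat \<Rightarrow>\<^sub>0 nat) \<Rightarrow> 'a mp" and A
    by (induction A rule: infinite_finite_induct)
      (simp_all add: coef_add mp_const_add distrib_right sum.distrib)
  have "subst2 vx vy p - ?r (subst2 vx vy p) \<in> trunc N"
    unfolding subst2_vx_vy_monomials add by (intro trunc_sum mono)
  then show ?thesis using subst2_vx_vy[OF assms] by simp
qed

lemma truncI_coef:
  assumes "p \<in> carrier (mp_ring 2)" "\<And>i j. i < N \<Longrightarrow> j < N \<Longrightarrow> coef p i j = 0"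
  shows "p \<in> trunc N"
  using reduce_mod_trunc[OF assms(1), of N] assms(2) by simp

lemma pow_ideal_eq:
  "pow_ideal m 2 = trunc (CARD('a) ^ m) \<inter> carrier (mp_ring 2 :: 'a::{field,finite} mp ring)"
  (is "_ = ?I")
proof -
  let ?R = "mp_ring 2 :: 'a mp ring" and ?N = "CARD('a) ^ m"
  interpret cring ?R by (rule cring_mp_ring)
  have gens: "(\<lambda>i. mp_var i ^ ?N) ` {1..2} = {vx ^ ?N, vy ^ ?N :: 'a mp}"
    by (auto simp: numeral_2_eq_2 atLeastAtMostSuc_conv vx_def vy_def)
  have sub: "{vx ^ ?N, vy ^ ?N} \<subseteq> carrier ?R" by (auto intro: mp_ring_intros vx_vy_closed)
  have "ideal ?I ?R"
  proof (rule idealI[OF ring_axioms])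
    show "subgroup ?I (add_monoid ?R)"
    proof (rule add.subgroupI)
      fix a assume a: "a \<in> ?I"
      have "\<ominus>\<^bsub>?R\<^esub> a = - a"
        by (rule minus_equality) (use a in \<open>auto simp: mp_ring_simps intro: mp_ring_closed\<close>)
      then show "\<ominus>\<^bsub>?R\<^esub> a \<in> ?I" using a by (auto intro: trunc_uminus mp_ring_closed)
    qed (auto simp: mp_ring_simps intro: trunc_add mp_ring_closed trunc_0)
  qed (auto simp: mp_ring_simps intro: trunc_mult trunc_mult_right mp_ring_closed)
  then have "genideal ?R {vx ^ ?N, vy ^ ?N} \<subseteq> ?I"
    by (rule genideal_minimal) (auto intro: vx_power_trunc vy_power_trunc mp_ring_intros vx_vy_closed)
  moreover have "?I \<subseteq> genideal ?R {vx ^ ?N, vy ^ ?N}"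
  proof
    fix p assume p: "p \<in> ?I"
    then obtain a b where ab: "p = vx ^ ?N * a + vy ^ ?N * b" by (auto simp: trunc_def)
    interpret G: ideal "genideal ?R {vx ^ ?N, vy ^ ?N}" ?R by (rule genideal_ideal[OF sub])
    have gen: "vx ^ ?N \<in> genideal ?R {vx ^ ?N, vy ^ ?N}" "vy ^ ?N \<in> genideal ?R {vx ^ ?N, vy ^ ?N}"
      using genideal_self[OF sub] by auto
    have "p = vx ^ ?N * subst2 vx vy a + vy ^ ?N * subst2 vx vy b"
      using subst2_vx_vy[of p] p ab by (simp add: subst2_hom)
    moreover have "subst2 vx vy a \<in> carrier ?R" "subst2 vx vy b \<in> carrier ?R"
      by (auto intro: subst2_closed vx_vy_closed)
    ultimately show "p \<in> genideal ?R {vx ^ ?N, vy ^ ?N}"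
      using G.a_closed[OF G.I_r_closed[OF gen(1)] G.I_r_closed[OF gen(2)]]
      by (simp add: mp_ring_simps)
  qed
  ultimately show ?thesis unfolding pow_ideal_def gens by blast
qed

section \<open>The Dickson invariants in two variables\<close>

text \<open>
  This is \<open>(q^k - 1) / (q - 1)\<close>, which is how the bounds of the sets \<open>\<Delta>\<close> and the exponent \<open>q^m - 1\<close> enter.
\<close>

definition qnum :: "nat \<Rightarrow> nat \<Rightarrow> nat" where
  "qnum q k = (\<Sum>i<k. q ^ i)"

lemma qnum_0 [simp]: "qnum q 0 = 0" and qnum_1 [simp]: "qnum q (Suc 0) = 1"
  and qnum_Suc: "qnum q (Suc k) = qnum q k + q ^ k"
  by (simp_all add: qnum_def)

lemma qnum_power: "0 < q \<Longrightarrow> (q - 1) * qnum q k + 1 = q ^ k"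
proof (induction k)
  case (Suc k)
  have "(q - 1) * qnum q (Suc k) + 1 = (q - 1) * q ^ k + ((q - 1) * qnum q k + 1)"
    by (simp add: qnum_Suc distrib_left)
  also have "\<dots> = (q - 1) * q ^ k + q ^ k" using Suc by simp
  also have "\<dots> = q ^ Suc k" using Suc.prems by (simp add: algebra_simps diff_mult_distrib)
  finally show ?case .
qed simp

lemma qnum_mono: "k \<le> l \<Longrightarrow> qnum q k \<le> qnum q l"
  unfolding qnum_def by (rule sum_mono2) auto

lemma qnum_add: "qnum q (s + k) = qnum q s + q ^ s * qnum q k"
  by (induction k) (simp_all add: qnum_Suc algebra_simps power_add)

text \<open>
  The \<open>2 \<times> 2\<close> Moore determinant with exponents \<open>1\<close> and \<open>q^k\<close>. For \<open>k = 1\<close>, its value at \<open>x\<close> and \<open>y\<close> is the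
  product \<open>L\<close> of representatives of all linear forms up to scalars.
\<close>

definition moore :: "nat \<Rightarrow> 'a::{field,finite} mp \<Rightarrow> 'a mp \<Rightarrow> 'a mp" where
  "moore k X Y = X * Y ^ (CARD('a) ^ k) - X ^ (CARD('a) ^ k) * Y"

text \<open>
  A geometric sum in \<open>X^(q - 1)\<close> and \<open>Y^(q - 1)\<close> with two uses: for \<open>M = [m]\<close> it is \<open>\<delta>\<^sub>2\<^sub>;\<^sub>m\<close> of \<open>x^((q - 1) e)\<close>, and
  for \<open>e = 0\<close> and \<open>M = [k]\<close> it is the quotient of the Moore determinants with exponents \<open>q^k\<close> and \<open>q\<close>.
\<close>

definition dsum :: "nat \<Rightarrow> nat \<Rightarrow> 'a::{field,finite} mp \<Rightarrow> 'a mp \<Rightarrow> 'a mp" where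
  "dsum M e X Y = (\<Sum>i=e..<M. X ^ ((CARD('a) - 1) * i) * Y ^ ((CARD('a) - 1) * (M + e - 1 - i)))"

lemma subst2_moore [simp]: "subst2 P Q (moore k X Y) = moore k (subst2 P Q X) (subst2 P Q Y)"
  by (simp add: moore_def subst2_hom)

lemma subst2_dsum [simp]: "subst2 P Q (dsum M e X Y) = dsum M e (subst2 P Q X) (subst2 P Q Y)"
  by (simp add: dsum_def subst2_hom)

lemma moore_1_alt:
  "moore 1 X Y = X * Y * (Y ^ (CARD('a) - 1) - X ^ (CARD('a) - 1))" for X Y :: "'a::{field,finite} mp"
proof -
  have "Z ^ CARD('a) = Z * Z ^ (CARD('a) - 1)" for Z :: "'a mp"
    using card_field_gt_1[where 'a='a] by (simp flip: power_Suc)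
  then show ?thesis by (simp add: moore_def algebra_simps)
qed

lemma moore_mult_dsum:
  fixes X Y :: "'a::{field,finite} mp"
  assumes "e \<le> M"
  shows "moore 1 X Y * dsum M e X Y
    = X * Y * (X ^ ((CARD('a) - 1) * e) * Y ^ ((CARD('a) - 1) * M)
        - X ^ ((CARD('a) - 1) * M) * Y ^ ((CARD('a) - 1) * e))"
proof -
  define u where "u = X ^ (CARD('a) - 1)"
  define v where "v = Y ^ (CARD('a) - 1)"
  define n where "n = M - e"
  have M: "M = n + e" using assms by (simp add: n_def)
  have "dsum M e X Y = (\<Sum>i=e..<M. u ^ i * v ^ (M + e - 1 - i))"
    by (simp add: dsum_def u_def v_def power_mult)
  also have "\<dots> = (\<Sum>i<n. u ^ (i + e) * v ^ (n - Suc i + e))"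
    by (rule sum.reindex_bij_witness[of _ "\<lambda>i. i + e" "\<lambda>i. i - e"]) (auto simp: M intro!: arg_cong[of _ _ "\<lambda>k. _ * v ^ k"])
  also have "\<dots> = (u * v) ^ e * (\<Sum>i<n. u ^ (n - Suc i) * v ^ i)"
  proof -
    have "(\<Sum>i<n. u ^ (i + e) * v ^ (n - Suc i + e)) = (\<Sum>i<n. u ^ (n - Suc i + e) * v ^ (i + e))"
      by (rule sum.reindex_bij_witness[of _ "\<lambda>i. n - Suc i" "\<lambda>i. n - Suc i"]) auto
    then show ?thesis by (simp only: sum_distrib_left power_add power_mult_distrib mult_ac)
  qed
  finally have "(v - u) * dsum M e X Y = (u * v) ^ e * (v ^ n - u ^ n)"
    unfolding power_diff_sumr2[of v n u] by (simp add: mult_ac)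
  also have "\<dots> = u ^ e * v ^ M - u ^ M * v ^ e"
    by (simp add: M algebra_simps power_mult_distrib power_add)
  finally show ?thesis
    unfolding moore_1_alt by (simp add: u_def v_def power_mult mult.assoc)
qed

text \<open>
  For \<open>b \<noteq> 0\<close>, as polynomials in \<open>a\<close>, both sides are monic of degree \<open>q\<close> with the \<open>q\<close> roots \<open>- c b\<close>.
\<close>

lemma prod_affine_line:
  fixes a b :: "'a::{field,finite} mp"
  shows "(\<Prod>c\<in>UNIV. a + mp_const c * b) = a ^ CARD('a) - b ^ (CARD('a) - 1) * a"
proof (cases "b = 0")
  case True
  then show ?thesis using card_field_gt_1[where 'a='a] by (simp add: power_0_left)
next
  case False
  let ?q = "CARD('a)"
  have b: "b * b ^ (?q - 1) = b ^ ?q"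
    using card_field_gt_1[where 'a='a] by (simp flip: power_Suc)
  define P where "P = (\<Prod>c\<in>UNIV. [:mp_const c * b, 1:])"
  define Q where "Q = monom 1 ?q - monom (b ^ (?q - 1)) 1"
  have degP: "degree P = ?q" unfolding P_def by (subst degree_prod_eq_sum_degree) auto
  have "lead_coeff P = 1" unfolding P_def by (subst lead_coeff_prod) auto
  have "P = Q"
  proof (rule poly_eqI_degree_lead_coeff[where n = ?q and A = "range (\<lambda>d. - (mp_const d * b))"])
    show "Polynomial.coeff P ?q = Polynomial.coeff Q ?q"
      using \<open>lead_coeff P = 1\<close> degP card_field_gt_1[where 'a='a] by (simp add: Q_def)
    have "inj (\<lambda>d. - (mp_const d * b))" using False by (auto simp: inj_def)
    then show "?q \<le> card (range (\<lambda>d. - (mp_const d * b)))" by (simp add: card_image)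
    show "degree Q \<le> ?q" unfolding Q_def
      using card_field_gt_1[where 'a='a]
      by (intro degree_diff_le) (auto simp: degree_monom_le intro: order_trans[OF degree_monom_le])
    fix z assume "z \<in> range (\<lambda>d. - (mp_const d * b))"
    then obtain d where z: "z = - (mp_const d * b)" by auto
    have "poly P z = 0"
      unfolding P_def poly_prod by (rule prod_zero) (auto intro!: bexI[of _ d] simp: z)
    moreover have "poly Q z = 0"
    proof -
      have "z ^ ?q = mp_const (- d) * b ^ ?q"
        unfolding z using mp_frobenius_const[of "- d" 1]
        by (simp add: power_mult_distrib flip: mult_minus_left mp_const_uminus)
      then show ?thesis using b
        by (simp add: Q_def poly_monom z mp_const_uminus mult.left_commute mult.commute)
    qed
    ultimately show "poly P z = poly Q z" by simp
  qed (simp add: degP)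
  then have "poly P a = poly Q a" by simp
  then show ?thesis by (simp add: P_def Q_def poly_prod poly_monom add.commute)
qed

lemma moore_1_prod: "moore 1 X Y = X * (\<Prod>c\<in>UNIV. Y + mp_const c * X)" for X Y :: "'a::{field,finite} mp"
proof -
  have "X * X ^ (CARD('a) - 1) = X ^ CARD('a)"
    using card_field_gt_1[where 'a='a] by (simp flip: power_Suc)
  then show ?thesis by (simp add: prod_affine_line moore_def right_diff_distrib flip: mult.assoc)
qed

lemma vx_power_eq_iff: "vx ^ i = (vx ^ j :: 'a::comm_ring_1 mp) \<longleftrightarrow> i = j"
proof
  assume "vx ^ i = (vx ^ j :: 'a mp)"
  then have "coef (mp_const 1 * vx ^ i * vy ^ 0) i 0 = coef (mp_const (1 :: 'a) * vx ^ j * vy ^ 0) i 0"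
    by simp
  then show "i = j" unfolding coef_monomial by (auto split: if_splits)
qed auto

text \<open>
  The polynomial ring is infinite, whereas the ground field is not: the powers of \<open>x\<close> serve as evaluation
  points.
\<close>

lemma mp_poly_eqI:
  fixes P Q :: "'a::idom mp poly"
  assumes "\<And>t. poly P t = poly Q t"
  shows "P = Q"
proof (rule poly_eqI_degree[where A = "(\<lambda>n. vx ^ n) ` {..degree P + degree Q}"])
  have "inj_on (\<lambda>n. vx ^ n :: 'a mp) {..degree P + degree Q}" by (auto simp: inj_on_def vx_power_eq_iff)
  then show "card ((\<lambda>n. vx ^ n :: 'a mp) ` {..degree P + degree Q}) > degree P"
    "card ((\<lambda>n. vx ^ n :: 'a mp) ` {..degree P + degree Q}) > degree Q" by (simp_all add: card_image)
qed (rule assms)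

text \<open>
  The product of the linear forms \<open>y + c x\<close> over all \<open>c\<close> in the field, that is, of the translates of \<open>y\<close>
  under \<open>y \<mapsto> y + x\<close>.
\<close>

definition y_orbit :: "'a::{field,finite} mp" where
  "y_orbit = vy ^ CARD('a) - vx ^ (CARD('a) - 1) * vy"

text \<open>
  The two Dickson invariants, in the form that shows how they behave under linear substitutions:
  \<open>q0\<close> is a power of a Moore determinant and \<open>q1\<close> a quotient of two. The lemma \<open>dickson_2\<close> identifies
  them.
\<close>

definition q0 :: "'a::{field,finite} mp" where "q0 = moore 1 vx vy ^ (CARD('a) - 1)"
definition q1 :: "'a::{field,finite} mp" where "q1 = dsum (CARD('a) + 1) 0 vx vy"

lemma vx_neq_0: "vx \<noteq> (0 :: 'a::comm_ring_1 mp)" and vy_neq_0: "vy \<noteq> (0 :: 'a mp)"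
proof -
  have "coef (mp_const 1 * vx ^ 1 * vy ^ 0 :: 'a mp) 1 0 = 1" "coef (mp_const 1 * vx ^ 0 * vy ^ 1 :: 'a mp) 0 1 = 1"
    unfolding coef_monomial by simp_all
  then show "vx \<noteq> (0 :: 'a mp)" "vy \<noteq> (0 :: 'a mp)" by auto
qed

lemma moore_neq_0: "moore 1 vx vy \<noteq> (0 :: 'a::{field,finite} mp)"
proof
  assume "moore 1 vx vy = (0 :: 'a mp)"
  then have "coef (mp_const 1 * vx ^ 1 * vy ^ CARD('a) - mp_const 1 * vx ^ CARD('a) * vy ^ 1 :: 'a mp) 1 (CARD('a)) = 0"
    by (simp add: moore_def)
  then show False unfolding coef_diff coef_monomial using card_field_gt_1[where 'a='a] by simp
qed

lemma q0_alt: "q0 = vx ^ (CARD('a) - 1) * (y_orbit :: 'a::{field,finite} mp) ^ (CARD('a) - 1)"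
proof -
  have "moore 1 vx vy = vx * (y_orbit :: 'a mp)"
    unfolding moore_1_prod prod_affine_line y_orbit_def ..
  then show "q0 = vx ^ (CARD('a) - 1) * (y_orbit :: 'a mp) ^ (CARD('a) - 1)"
    by (simp add: q0_def power_mult_distrib)
qed

text \<open>
  The product over all linear forms is computed one variable at a time: the forms in \<open>x\<close> alone give
  an additive polynomial \<open>\<phi>\<close>, so translating by the multiples of \<open>y\<close> amounts to translating
  \<open>\<phi>\<close> by the multiples of \<open>\<phi>(y)\<close>.
\<close>

lemma prod_linear_forms:
  fixes t :: "'a::{field,finite} mp"
  shows "(\<Prod>b\<in>UNIV. \<Prod>a\<in>UNIV. t + mp_const b * vy + mp_const a * vx)
    = t ^ (CARD('a) ^ 2) - (vx ^ ((CARD('a) - 1) * CARD('a)) + y_orbit ^ (CARD('a) - 1)) * t ^ CARD('a) + q0 * t"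
proof -
  let ?q = "CARD('a)"
  define \<phi> where "\<phi> = (\<lambda>s :: 'a mp. s ^ ?q - vx ^ (?q - 1) * s)"
  have frob: "(s + mp_const b * r) ^ ?q = s ^ ?q + mp_const b * r ^ ?q" for s r :: "'a mp" and b
    using mp_frobenius_add[of s "mp_const b * r" 1] mp_frobenius_const[of b 1] by (simp add: power_mult_distrib)
  have "(\<Prod>b\<in>UNIV. \<Prod>a\<in>UNIV. t + mp_const b * vy + mp_const a * vx)
      = (\<Prod>b\<in>UNIV. \<phi> t + mp_const b * y_orbit)"
    by (intro prod.cong refl) (simp only: prod_affine_line frob \<phi>_def y_orbit_def, simp add: algebra_simps)
  also have "\<dots> = \<phi> t ^ ?q - y_orbit ^ (?q - 1) * \<phi> t" by (rule prod_affine_line)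
  also have "\<phi> t ^ ?q = t ^ (?q ^ 2) - vx ^ ((?q - 1) * ?q) * t ^ ?q"
    using mp_frobenius_diff[of "t ^ ?q" "vx ^ (?q - 1) * t" 1]
    by (simp add: \<phi>_def power_mult_distrib power_mult power2_eq_square)
  finally show ?thesis by (simp add: \<phi>_def q0_alt algebra_simps)
qed

text \<open>
  The product over all linear forms vanishes at each of them.
\<close>

lemma root_vx: "vx ^ (CARD('a) ^ 2)
     = (vx ^ ((CARD('a) - 1) * CARD('a)) + y_orbit ^ (CARD('a) - 1)) * vx ^ CARD('a) - q0 * (vx :: 'a::{field,finite} mp)"
  and root_vy: "vy ^ (CARD('a) ^ 2)
     = (vx ^ ((CARD('a) - 1) * CARD('a)) + y_orbit ^ (CARD('a) - 1)) * vy ^ CARD('a) - q0 * (vy :: 'a mp)"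
proof -
  have "(\<Prod>b\<in>UNIV. \<Prod>a\<in>UNIV. t + mp_const b * vy + mp_const a * vx) = 0"
    if "t = vx \<or> t = vy" for t :: "'a mp"
    using that
  proof
    assume "t = vx"
    then show ?thesis
      by - (rule prod_zero[OF finite], rule bexI[of _ 0], rule prod_zero[OF finite], rule bexI[of _ "-1"],
        simp_all add: mp_const_uminus)
  next
    assume "t = vy"
    then show ?thesis
      by - (rule prod_zero[OF finite], rule bexI[of _ "-1"], rule prod_zero[OF finite], rule bexI[of _ 0],
        simp_all add: mp_const_uminus)
  qed
  from this[of vx] this[of vy]
  show "vx ^ (CARD('a) ^ 2)
     = (vx ^ ((CARD('a) - 1) * CARD('a)) + y_orbit ^ (CARD('a) - 1)) * vx ^ CARD('a) - q0 * (vx :: 'a mp)"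
   "vy ^ (CARD('a) ^ 2)
     = (vx ^ ((CARD('a) - 1) * CARD('a)) + y_orbit ^ (CARD('a) - 1)) * vy ^ CARD('a) - q0 * (vy :: 'a mp)"
    unfolding prod_linear_forms by (simp_all add: algebra_simps eq_neg_iff_add_eq_0)
qed

lemma moore_eq_beta: "moore k vx vy = moore 1 vx vy * (dsum (qnum CARD('a) k) 0 vx vy :: 'a::{field,finite} mp)"
proof -
  have e: "Suc ((CARD('a) - 1) * qnum CARD('a) k) = CARD('a) ^ k" using qnum_power[of "CARD('a)" k] by simp
  have "moore 1 vx vy * (dsum (qnum CARD('a) k) 0 vx vy :: 'a mp)
      = vx * vy ^ (Suc ((CARD('a) - 1) * qnum CARD('a) k)) - vx ^ (Suc ((CARD('a) - 1) * qnum CARD('a) k)) * vy"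
    by (subst moore_mult_dsum) (simp_all add: algebra_simps)
  then show ?thesis unfolding e by (simp add: moore_def)
qed

text \<open>
  Both expressions are the quotient of the Moore determinants with exponents \<open>q^2\<close> and \<open>q\<close>.
\<close>

lemma q1_alt: "q1 = vx ^ ((CARD('a) - 1) * CARD('a)) + (y_orbit :: 'a::{field,finite} mp) ^ (CARD('a) - 1)"
proof -
  let ?Q = "vx ^ ((CARD('a) - 1) * CARD('a)) + (y_orbit :: 'a mp) ^ (CARD('a) - 1)"
  have "moore 2 vx vy = moore 1 vx vy * ?Q"
    unfolding moore_def[of 2] root_vx root_vy by (simp add: moore_def algebra_simps)
  moreover have "moore 2 vx vy = moore 1 vx vy * (q1 :: 'a mp)"
    using moore_eq_beta[of 2, where 'a='a] by (simp add: q1_def qnum_def numeral_2_eq_2)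
  ultimately show ?thesis using moore_neq_0 by (metis mult_left_cancel)
qed

lemma q_roots:
  assumes "z = vx \<or> z = (vy :: 'a::{field,finite} mp)"
  shows "z ^ (CARD('a) ^ 2) = q1 * z ^ CARD('a) - q0 * z"
  using assms root_vx root_vy by (auto simp: q1_alt)

lemma prod_PiE_1: "(\<Prod>\<mu>\<in>{1..1::nat} \<rightarrow>\<^sub>E (UNIV :: 'a::finite set). f (\<mu> 1)) = (\<Prod>a\<in>UNIV. f a)"
  by (rule prod.reindex_bij_witness[of _ "\<lambda>a. restrict (\<lambda>_. a) {1..1}" "\<lambda>\<mu>. \<mu> 1"])
    (auto simp: PiE_def extensional_def restrict_def)

lemma prod_PiE_2:
  "(\<Prod>\<mu>\<in>{1..2::nat} \<rightarrow>\<^sub>E (UNIV :: 'a::finite set). f (\<mu> 1) (\<mu> 2)) = (\<Prod>b\<in>UNIV. \<Prod>a\<in>UNIV. f a b)"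
proof -
  have set: "{1..2::nat} = {1, 2}" by auto
  have "(\<Prod>\<mu>\<in>{1..2::nat} \<rightarrow>\<^sub>E (UNIV :: 'a set). f (\<mu> 1) (\<mu> 2)) = (\<Prod>(b, a)\<in>UNIV \<times> UNIV. f a b)"
    by (rule prod.reindex_bij_witness[of _ "\<lambda>(b, a). restrict (\<lambda>i. if i = 1 then a else b) {1, 2}"
          "\<lambda>\<mu>. (\<mu> 2, \<mu> 1)"])
      (auto simp: set PiE_def extensional_def restrict_def)
  then show ?thesis by (simp add: prod.cartesian_product)
qed

lemma dickson_1_0: "dickson 1 0 = (vx ^ (CARD('a) - 1) :: 'a::{field,finite} mp)"
proof -
  have "dickson_poly 1 = (monom 1 CARD('a) - monom (vx ^ (CARD('a) - 1)) 1 :: 'a mp poly)"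
  proof (rule mp_poly_eqI)
    fix t :: "'a mp"
    have "poly (dickson_poly 1) t
        = (\<Prod>\<mu>\<in>{1..1::nat} \<rightarrow>\<^sub>E (UNIV :: 'a set). t + mp_const (\<mu> 1) * vx)"
      by (simp add: dickson_poly_def poly_prod vx_def add.commute)
    also have "\<dots> = t ^ CARD('a) - vx ^ (CARD('a) - 1) * t"
      using prod_PiE_1[of "\<lambda>c. t + mp_const c * vx"] prod_affine_line[of t vx] by simp
    finally show "poly (dickson_poly 1) t = poly (monom 1 CARD('a) - monom (vx ^ (CARD('a) - 1)) 1) t"
      by (simp add: poly_monom)
  qed
  then show ?thesis using card_field_gt_1[where 'a='a] by (simp add: dickson_def)
qed

lemma dickson_2: "dickson 2 0 = (q0 :: 'a::{field,finite} mp)" "dickson 2 1 = (q1 :: 'a mp)"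
proof -
  let ?q = "CARD('a)"
  have sum2: "(\<Sum>i\<in>{1..2::nat}. f i) = f 1 + f 2" for f :: "nat \<Rightarrow> 'a mp"
    by (simp add: numeral_2_eq_2)
  have *: "dickson_poly 2 = (monom 1 (?q ^ 2) - monom q1 ?q + monom q0 1 :: 'a mp poly)"
  proof (rule mp_poly_eqI)
    fix t :: "'a mp"
    have "poly (dickson_poly 2) t
        = (\<Prod>\<mu>\<in>{1..2::nat} \<rightarrow>\<^sub>E (UNIV :: 'a set). t + mp_const (\<mu> 2) * vy + mp_const (\<mu> 1) * vx)"
      unfolding dickson_poly_def poly_prod by (intro prod.cong refl) (simp only: sum2, simp add: vx_def vy_def algebra_simps)
    also have "\<dots> = (\<Prod>b\<in>UNIV. \<Prod>a\<in>UNIV. t + mp_const b * vy + mp_const a * vx)"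
      by (rule prod_PiE_2)
    finally show "poly (dickson_poly 2) t = poly (monom 1 (?q ^ 2) - monom q1 ?q + monom q0 1) t"
      by (simp add: prod_linear_forms q1_alt poly_monom)
  qed
  have "1 < ?q" by (rule card_field_gt_1)
  then have "?q < ?q ^ 2" by (simp add: power2_eq_square)
  then show "dickson 2 0 = (q0 :: 'a mp)" "dickson 2 1 = (q1 :: 'a mp)"
    using \<open>1 < ?q\<close> by (simp_all add: dickson_def *)
qed

section \<open>The algebra generated by the Dickson invariants\<close>

inductive_set dickson_ring :: "'a::{field,finite} mp set" where
  zero: "0 \<in> dickson_ring"
| add: "p \<in> dickson_ring \<Longrightarrow> p' \<in> dickson_ring \<Longrightarrow> p + p' \<in> dickson_ring"
| monomial: "mp_const c * q1 ^ a * q0 ^ b \<in> dickson_ring"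

lemma dickson_ring_mult: "p \<in> dickson_ring \<Longrightarrow> p' \<in> dickson_ring \<Longrightarrow> p * p' \<in> dickson_ring"
proof (induction p rule: dickson_ring.induct)
  case (monomial c a b)
  from \<open>p' \<in> dickson_ring\<close> show ?case
  proof (induction p' rule: dickson_ring.induct)
    case (monomial c' a' b')
    have "mp_const c * q1 ^ a * q0 ^ b * (mp_const c' * q1 ^ a' * q0 ^ b')
        = mp_const (c * c') * q1 ^ (a + a') * q0 ^ (b + b')"
      by (simp add: mp_const_mult power_add mult_ac)
    then show ?case by (simp only: dickson_ring.monomial)
  qed (auto simp: distrib_left intro: dickson_ring.intros)
qed (auto simp: distrib_right intro: dickson_ring.intros)

lemma dickson_ring_const: "mp_const c \<in> dickson_ring" using dickson_ring.monomial[of c 0 0] by simp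
lemma dickson_ring_q1: "q1 \<in> dickson_ring" using dickson_ring.monomial[of 1 1 0] by simp
lemma dickson_ring_q0: "q0 \<in> dickson_ring" using dickson_ring.monomial[of 1 0 1] by simp
lemma dickson_ring_power: "p \<in> dickson_ring \<Longrightarrow> p ^ n \<in> dickson_ring"
  using dickson_ring_const[of 1] by (induction n) (auto intro: dickson_ring_mult)
lemma dickson_ring_uminus: "p \<in> dickson_ring \<Longrightarrow> - p \<in> dickson_ring"
  using dickson_ring_mult[OF dickson_ring_const[of "-1"], of p] by (simp add: mp_const_uminus)
lemma dickson_ring_diff: "p \<in> dickson_ring \<Longrightarrow> p' \<in> dickson_ring \<Longrightarrow> p - p' \<in> dickson_ring"
  using dickson_ring.add[OF _ dickson_ring_uminus, of p p'] by simp

lemmas dickson_ring_intros = dickson_ring.intros(1,2) dickson_ring_mult dickson_ring_const dickson_ring_q1 dickson_ring_q0 dickson_ring_power dickson_ring_uminus dickson_ring_diff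

lemma moore_linear:
  "moore k (mp_const a * vx + mp_const b * vy) (mp_const c * vx + mp_const d * vy)
     = mp_const (a * d - b * c) * moore k vx (vy :: 'a::{field,finite} mp)"
  by (simp add: moore_def mp_frobenius_add power_mult_distrib mp_frobenius_const
      mp_const_diff mp_const_mult algebra_simps)

lemma subst2_q0:
  fixes a b c d :: "'a::{field,finite}"
  assumes "a * d - b * c \<noteq> 0"
  shows "subst2 (mp_const a * vx + mp_const b * vy) (mp_const c * vx + mp_const d * vy) q0 = q0"
  using power_card_minus_1_eq[OF assms]
  by (simp add: q0_def subst2_hom moore_linear power_mult_distrib flip: mp_const_power)

text \<open>
  A linear substitution multiplies every Moore determinant by its own determinant, so quotients of Moore
  determinants are invariant.
\<close>

lemma subst2_beta:
  fixes a b c d :: "'a::{field,finite}"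
  assumes "a * d - b * c \<noteq> 0"
  shows "dsum (qnum CARD('a) k) 0 (mp_const a * vx + mp_const b * vy) (mp_const c * vx + mp_const d * vy)
    = dsum (qnum CARD('a) k) 0 vx vy"
proof -
  let ?s = "subst2 (mp_const a * vx + mp_const b * vy) (mp_const c * vx + mp_const d * vy)"
  let ?D = "dsum (qnum CARD('a) k) 0 vx vy"
  have "mp_const (a * d - b * c) * moore 1 vx vy * ?D = mp_const (a * d - b * c) * moore k vx vy"
    by (simp only: moore_eq_beta[of k] mult.assoc)
  also have "\<dots> = ?s (moore k vx vy)" by (simp add: moore_linear)
  also have "\<dots> = ?s (moore 1 vx vy * ?D)" by (simp only: moore_eq_beta[of k])
  also have "\<dots> = mp_const (a * d - b * c) * moore 1 vx vy * ?s ?D"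
    by (simp only: subst2_hom subst2_moore subst2_vx subst2_vy moore_linear)
  finally have "mp_const (a * d - b * c) * moore 1 vx vy * ?D = mp_const (a * d - b * c) * moore 1 vx vy * ?s ?D" .
  moreover have "mp_const (a * d - b * c) * moore 1 vx vy \<noteq> 0"
    using assms moore_neq_0 mp_const_inject[of _ 0] by (metis mp_const_0 mult_eq_0_iff)
  ultimately have "?s ?D = ?D" by (metis mult_left_cancel)
  then show ?thesis by simp
qed

lemma subst2_q1:
  fixes a b c d :: "'a::{field,finite}"
  assumes "a * d - b * c \<noteq> 0"
  shows "subst2 (mp_const a * vx + mp_const b * vy) (mp_const c * vx + mp_const d * vy) q1 = q1"
  using subst2_beta[OF assms, of 2] by (simp add: q1_def qnum_def numeral_2_eq_2)

lemma subst2_dickson_ring: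
  fixes a b c d :: "'a::{field,finite}"
  assumes "p \<in> dickson_ring" "a * d - b * c \<noteq> 0"
  shows "subst2 (mp_const a * vx + mp_const b * vy) (mp_const c * vx + mp_const d * vy) p = p"
  using assms(1) by induction (simp_all add: subst2_hom subst2_q0[OF assms(2)] subst2_q1[OF assms(2)])

lemma dickson_ring_closed: "p \<in> dickson_ring \<Longrightarrow> p \<in> carrier (mp_ring 2)"
  by (induction rule: dickson_ring.induct)
    (auto simp: q0_def q1_def moore_def dsum_def intro!: mp_ring_intros vx_vy_closed)

lemma moore_rec:
  "moore (k + 2) vx vy = q1 ^ (CARD('a) ^ k) * moore (k + 1) vx vy
     - q0 ^ (CARD('a) ^ k) * moore k vx (vy :: 'a::{field,finite} mp)"
proof -
  have *: "z ^ (CARD('a) ^ (k + 2)) = q1 ^ (CARD('a) ^ k) * z ^ (CARD('a) ^ (k + 1)) - q0 ^ (CARD('a) ^ k) * z ^ (CARD('a) ^ k)"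
    if "z = vx \<or> z = vy" for z :: "'a mp"
  proof -
    have "CARD('a) ^ (k + 2) = CARD('a) ^ 2 * CARD('a) ^ k" by (simp add: power_add power2_eq_square)
    then have "z ^ (CARD('a) ^ (k + 2)) = (z ^ (CARD('a) ^ 2)) ^ (CARD('a) ^ k)"
      by (simp only: power_mult)
    then show ?thesis
      unfolding q_roots[OF that] mp_frobenius_diff
      by (simp add: power_mult_distrib power_add power_mult)
  qed
  show ?thesis
    unfolding moore_def *[OF disjI1[OF refl]] *[OF disjI2[OF refl]] by (simp add: algebra_simps)
qed

text \<open>
  The recursion for the quotients of Moore determinants reduces modulo \<open>q0\<close> to a product, which
  gives the leading term.
\<close>

lemma beta_leading_term:
  fixes k :: nat
  defines "\<beta> \<equiv> \<lambda>k. dsum (qnum CARD('a) k) 0 vx (vy :: 'a::{field,finite} mp)"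
  shows "\<exists>w\<in>dickson_ring. \<beta> (Suc k) = q1 ^ qnum CARD('a) k + q0 * w"
proof -
  have rec: "\<beta> (Suc (Suc k)) = q1 ^ (CARD('a) ^ k) * \<beta> (Suc k) - q0 ^ (CARD('a) ^ k) * \<beta> k" for k
  proof -
    have "moore 1 vx vy * \<beta> (Suc (Suc k)) = moore 1 vx vy * (q1 ^ (CARD('a) ^ k) * \<beta> (Suc k) - q0 ^ (CARD('a) ^ k) * \<beta> k)"
      using moore_rec[of k, where 'a='a] unfolding \<beta>_def
      by (simp add: moore_eq_beta[of "Suc (Suc k)"] moore_eq_beta[of "Suc k"] moore_eq_beta[of k] algebra_simps)
    then show ?thesis using moore_neq_0 by (metis mult_left_cancel)
  qed
  have "\<beta> k \<in> dickson_ring \<and> (\<exists>w\<in>dickson_ring. \<beta> (Suc k) = q1 ^ qnum CARD('a) k + q0 * w)"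
  proof (induction k)
    case 0
    have "\<beta> 0 = 0" "\<beta> (Suc 0) = 1" by (simp_all add: \<beta>_def dsum_def)
    then show ?case by (auto intro!: dickson_ring.zero bexI[of _ 0])
  next
    case (Suc k)
    then obtain w where w: "w \<in> dickson_ring" "\<beta> (Suc k) = q1 ^ qnum CARD('a) k + q0 * w" by blast
    have "\<beta> (Suc k) \<in> dickson_ring" unfolding w(2) using w(1) by (intro dickson_ring_intros)
    moreover have "\<beta> (Suc (Suc k)) = q1 ^ qnum CARD('a) (Suc k)
        + q0 * (q1 ^ (CARD('a) ^ k) * w - q0 ^ (CARD('a) ^ k - 1) * \<beta> k)"
    proof -
      have "q0 ^ (CARD('a) ^ k) = q0 * (q0 :: 'a mp) ^ (CARD('a) ^ k - 1)"
        by (simp flip: power_Suc)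
      then show ?thesis unfolding rec w(2) by (simp add: qnum_Suc power_add algebra_simps)
    qed
    moreover have "q1 ^ (CARD('a) ^ k) * w - q0 ^ (CARD('a) ^ k - 1) * \<beta> k \<in> dickson_ring"
      using w(1) Suc by (intro dickson_ring_intros) auto
    ultimately show ?case by blast
  qed
  then show ?thesis by blast
qed

section \<open>The trace over the lines of the plane\<close>

definition lin_subst :: "'a::{field,finite} \<Rightarrow> 'a \<Rightarrow> 'a \<Rightarrow> 'a \<Rightarrow> 'a mp \<Rightarrow> 'a mp" where
  "lin_subst a b c d = subst2 (mp_const a * vx + mp_const b * vy) (mp_const c * vx + mp_const d * vy)"

lemma lin_subst_hom: "lin_subst a b c d (p + p') = lin_subst a b c d p + lin_subst a b c d p'"
  "lin_subst a b c d (p - p') = lin_subst a b c d p - lin_subst a b c d p'"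
  "lin_subst a b c d (- p) = - lin_subst a b c d p" "lin_subst a b c d (p * p') = lin_subst a b c d p * lin_subst a b c d p'"
  "lin_subst a b c d (p ^ n) = lin_subst a b c d p ^ n" "lin_subst a b c d (sum f A) = (\<Sum>x\<in>A. lin_subst a b c d (f x))"
  by (simp_all add: lin_subst_def subst2_hom)

lemma lin_subst_simps [simp]:
  "lin_subst a b c d vx = mp_const a * vx + mp_const b * vy"
  "lin_subst a b c d vy = mp_const c * vx + mp_const d * vy"
  "lin_subst a b c d (mp_const e) = mp_const e" "lin_subst a b c d 0 = 0" "lin_subst a b c d 1 = 1"
  by (simp_all add: lin_subst_def)

lemma lin_subst_dickson_ring: "p \<in> dickson_ring \<Longrightarrow> a * d - b * c \<noteq> 0 \<Longrightarrow> lin_subst a b c d p = p"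
  by (simp add: lin_subst_def subst2_dickson_ring)

lemma linear_form_power_trunc:
  fixes a b :: "'a::{field,finite}"
  shows "(mp_const a * vx + mp_const b * vy) ^ (CARD('a) ^ m) \<in> trunc (CARD('a) ^ m)"
  by (simp add: mp_frobenius_add power_mult_distrib trunc_add trunc_mult vx_power_trunc vy_power_trunc)

lemma lin_subst_trunc: "p \<in> trunc (CARD('a) ^ m) \<Longrightarrow> lin_subst a b c (d::'a::{field,finite}) p \<in> trunc (CARD('a) ^ m)"
  unfolding lin_subst_def by (rule subst2_trunc[OF _ linear_form_power_trunc linear_form_power_trunc])

text \<open>
  The sum over \<open>c\<close> of \<open>c^t\<close> vanishes unless \<open>t\<close> is a positive multiple of \<open>q - 1\<close>, when it is \<open>- 1\<close>.
\<close>

lemma power_sum_line: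
  fixes X Y :: "'a::{field,finite} mp"
  assumes "1 \<le> l"
  shows "(\<Sum>c\<in>UNIV. (mp_const c * X + Y) ^ ((CARD('a) - 1) * l))
    = - (\<Sum>j=1..l. of_nat ((CARD('a) - 1) * l choose ((CARD('a) - 1) * j)) *
          X ^ ((CARD('a) - 1) * j) * Y ^ ((CARD('a) - 1) * (l - j)))"
proof -
  define r where "r = CARD('a) - 1"
  have r: "0 < r" using card_field_gt_1[where 'a='a] by (simp add: r_def)
  let ?b = "\<lambda>t. of_nat (r * l choose t) * X ^ t * Y ^ (r * l - t)"
  have "(\<Sum>c\<in>UNIV. (mp_const c * X + Y) ^ (r * l))
      = (\<Sum>c\<in>UNIV. \<Sum>t\<le>r * l. mp_const (c ^ t) * ?b t)"
    by (simp add: binomial_ring power_mult_distrib mp_const_power mult_ac)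
  also have "\<dots> = (\<Sum>t\<le>r * l. \<Sum>c\<in>UNIV. mp_const (c ^ t) * ?b t)" by (rule sum.swap)
  also have "\<dots> = (\<Sum>t\<le>r * l. mp_const (\<Sum>c\<in>UNIV. c ^ t) * ?b t)"
    by (simp add: mp_const_sum sum_distrib_right)
  also have "\<dots> = (\<Sum>t\<in>(\<lambda>j. r * j) ` {1..l}. mp_const (\<Sum>c\<in>UNIV. c ^ t) * ?b t)"
  proof (rule sum.mono_neutral_right)
    show "\<forall>t\<in>{..r * l} - (\<lambda>j. r * j) ` {1..l}. mp_const (\<Sum>c\<in>UNIV. c ^ t) * ?b t = 0"
    proof
      fix t assume t: "t \<in> {..r * l} - (\<lambda>j. r * j) ` {1..l}"
      have "\<not> (0 < t \<and> r dvd t)"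
      proof
        assume *: "0 < t \<and> r dvd t"
        then obtain j where "t = r * j" by blast
        then show False using * t r by auto
      qed
      then show "mp_const (\<Sum>c\<in>UNIV. c ^ t) * ?b t = 0" by (simp only: sum_powers_field r_def if_False mp_const_0 mult_zero_left)
    qed
  qed (use r in auto)
  also have "\<dots> = (\<Sum>j=1..l. mp_const (\<Sum>c\<in>UNIV. c ^ (r * j)) * ?b (r * j))"
    using r by (subst sum.reindex) (auto simp: inj_on_def)
  also have "\<dots> = (\<Sum>j=1..l. - (of_nat (r * l choose (r * j)) * X ^ (r * j) * Y ^ (r * (l - j))))"
  proof (rule sum.cong[OF refl])
    fix j assume "j \<in> {1..l}"
    then have "(\<Sum>c\<in>UNIV. c ^ (r * j)) = (-1 :: 'a)" using r by (simp add: sum_powers_field r_def)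
    then show "mp_const (\<Sum>c\<in>UNIV. c ^ (r * j)) * ?b (r * j)
        = - (of_nat (r * l choose (r * j)) * X ^ (r * j) * Y ^ (r * (l - j)))"
      by (simp add: mp_const_uminus diff_mult_distrib2)
  qed
  finally show ?thesis by (simp add: r_def sum_negf)
qed

text \<open>
  The last base-\<open>q\<close> digits of \<open>(q - 1) l\<close> and \<open>(q - 1) j\<close> are \<open>q - l\<close> and \<open>q - j\<close>.
\<close>

lemma binomial_multiple_eq_0:
  assumes "0 < j" "j < l" "l \<le> CARD('a)"
  shows "of_nat ((CARD('a) - 1) * l choose ((CARD('a) - 1) * j)) = (0 :: 'a::{field,finite})"
proof (rule binomial_last_digit(1))
  have digit: "(CARD('a) - 1) * k mod CARD('a) = CARD('a) - k" if "0 < k" "k \<le> CARD('a)" for k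
  proof -
    have eq: "(CARD('a) - 1) * k = (CARD('a) - k) + CARD('a) * (k - 1)"
      using that by (cases k) (auto simp: algebra_simps diff_mult_distrib)
    show ?thesis unfolding eq mod_mult_self2 using that by (intro mod_less) auto
  qed
  have l: "0 < l" "l \<le> CARD('a)" and j: "0 < j" "j \<le> CARD('a)" using assms by auto
  show "(CARD('a) - 1) * l mod CARD('a) < (CARD('a) - 1) * j mod CARD('a)"
    unfolding digit[OF l] digit[OF j] using assms by simp
qed

text \<open>
  Row \<open>q^m\<close> of the triangle of Pascal vanishes in the field except at its ends, so the entries of the row above
  alternate in sign.
\<close>

lemma binomial_power_minus_1:
  assumes "t \<le> CARD('a) ^ m - 1"
  shows "of_nat (CARD('a) ^ m - 1 choose t) = ((-1) ^ t :: 'a::{field,finite})"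
  using assms
proof (induction t)
  case (Suc t)
  let ?N = "CARD('a) ^ m"
  have N: "?N = Suc (?N - 1)" by simp
  have "coef ((vx + vy :: 'a mp) ^ ?N) (Suc t) (?N - Suc t) = of_nat (?N choose Suc t)"
  proof -
    have "(vx + vy :: 'a mp) ^ ?N = (\<Sum>k\<le>?N. mp_const (of_nat (?N choose k)) * vx ^ k * vy ^ (?N - k))"
      by (simp add: binomial_ring mp_const_of_nat)
    then have "coef ((vx + vy :: 'a mp) ^ ?N) (Suc t) (?N - Suc t)
        = (\<Sum>k\<le>?N. if k = Suc t \<and> ?N - k = ?N - Suc t then of_nat (?N choose k) else 0)"
      by (simp add: coef_sum coef_monomial)
    also have "\<dots> = (\<Sum>k\<le>?N. if k = Suc t then of_nat (?N choose k) else 0)"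
      by (rule sum.cong) auto
    finally show ?thesis using Suc.prems by auto
  qed
  moreover have "coef ((vx + vy :: 'a mp) ^ ?N) (Suc t) (?N - Suc t) = 0"
  proof -
    have *: "(vx + vy :: 'a mp) ^ ?N = mp_const 1 * vx ^ ?N * vy ^ 0 + mp_const 1 * vx ^ 0 * vy ^ ?N"
      by (simp add: mp_frobenius_add)
    show ?thesis unfolding * coef_add coef_monomial using Suc.prems N by auto
  qed
  ultimately have "of_nat (?N choose Suc t) = (0 :: 'a)" by simp
  moreover have "?N choose Suc t = (?N - 1 choose t) + (?N - 1 choose Suc t)"
    by (metis N binomial_Suc_Suc)
  ultimately show ?case using Suc by (simp add: eq_neg_iff_add_eq_0 add.commute)
qed simp

text \<open>
  The sum runs over representatives \<open>x\<close> and \<open>c x + y\<close> of the \<open>q + 1\<close> lines of the plane. For a polynomial that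
  is fixed by the matrices preserving the line of \<open>x\<close>, this is the trace to the full linear group.
\<close>

definition line_trace :: "'a::{field,finite} mp \<Rightarrow> 'a mp" where
  "line_trace F = F + (\<Sum>c\<in>UNIV. lin_subst c 1 1 0 F)"

lemma line_trace_add: "line_trace (F + G) = line_trace F + line_trace G"
  and line_trace_0 [simp]: "line_trace 0 = 0"
  by (simp_all add: line_trace_def lin_subst_hom sum.distrib)

lemma line_trace_dickson_ring_mult: "p \<in> dickson_ring \<Longrightarrow> line_trace (p * F) = p * line_trace F"
  by (simp add: line_trace_def lin_subst_hom lin_subst_dickson_ring sum_distrib_left distrib_left)

lemma line_trace_1: "line_trace 1 = (1 :: 'a::{field,finite} mp)"
  by (simp add: line_trace_def mp_of_nat_card)

text \<open>
  In the power sum only the summand \<open>u^l\<close> of the term for \<open>j = l\<close> survives, and it cancels against the term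
  of the line of \<open>x\<close>.
\<close>

lemma line_trace_u:
  assumes "1 \<le> l" "l \<le> CARD('a)"
  shows "line_trace (vx ^ ((CARD('a) - 1) * l)) = (0 :: 'a::{field,finite} mp)"
proof -
  have "line_trace (vx ^ ((CARD('a) - 1) * l)) = vx ^ ((CARD('a) - 1) * l) -
     (\<Sum>j=1..l. of_nat ((CARD('a) - 1) * l choose ((CARD('a) - 1) * j)) *
          vx ^ ((CARD('a) - 1) * j) * (vy :: 'a mp) ^ ((CARD('a) - 1) * (l - j)))"
    using power_sum_line[OF assms(1), of vx vy] by (simp add: line_trace_def lin_subst_hom)
  also have "(\<Sum>j=1..l. of_nat ((CARD('a) - 1) * l choose ((CARD('a) - 1) * j)) *
          vx ^ ((CARD('a) - 1) * j) * (vy :: 'a mp) ^ ((CARD('a) - 1) * (l - j)))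
      = (\<Sum>j\<in>{l}. of_nat ((CARD('a) - 1) * l choose ((CARD('a) - 1) * j)) *
          vx ^ ((CARD('a) - 1) * j) * (vy :: 'a mp) ^ ((CARD('a) - 1) * (l - j)))"
  proof (rule sum.mono_neutral_right)
    show "\<forall>j\<in>{1..l} - {l}. of_nat ((CARD('a) - 1) * l choose ((CARD('a) - 1) * j)) *
          vx ^ ((CARD('a) - 1) * j) * (vy :: 'a mp) ^ ((CARD('a) - 1) * (l - j)) = 0"
    proof
      fix j assume "j \<in> {1..l} - {l}"
      then have "mp_const (of_nat ((CARD('a) - 1) * l choose ((CARD('a) - 1) * j))) = (0 :: 'a mp)"
        using assms by (subst binomial_multiple_eq_0) auto
      then show "of_nat ((CARD('a) - 1) * l choose ((CARD('a) - 1) * j)) *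
          vx ^ ((CARD('a) - 1) * j) * (vy :: 'a mp) ^ ((CARD('a) - 1) * (l - j)) = 0"
        by (simp add: mp_const_of_nat)
    qed
  qed (use assms in auto)
  finally show ?thesis by simp
qed

text \<open>
  The equation \<open>x^(q^2) = Q\<^sub>1 x^q - Q\<^sub>0 x\<close>, divided by \<open>x\<close>, is the recursion \<open>u^(q + 1) = Q\<^sub>1 u - Q\<^sub>0\<close>.
\<close>

lemma u_rec: "vx ^ ((CARD('a) - 1) * (l + CARD('a) + 1))
    = q1 * vx ^ ((CARD('a) - 1) * (l + 1)) - q0 * (vx :: 'a::{field,finite} mp) ^ ((CARD('a) - 1) * l)"
proof -
  define u :: "'a mp" where "u = vx ^ (CARD('a) - 1)"
  have *: "vx ^ ((CARD('a) - 1) * k) = u ^ k" for k by (simp add: u_def power_mult)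
  have q: "q1 = u ^ CARD('a) + y_orbit ^ (CARD('a) - 1)" "q0 = u * y_orbit ^ (CARD('a) - 1)"
    by (simp_all only: q1_alt q0_alt *) (simp add: u_def)
  show ?thesis unfolding * q by (simp add: algebra_simps power_add)
qed

lemma line_trace_u_dickson_ring: "line_trace (vx ^ ((CARD('a) - 1) * l)) \<in> (dickson_ring :: 'a::{field,finite} mp set)"
proof (induction l rule: less_induct)
  case (less l)
  consider "l = 0" | "1 \<le> l" "l \<le> CARD('a)" | k where "l = k + CARD('a) + 1"
    by (metis One_nat_def Suc_leI add.commute bot_nat_0.not_eq_extremum le_Suc_ex not_less_eq_eq plus_1_eq_Suc add.assoc)
  then show ?case
  proof cases
    case 1
    then show ?thesis using dickson_ring_const[of 1] by (simp add: line_trace_1)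
  next
    case 2
    then show ?thesis by (simp only: line_trace_u dickson_ring.zero)
  next
    case 3
    have "line_trace (vx ^ ((CARD('a) - 1) * l)) = q1 * line_trace (vx ^ ((CARD('a) - 1) * (k + 1)))
       - q0 * line_trace (vx ^ ((CARD('a) - 1) * k) :: 'a mp)"
      using line_trace_add[of "q1 * vx ^ ((CARD('a) - 1) * (k + 1)) - q0 * vx ^ ((CARD('a) - 1) * k) :: 'a mp"
          "q0 * vx ^ ((CARD('a) - 1) * k)"]
      unfolding 3 u_rec by (simp add: line_trace_dickson_ring_mult dickson_ring_q0 dickson_ring_q1 algebra_simps)
    then show ?thesis
      using less[of "k + 1"] less[of k] 3 card_field_gt_1[where 'a='a]
      by (auto intro!: dickson_ring_diff dickson_ring_mult dickson_ring_q0 dickson_ring_q1)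
  qed
qed

text \<open>
  The polynomials in \<open>u\<close> and \<open>V\<close>, which are the invariants of the group of matrices that preserve the line
  of \<open>x\<close>.
\<close>

inductive_set borel_ring :: "'a::{field,finite} mp set" where
  zero: "0 \<in> borel_ring"
| add: "p \<in> borel_ring \<Longrightarrow> p' \<in> borel_ring \<Longrightarrow> p + p' \<in> borel_ring"
| monomial: "mp_const c * vx ^ ((CARD('a) - 1) * i) * y_orbit ^ ((CARD('a) - 1) * j) \<in> (borel_ring :: 'a::{field,finite} mp set)"

text \<open>
  Since \<open>V = Q\<^sub>1 - u^q\<close> and the trace is linear over the Dickson algebra, powers of \<open>V\<close> can be replaced by
  powers of \<open>u\<close>.
\<close>

lemma line_trace_borel_ring: "p \<in> borel_ring \<Longrightarrow> line_trace p \<in> dickson_ring"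
proof (induction p rule: borel_ring.induct)
  case (monomial c i j)
  have "line_trace (vx ^ ((CARD('a) - 1) * i) * y_orbit ^ ((CARD('a) - 1) * j)) \<in> (dickson_ring :: 'a mp set)"
  proof (induction j arbitrary: i)
    case 0
    then show ?case using line_trace_u_dickson_ring[of i] by simp
  next
    case (Suc j)
    have "vx ^ ((CARD('a) - 1) * i) * y_orbit ^ ((CARD('a) - 1) * Suc j)
        = vx ^ ((CARD('a) - 1) * i) * y_orbit ^ ((CARD('a) - 1) * j) * (y_orbit ^ (CARD('a) - 1) :: 'a mp)"
      by (simp only: mult_Suc_right power_add) (simp only: mult_ac)
    also have "\<dots> = vx ^ ((CARD('a) - 1) * i) * y_orbit ^ ((CARD('a) - 1) * j) * (q1 - vx ^ ((CARD('a) - 1) * CARD('a)))"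
      by (simp add: q1_alt)
    also have "\<dots> = q1 * (vx ^ ((CARD('a) - 1) * i) * y_orbit ^ ((CARD('a) - 1) * j)) +
        mp_const (-1) * (vx ^ ((CARD('a) - 1) * (i + CARD('a))) * y_orbit ^ ((CARD('a) - 1) * j))"
      by (simp add: mp_const_uminus right_diff_distrib distrib_left distrib_right power_add mult_ac)
    finally have "line_trace (vx ^ ((CARD('a) - 1) * i) * y_orbit ^ ((CARD('a) - 1) * Suc j) :: 'a mp)
        = q1 * line_trace (vx ^ ((CARD('a) - 1) * i) * y_orbit ^ ((CARD('a) - 1) * j)) +
          mp_const (-1) * line_trace (vx ^ ((CARD('a) - 1) * (i + CARD('a))) * y_orbit ^ ((CARD('a) - 1) * j))"
      by (simp only: line_trace_add line_trace_dickson_ring_mult dickson_ring_q1 dickson_ring_const)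
    then show ?case using Suc by (auto intro!: dickson_ring.add dickson_ring_mult dickson_ring_q1 dickson_ring_const)
  qed
  then show ?case
    unfolding mult.assoc line_trace_dickson_ring_mult[OF dickson_ring_const] by (intro dickson_ring_mult dickson_ring_const)
qed (auto simp: line_trace_add intro: dickson_ring.intros)

text \<open>
  By \<open>binomial_power_minus_1\<close>, all binomial coefficients in the power sum over the lines are \<open>1\<close>. What is left is
  a geometric sum whose terms with an exponent of \<open>P\<close> above \<open>N - 1\<close> are collected in \<open>h\<close>, and whose term with
  exponent equal to \<open>N - 1\<close>, present if \<open>k < M\<close>, cancels against the
  first summand. For linear forms \<open>P\<close>, the power \<open>P^N\<close> lies in the ideal.
\<close>

lemma line_trace_top:
  fixes P Q :: "'a::{field,finite} mp"
  assumes M: "Suc ((CARD('a) - 1) * M) = CARD('a) ^ m" and "1 \<le> M" "k \<le> M"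
  shows "\<exists>h. P ^ ((CARD('a) - 1) * M) * Q ^ ((CARD('a) - 1) * k)
      + (\<Sum>c\<in>UNIV. (mp_const c * P + Q) ^ ((CARD('a) - 1) * M) * P ^ ((CARD('a) - 1) * k))
    = (if k = M then P ^ ((CARD('a) - 1) * M) * Q ^ ((CARD('a) - 1) * M) else - dsum M (k + 1) P Q)
      + P ^ (CARD('a) ^ m) * h"
proof -
  define r where "r = CARD('a) - 1"
  have r: "1 \<le> r" using card_field_gt_1[where 'a='a] by (simp add: r_def)
  define N where "N = CARD('a) ^ m"
  have N: "r * M = N - 1" "0 < N" using M by (simp_all add: r_def N_def)
  have choose: "of_nat (r * M choose (r * j)) = (1 :: 'a mp)" if "j \<le> M" for j
  proof -
    have "of_nat (r * M choose (r * j)) = ((-1) ^ (r * j) :: 'a)"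
      using that N(1) mult_le_mono2[OF that, of r] unfolding N N_def by (intro binomial_power_minus_1) simp
    also have "\<dots> = 1" using minus_one_power_card[where 'a='a] by (simp add: power_mult r_def)
    finally show ?thesis by (metis mp_const_1 mp_const_of_nat)
  qed
  let ?t = "\<lambda>i. P ^ (r * i) * Q ^ (r * (M + k - i))"
  have "(\<Sum>c\<in>UNIV. (mp_const c * P + Q) ^ (r * M) * P ^ (r * k))
      = - (\<Sum>j=1..M. P ^ (r * j) * Q ^ (r * (M - j))) * P ^ (r * k)"
    using power_sum_line[OF \<open>1 \<le> M\<close>, of P Q, folded r_def] by (simp add: choose flip: sum_distrib_right)
  also have "\<dots> = - (\<Sum>j=1..M. P ^ (r * (j + k)) * Q ^ (r * (M - j)))"
    by (simp add: sum_distrib_left sum_distrib_right power_add distrib_left mult_ac)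
  also have "(\<Sum>j=1..M. P ^ (r * (j + k)) * Q ^ (r * (M - j))) = (\<Sum>i=k+1..M+k. ?t i)"
    by (rule sum.reindex_bij_witness[of _ "\<lambda>i. i - k" "\<lambda>j. j + k"]) auto
  finally have sum: "(\<Sum>c\<in>UNIV. (mp_const c * P + Q) ^ (r * M) * P ^ (r * k)) = - (\<Sum>i=k+1..M+k. ?t i)" .
  have high: "\<exists>h. (\<Sum>i=M+1..M+k. ?t i) = P ^ N * h"
  proof
    show "(\<Sum>i=M+1..M+k. ?t i) = P ^ N * (\<Sum>i=M+1..M+k. P ^ (r * i - N) * Q ^ (r * (M + k - i)))"
      unfolding sum_distrib_left
    proof (rule sum.cong[OF refl])
      fix i assume "i \<in> {M+1..M+k}"
      then have "r * (M + 1) \<le> r * i" by (intro mult_le_mono) auto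
      then have "N \<le> r * i" using N r by simp
      then show "?t i = P ^ N * (P ^ (r * i - N) * Q ^ (r * (M + k - i)))"
        by (simp flip: power_add mult.assoc)
    qed
  qed
  then obtain h where h: "(\<Sum>i=M+1..M+k. ?t i) = P ^ N * h" by blast
  show ?thesis
  proof (cases "k = M")
    case True
    then have "(\<Sum>i=k+1..M+k. ?t i) = P ^ N * h" using h by simp
    then show ?thesis using True sum unfolding r_def[symmetric] N_def[symmetric]
      by (intro exI[of _ "- h"]) simp
  next
    case False
    then have "k < M" using assms by simp
    have "(\<Sum>i=k+1..M+k. ?t i) = (\<Sum>i=k+1..<M+1. ?t i) + (\<Sum>i=M+1..M+k. ?t i)"
      using \<open>k < M\<close> by (subst sum.union_disjoint[symmetric]) (auto intro!: sum.cong)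
    also have "(\<Sum>i=k+1..<M+1. ?t i) = (\<Sum>i=k+1..<M. ?t i) + ?t M"
      using \<open>k < M\<close> by simp
    also have "(\<Sum>i=k+1..<M. ?t i) = dsum M (k + 1) P Q"
      unfolding dsum_def r_def[symmetric] by (rule sum.cong) auto
    finally have split: "(\<Sum>i=k+1..M+k. ?t i) = dsum M (k + 1) P Q + ?t M + P ^ N * h" unfolding h .
    show ?thesis using False unfolding r_def[symmetric] N_def[symmetric] sum split
      by (intro exI[of _ "- h"]) simp
  qed
qed

section \<open>Lifting invariants of the quotient\<close>

definition inv_mod :: "nat \<Rightarrow> 'a::{field,finite} mp \<Rightarrow> bool" where
  "inv_mod m F \<longleftrightarrow> (\<forall>a b c d. a * d - b * c \<noteq> 0 \<longrightarrow> lin_subst a b c d F - F \<in> trunc (CARD('a) ^ m))"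

lemma inv_modD:
  fixes F :: "'a::{field,finite} mp"
  shows "inv_mod m F \<Longrightarrow> a * d - b * c \<noteq> 0 \<Longrightarrow> lin_subst a b c d F - F \<in> trunc (CARD('a) ^ m)"
  by (auto simp: inv_mod_def)

lemma inv_mod_add:
  assumes "inv_mod m F" "inv_mod m G"
  shows "inv_mod m (F + G)"
  unfolding inv_mod_def
proof (intro allI impI)
  fix a b c d :: 'a assume *: "a * d - b * c \<noteq> 0"
  show "lin_subst a b c d (F + G) - (F + G) \<in> trunc (CARD('a) ^ m)"
    using trunc_add[OF inv_modD[OF assms(1) *] inv_modD[OF assms(2) *]]
    by (simp add: lin_subst_hom add_diff_add)
qed

lemma inv_mod_const_mult:
  assumes "inv_mod m F"
  shows "inv_mod m (mp_const e * F)"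
  unfolding inv_mod_def
proof (intro allI impI)
  fix a b c d :: 'a assume *: "a * d - b * c \<noteq> 0"
  show "lin_subst a b c d (mp_const e * F) - mp_const e * F \<in> trunc (CARD('a) ^ m)"
    using trunc_mult[OF inv_modD[OF assms *], of "mp_const e"] by (simp add: lin_subst_hom right_diff_distrib)
qed

lemma inv_mod_dickson_ring: "p \<in> dickson_ring \<Longrightarrow> inv_mod m p"
  by (simp add: inv_mod_def lin_subst_dickson_ring)

lemma inv_mod_sum: "(\<And>x. x \<in> A \<Longrightarrow> inv_mod m (f x)) \<Longrightarrow> inv_mod m (sum f A)"
proof (induction A rule: infinite_finite_induct)
  case (insert x A)
  then show ?case by (simp add: inv_mod_add)
qed (simp_all add: inv_mod_def)

lemma mp2_induct [consumes 1, case_names zero add monomial]: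
  assumes "p \<in> carrier (mp_ring 2)"
    and zero: "P 0" and add: "\<And>p p'. P p \<Longrightarrow> P p' \<Longrightarrow> P (p + p')"
    and monomial: "\<And>c i j. P (mp_const c * vx ^ i * vy ^ j)"
  shows "P p"
proof -
  have "P (sum f A)" if "\<And>x. P (f x)" for f :: "(nat \<Rightarrow>\<^sub>0 nat) \<Rightarrow> 'a mp" and A
    using that by (induction A rule: infinite_finite_induct) (auto intro: zero add)
  then have "P (subst2 vx vy p)" unfolding subst2_vx_vy_monomials by (simp add: monomial)
  then show ?thesis using subst2_vx_vy[OF assms(1)] by simp
qed

lemma coef_diagonal:
  assumes "p \<in> carrier (mp_ring 2)"
  shows "coef (lin_subst a 0 0 d p) i j = a ^ i * d ^ j * coef p i j"
  using assms
proof (induction rule: mp2_induct)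
  case (monomial c k l)
  have "lin_subst a 0 0 d (mp_const c * vx ^ k * vy ^ l) = mp_const (a ^ k * d ^ l * c) * vx ^ k * vy ^ l"
    by (simp add: lin_subst_hom power_mult_distrib mp_const_mult mp_const_power mult_ac)
  then show ?case by (simp only: coef_monomial) simp
qed (simp_all add: lin_subst_hom coef_add algebra_simps)

lemma coef_swap:
  assumes "p \<in> carrier (mp_ring 2)"
  shows "coef (lin_subst 0 1 1 0 p) i j = coef p j i"
  using assms
proof (induction rule: mp2_induct)
  case (monomial c k l)
  have "lin_subst 0 1 1 0 (mp_const c * vx ^ k * vy ^ l) = mp_const c * vx ^ l * vy ^ k"
    by (simp add: lin_subst_hom mult_ac)
  then show ?case by (simp only: coef_monomial) simp
qed (simp_all add: lin_subst_hom coef_add)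

lemma torus_exponents:
  fixes F :: "'a::{field,finite} mp"
  assumes "F \<in> carrier (mp_ring 2)" "inv_mod m F" "i < CARD('a) ^ m" "j < CARD('a) ^ m" "coef F i j \<noteq> 0"
  shows "CARD('a) - 1 dvd i" "CARD('a) - 1 dvd j"
proof -
  have *: "a ^ i * d ^ j = 1" if "a \<noteq> 0" "d \<noteq> 0" for a d :: 'a
  proof -
    have "coef (lin_subst a 0 0 d F - F) i j = 0"
      using assms that by (intro coef_trunc[of _ "CARD('a) ^ m"] inv_modD) auto
    then show ?thesis using assms by (simp add: coef_diff coef_diagonal)
  qed
  show "CARD('a) - 1 dvd i" using *[of _ 1] by (intro dvd_exponent[where 'a='a]) simp
  show "CARD('a) - 1 dvd j" using *[of 1] by (intro dvd_exponent[where 'a='a]) simp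
qed

text \<open>
  The filtration by the degree in \<open>v\<close> of the polynomials that are fixed by the diagonal matrices;
  \<open>borel_decomposition\<close> descends along it.
\<close>

inductive_set ylow :: "nat \<Rightarrow> 'a::{field,finite} mp set" for n where
  zero: "0 \<in> ylow n"
| add: "p \<in> ylow n \<Longrightarrow> p' \<in> ylow n \<Longrightarrow> p + p' \<in> ylow n"
| monomial: "j < n \<Longrightarrow>
    mp_const c * vx ^ ((CARD('a) - 1) * i) * vy ^ ((CARD('a) - 1) * j) \<in> (ylow n :: 'a::{field,finite} mp set)"

lemma ylow_sum: "(\<And>x. x \<in> A \<Longrightarrow> f x \<in> ylow n) \<Longrightarrow> sum f A \<in> ylow n"
  by (induction A rule: infinite_finite_induct) (auto intro: ylow.zero ylow.add)

lemma ylow_mult: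
  fixes p p' :: "'a::{field,finite} mp"
  assumes "p \<in> ylow (Suc a)" "p' \<in> ylow b"
  shows "p * p' \<in> ylow (a + b)"
  using assms(1)
proof induction
  case (monomial j c i)
  from assms(2) show ?case
  proof induction
    case (monomial j' c' i')
    have "mp_const c * vx ^ ((CARD('a) - 1) * i) * vy ^ ((CARD('a) - 1) * j) *
        (mp_const c' * vx ^ ((CARD('a) - 1) * i') * vy ^ ((CARD('a) - 1) * j'))
      = mp_const (c * c') * vx ^ ((CARD('a) - 1) * (i + i')) * vy ^ ((CARD('a) - 1) * (j + j') :: nat)"
      by (simp add: mp_const_mult power_add distrib_left distrib_right mult_ac)
    then show ?case using \<open>j < Suc a\<close> \<open>j' < b\<close> by (simp only: ylow.monomial)
  qed (auto simp: distrib_left intro: ylow.intros)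
qed (auto simp: distrib_right intro: ylow.intros)

lemma ylow_mono:
  assumes "p \<in> ylow n" "n \<le> n'"
  shows "p \<in> ylow n'"
  using assms(1)
proof induction
  case (monomial j c i)
  then show ?case using assms(2) by (intro ylow.monomial) simp
qed (auto intro: ylow.zero ylow.add)

lemma ylow_uminus: "p \<in> ylow n \<Longrightarrow> - p \<in> ylow n"
  using ylow_mult[of "mp_const (-1)" 0 p n] ylow.monomial[of 0 1 "-1" 0]
  by (simp add: mp_const_uminus)

lemma ylow_normal_form:
  fixes p :: "'a::{field,finite} mp"
  assumes "p \<in> ylow n" and M: "Suc ((CARD('a) - 1) * M) = CARD('a) ^ m"
  shows "\<exists>c. p - (\<Sum>i\<le>M. \<Sum>j<n. mp_const (c i j) * vx ^ ((CARD('a) - 1) * i) * vy ^ ((CARD('a) - 1) * j))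
    \<in> trunc (CARD('a) ^ m)"
  using assms(1)
proof induction
  case zero
  show ?case by (rule exI[of _ "\<lambda>_ _. 0"]) simp
next
  case (add p p')
  then obtain c c' where
    "p - (\<Sum>i\<le>M. \<Sum>j<n. mp_const (c i j) * vx ^ ((CARD('a) - 1) * i) * vy ^ ((CARD('a) - 1) * j)) \<in> trunc (CARD('a) ^ m)"
    "p' - (\<Sum>i\<le>M. \<Sum>j<n. mp_const (c' i j) * vx ^ ((CARD('a) - 1) * i) * vy ^ ((CARD('a) - 1) * j)) \<in> trunc (CARD('a) ^ m)"
    by blast
  from trunc_add[OF this] show ?case
    by (intro exI[of _ "\<lambda>i j. c i j + c' i j"])
      (simp add: mp_const_add distrib_right sum.distrib add_diff_add)
next
  case (monomial j c i)
  show ?case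
  proof (cases "i \<le> M")
    case True
    let ?t = "mp_const c * vx ^ ((CARD('a) - 1) * i) * vy ^ ((CARD('a) - 1) * j)"
    have "(\<Sum>i'\<le>M. \<Sum>j'<n. mp_const (if i' = i \<and> j' = j then c else 0) *
        vx ^ ((CARD('a) - 1) * i') * vy ^ ((CARD('a) - 1) * j'))
      = (\<Sum>i'\<le>M. \<Sum>j'<n. if j' = j then (if i' = i then ?t else 0) else 0)"
      by (intro sum.cong refl) auto
    also have "\<dots> = ?t" using True \<open>j < n\<close> by (simp add: sum.delta)
    finally show ?thesis by (intro exI[of _ "\<lambda>i' j'. if i' = i \<and> j' = j then c else 0"]) simp
  next
    case False
    then have "(CARD('a) - 1) * Suc M \<le> (CARD('a) - 1) * i" by (intro mult_le_mono) auto
    then have "CARD('a) ^ m \<le> (CARD('a) - 1) * i"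
      using M card_field_gt_1[where 'a='a] by simp
    then show ?thesis
      by (intro exI[of _ "\<lambda>_ _. 0"]) (simp add: vx_power_trunc trunc_mult trunc_mult_right)
  qed
qed

text \<open>
  As a polynomial in \<open>v\<close>, the power \<open>V^k\<close> is monic of degree \<open>q k\<close>.
\<close>

lemma ylow_y_orbit:
  "y_orbit ^ ((CARD('a) - 1) * k) - vy ^ ((CARD('a) - 1) * (CARD('a) * k)) \<in> (ylow (CARD('a) * k) :: 'a::{field,finite} mp set)"
proof -
  define u :: "'a mp" where "u = vx ^ (CARD('a) - 1)"
  define v :: "'a mp" where "v = vy ^ (CARD('a) - 1)"
  have mono: "u ^ i * v ^ j \<in> ylow n" if "j < n" for i j n
    using ylow.monomial[OF that, of "1 :: 'a" i] by (simp add: u_def v_def power_mult)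
  have binom: "(v - u) ^ n - v ^ n \<in> ylow n" for n
  proof (induction n)
    case (Suc n)
    have "(v - u) ^ Suc n - v ^ Suc n = (v - u) * ((v - u) ^ n - v ^ n) + - (u * v ^ n)"
      by (simp add: algebra_simps)
    moreover have "v - u \<in> ylow (Suc 1)"
      using ylow.add[OF mono[of 1 "Suc 1" 0] ylow_uminus[OF mono[of 0 "Suc 1" 1]]] by simp
    from ylow_mult[OF this Suc] have "(v - u) * ((v - u) ^ n - v ^ n) \<in> ylow (Suc n)" by simp
    moreover have "u * v ^ n \<in> ylow (Suc n)" using mono[of n "Suc n" 1] by simp
    ultimately show ?case by (simp only: ylow.add ylow_uminus)
  qed (simp add: ylow.zero)
  define V :: "'a mp" where "V = y_orbit ^ (CARD('a) - 1)"
  have q: "CARD('a) = Suc (CARD('a) - 1)" using card_field_gt_1[where 'a='a] by simp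
  have yl: "y_orbit = vy * (v - u)"
    unfolding y_orbit_def u_def v_def right_diff_distrib power_Suc[symmetric] q[symmetric] by (simp add: mult.commute)
  have V: "V = v * (v - u) ^ (CARD('a) - 1)"
    unfolding V_def yl power_mult_distrib by (simp add: v_def)
  have Vlow: "V - v ^ CARD('a) \<in> ylow (CARD('a))"
  proof -
    have "V - v ^ CARD('a) = v * ((v - u) ^ (CARD('a) - 1) - v ^ (CARD('a) - 1))"
    proof -
      have "v * v ^ (CARD('a) - 1) = v ^ CARD('a)" unfolding power_Suc[symmetric] q[symmetric] ..
      then show ?thesis by (simp add: V right_diff_distrib)
    qed
    moreover have "v \<in> ylow (Suc 1)" using mono[of 1 "Suc 1" 0] by simp
    from ylow_mult[OF this binom[of "CARD('a) - 1"]] have "v * ((v - u) ^ (CARD('a) - 1) - v ^ (CARD('a) - 1)) \<in> ylow (CARD('a))"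
      unfolding plus_1_eq_Suc q[symmetric] .
    ultimately show ?thesis by simp
  qed
  have "V ^ k - v ^ (CARD('a) * k) \<in> ylow (CARD('a) * k)"
  proof (induction k)
    case (Suc k)
    have eq: "V ^ Suc k - v ^ (CARD('a) * Suc k)
        = V * (V ^ k - v ^ (CARD('a) * k)) + v ^ (CARD('a) * k) * (V - v ^ CARD('a))"
      by (simp add: right_diff_distrib left_diff_distrib power_add mult_ac)
    have "V \<in> ylow (Suc CARD('a))"
      using ylow.add[OF ylow_mono[OF Vlow, of "Suc CARD('a)"] mono[of "CARD('a)" "Suc CARD('a)" 0]] by simp
    from ylow_mult[OF this Suc] have 1: "V * (V ^ k - v ^ (CARD('a) * k)) \<in> ylow (CARD('a) * Suc k)"
      by simp
    have "v ^ (CARD('a) * k) \<in> ylow (Suc (CARD('a) * k))" using mono[of "CARD('a) * k" _ 0] by simp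
    from ylow_mult[OF this Vlow] have 2: "v ^ (CARD('a) * k) * (V - v ^ CARD('a)) \<in> ylow (CARD('a) * Suc k)"
      by (simp add: add.commute)
    show ?case unfolding eq by (rule ylow.add[OF 1 2])
  qed (simp add: ylow.zero)
  then show ?thesis by (simp add: V_def v_def power_mult)
qed

lemma coef_shear:
  "coef (mp_const c * vx ^ s * (vx + vy) ^ t) a b = (if s + t = a + b then c * of_nat (t choose b) else 0)"
proof -
  have expand: "mp_const c * vx ^ s * (vx + vy) ^ t
      = (\<Sum>k\<le>t. mp_const (c * of_nat (t choose k)) * vx ^ (s + k) * vy ^ (t - k))"
    by (simp add: binomial_ring sum_distrib_left mp_const_mult mp_const_of_nat power_add mult_ac)
  have "coef (mp_const c * vx ^ s * (vx + vy) ^ t) a b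
      = (\<Sum>k\<le>t. if s + k = a \<and> t - k = b then c * of_nat (t choose k) else 0)"
    by (simp only: expand coef_sum coef_monomial)
  also have "\<dots> = (\<Sum>k\<le>t. if k = t - b then (if s + t = a + b \<and> b \<le> t then c * of_nat (t choose k) else 0) else 0)"
  proof (rule sum.cong[OF refl])
    fix k assume "k \<in> {..t}"
    then have "s + k = a \<and> t - k = b \<longleftrightarrow> k = t - b \<and> s + t = a + b \<and> b \<le> t" by auto
    then show "(if s + k = a \<and> t - k = b then c * of_nat (t choose k) else 0)
        = (if k = t - b then (if s + t = a + b \<and> b \<le> t then c * of_nat (t choose k) else 0) else 0)"
      by simp
  qed
  also have "\<dots> = (if s + t = a + b \<and> b \<le> t then c * of_nat (t choose (t - b)) else 0)"
    by (simp only: sum.delta finite_atMost) simp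
  also have "\<dots> = (if s + t = a + b then c * of_nat (t choose b) else 0)"
  proof (cases "b \<le> t")
    case True
    then show ?thesis using binomial_symmetric[of b t] by simp
  next
    case False
    then show ?thesis by (simp add: binomial_eq_0)
  qed
  finally show ?thesis .
qed

text \<open>
  In the expansion of \<open>(x + y)^((q - 1) n)\<close>, the monomials whose exponent of \<open>y\<close> is less than the top one by
  some \<open>l\<close> with \<open>1 \<le> l < q\<close> receive nothing from lower powers of \<open>v\<close>, except from the pure power of \<open>y\<close> in the next
  one, which the substitution preserves. So the binomial coefficients of \<open>(q - 1) n\<close> over all these \<open>l\<close> vanish.
  By \<open>binomial_last_digit\<close> the last base-\<open>q\<close> digit of \<open>(q - 1) n\<close> must be \<open>0\<close>.
\<close>

lemma top_coefficient_shear: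
  fixes c :: "nat \<Rightarrow> nat \<Rightarrow> 'a::{field,finite}"
  assumes M: "Suc ((CARD('a) - 1) * M) = CARD('a) ^ m" and "n \<le> M" "i < M" "c i n \<noteq> 0"
    and G: "G = (\<Sum>i\<le>M. \<Sum>j<Suc n. mp_const (c i j) * vx ^ ((CARD('a) - 1) * i) * vy ^ ((CARD('a) - 1) * j))"
    and inv: "lin_subst 1 0 1 1 G - G \<in> trunc (CARD('a) ^ m)"
  shows "CARD('a) dvd n"
proof -
  define r where "r = CARD('a) - 1"
  have r: "1 \<le> r" "CARD('a) = Suc r" using card_field_gt_1[where 'a='a] by (auto simp: r_def)
  have binom0: "of_nat (r * n choose l) = (0 :: 'a)" if "1 \<le> l" "l \<le> r" "0 < n" for l
  proof -
    have ln: "l \<le> r * n" using that mult_le_mono2[of 1 n r] by linarith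
    define b where "b = r * n - l"
    have rn: "r * (n - 1) = r * n - r" by (simp add: diff_mult_distrib2)
    have "r * i + r \<le> r * M" using mult_le_mono2[of "Suc i" M r] \<open>i < M\<close> by simp
    then have lt: "r * i + l < CARD('a) ^ m" using M that by (simp add: r_def)
    have "r * n \<le> r * M" using \<open>n \<le> M\<close> by simp
    then have lt': "b < CARD('a) ^ m" using M unfolding b_def r_def by linarith
    have eq: "lin_subst 1 0 1 1 G - G = (\<Sum>i\<le>M. \<Sum>j<Suc n. mp_const (c i j) * vx ^ (r * i) * (vx + vy) ^ (r * j)
        - mp_const (c i j) * vx ^ (r * i) * vy ^ (r * j))"
      by (simp add: G lin_subst_hom sum_subtractf r_def)
    have coeff: "coef (mp_const (c i' j) * vx ^ (r * i') * (vx + vy) ^ (r * j)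
          - mp_const (c i' j) * vx ^ (r * i') * vy ^ (r * j)) (r * i + l) b
        = (if j = n then (if i' = i then c i n * of_nat (r * n choose b) else 0) else 0)"
      if "j < Suc n" for i' j
    proof -
      have sum: "r * i' + r * j = r * i + l + b \<longleftrightarrow> i' + j = i + n"
        using ln r by (simp add: b_def flip: distrib_left)
      have "b < r * n" using ln \<open>1 \<le> l\<close> by (simp add: b_def)
      then have top: "r * n \<noteq> b" by simp
      consider "j = n" | "j = n - 1" "j < n" | "j < n - 1" using \<open>j < Suc n\<close> by linarith
      then show ?thesis
      proof cases
        case 1
        then show ?thesis using sum top by (auto simp: coef_diff coef_shear coef_monomial)
      next
        case 2
        have "of_nat (r * j choose b) = (if r * j = b then 1 else 0 :: 'a)"
        proof (cases "r * j = b")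
          case False
          then have "r * j < b" using 2 rn \<open>l \<le> r\<close> ln by (simp add: b_def)
          then show ?thesis using False by (simp add: binomial_eq_0)
        qed simp
        then show ?thesis using 2 sum by (auto simp: coef_diff coef_shear coef_monomial)
      next
        case 3
        then have "r * Suc j \<le> r * (n - 1)" by (intro mult_le_mono2) simp
        then have "r * j < b" using rn \<open>l \<le> r\<close> ln r by (simp add: b_def)
        then show ?thesis using 3 by (auto simp: coef_diff coef_shear coef_monomial binomial_eq_0)
      qed
    qed
    have "coef (lin_subst 1 0 1 1 G - G) (r * i + l) b
        = (\<Sum>i'\<le>M. \<Sum>j<Suc n. if j = n then (if i' = i then c i n * of_nat (r * n choose b) else 0) else 0)"
      unfolding eq coef_sum by (intro sum.cong refl coeff) auto
    also have "\<dots> = c i n * of_nat (r * n choose b)" using \<open>i < M\<close> by (simp add: sum.delta)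
    finally have "c i n * of_nat (r * n choose b) = 0" using coef_trunc[OF inv lt lt'] by simp
    moreover have "r * n choose b = r * n choose l"
      unfolding b_def using ln by (rule binomial_symmetric[symmetric])
    ultimately show ?thesis using \<open>c i n \<noteq> 0\<close> by simp
  qed
  show ?thesis
  proof (cases "n = 0")
    case False
    have "(r * n) mod CARD('a) = 0"
    proof (rule ccontr)
      assume *: "(r * n) mod CARD('a) \<noteq> 0"
      have "(r * n) mod CARD('a) < CARD('a)" by simp
      then have "of_nat (r * n choose ((r * n) mod CARD('a))) = (0 :: 'a)"
        using * False r by (intro binom0) auto
      then show False using binomial_last_digit(2)[of "r * n", where 'a='a] by simp
    qed
    then have "CARD('a) dvd r * n" by (simp add: dvd_eq_mod_eq_0)
    moreover have "coprime CARD('a) r" using r(2) by simp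
    ultimately show ?thesis by (simp add: coprime_dvd_mult_right_iff)
  qed simp
qed

lemma lin_subst_y_orbit: "lin_subst 1 0 1 1 y_orbit = (y_orbit :: 'a::{field,finite} mp)"
proof -
  have "(vx :: 'a mp) ^ (CARD('a) - 1) * vx = vx ^ CARD('a)"
    using card_field_gt_1[where 'a='a] by (subst mult.commute) (simp flip: power_Suc)
  moreover have "lin_subst 1 0 1 1 y_orbit = (vx + vy :: 'a mp) ^ CARD('a) - vx ^ (CARD('a) - 1) * (vx + vy)"
    by (simp add: y_orbit_def lin_subst_hom)
  ultimately show ?thesis
    by (simp only: mp_power_card_add distrib_left y_orbit_def) simp
qed

lemma shear_difference_trunc:
  "vx ^ N * ((vx + vy) ^ k - vy ^ k) \<in> trunc (Suc N)"
proof -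
  have "(vx + vy :: 'a mp) ^ k - vy ^ k = vx * (\<Sum>i<k. vy ^ (k - Suc i) * (vx + vy) ^ i)"
    by (subst power_diff_sumr2) simp
  then have "vx ^ N * ((vx + vy :: 'a mp) ^ k - vy ^ k)
      = vx ^ Suc N * (\<Sum>i<k. vy ^ (k - Suc i) * (vx + vy) ^ i)"
    by (simp only: power_Suc2 mult.assoc)
  then show ?thesis by (simp only: trunc_mult_right vx_power_trunc order_refl)
qed

text \<open>
  Induction on the degree in \<open>v\<close>, removing the top terms. A term \<open>u^i v^n\<close> of top degree with \<open>i < M\<close> only
  occurs if \<open>q\<close> divides \<open>n\<close>, and then it is the leading term of the invariant \<open>u^i V^(n / q)\<close>, which can be subtracted. The term \<open>u^M v^n\<close>
  is already invariant modulo the ideal.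
\<close>

lemma borel_decomposition:
  fixes F :: "'a::{field,finite} mp"
  assumes M: "Suc ((CARD('a) - 1) * M) = CARD('a) ^ m"
  shows "F \<in> ylow n \<Longrightarrow> n \<le> Suc M \<Longrightarrow> lin_subst 1 0 1 1 F - F \<in> trunc (CARD('a) ^ m) \<Longrightarrow>
    \<exists>B\<in>borel_ring. \<exists>d. F - B - (\<Sum>k\<le>M. mp_const (d k) * (vx ^ ((CARD('a) - 1) * M) * vy ^ ((CARD('a) - 1) * k)))
      \<in> trunc (CARD('a) ^ m)"
proof (induction n arbitrary: F)
  case 0
  have "p = 0" if "p \<in> ylow 0" for p :: "'a mp"
    using that by (induction rule: ylow.induct) auto
  then have "F = 0" using 0 by blast
  then show ?case by (intro bexI[of _ 0] exI[of _ "\<lambda>_. 0"]) (auto intro: borel_ring.zero)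
next
  case (Suc n)
  let ?N = "CARD('a) ^ m"
  define r where "r = CARD('a) - 1"
  have M': "Suc (r * M) = ?N" using M by (simp add: r_def)
  have "n \<le> M" using Suc.prems by simp
  let ?T = "\<lambda>k. vx ^ (r * M) * vy ^ (r * k) :: 'a mp"
  obtain c where c: "F - (\<Sum>i\<le>M. \<Sum>j<Suc n. mp_const (c i j) * vx ^ (r * i) * vy ^ (r * j)) \<in> trunc ?N"
    using ylow_normal_form[OF Suc.prems(1) M] unfolding r_def by blast
  define G where "G = (\<Sum>i\<le>M. \<Sum>j<Suc n. mp_const (c i j) * vx ^ (r * i) * vy ^ (r * j))"
  have FG: "F - G \<in> trunc ?N" using c by (simp add: G_def)
  have inv: "lin_subst 1 0 1 1 G - G \<in> trunc ?N"
  proof -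
    have "lin_subst 1 0 1 1 G - G = (lin_subst 1 0 1 1 F - F) - (lin_subst 1 0 1 1 (F - G)) + (F - G)"
      unfolding lin_subst_hom(2) by simp
    then show ?thesis using Suc.prems(3) FG lin_subst_trunc[OF FG] by (simp only: trunc_add trunc_diff)
  qed
  have div: "c i n = 0" if "i < M" "\<not> CARD('a) dvd n" for i
    using top_coefficient_shear[OF M \<open>n \<le> M\<close> that(1) _ _ inv, of c] that(2) unfolding G_def r_def by blast
  define k where "k = n div CARD('a)"
  define B where "B = (\<Sum>i<M. mp_const (c i n) * vx ^ (r * i) * y_orbit ^ (r * k))"
  have B: "B \<in> borel_ring"
  proof -
    have "(\<Sum>i\<in>A. mp_const (c i n) * vx ^ (r * i) * y_orbit ^ (r * k)) \<in> borel_ring" for A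
    proof (induction A rule: infinite_finite_induct)
      case (insert x A)
      show ?case
        unfolding sum.insert[OF insert.hyps] r_def
        by (rule borel_ring.add[OF borel_ring.monomial insert.IH[unfolded r_def]])
    qed (simp_all add: borel_ring.zero)
    then show ?thesis by (simp add: B_def)
  qed
  have invB: "lin_subst 1 0 1 1 B = B" by (simp add: B_def lin_subst_hom lin_subst_y_orbit)
  have invT: "lin_subst 1 0 1 1 (?T j) - ?T j \<in> trunc ?N" for j
    using shear_difference_trunc[of "r * M" "r * j"] M' by (simp add: lin_subst_hom right_diff_distrib)
  \<comment> \<open>If \<open>q\<close> does not divide \<open>n\<close>, the coefficients in \<open>B\<close> vanish, so the rounding in \<open>k\<close> is harmless.\<close>
  define H where "H = G - B - mp_const (c M n) * ?T n"
  have "H \<in> ylow n"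
  proof -
    have "H = (\<Sum>i\<le>M. \<Sum>j<n. mp_const (c i j) * vx ^ (r * i) * vy ^ (r * j))
        + (\<Sum>i<M. - (mp_const (c i n) * vx ^ (r * i) * (y_orbit ^ (r * k) - vy ^ (r * n))))"
    proof -
      have "(\<Sum>i\<le>M. f i) = (\<Sum>i<M. f i) + f M" for f :: "nat \<Rightarrow> 'a mp"
        by (simp flip: lessThan_Suc_atMost)
      from this[of "\<lambda>i. mp_const (c i n) * vx ^ (r * i) * vy ^ (r * n)"]
      have "G = (\<Sum>i\<le>M. \<Sum>j<n. mp_const (c i j) * vx ^ (r * i) * vy ^ (r * j))
          + ((\<Sum>i<M. mp_const (c i n) * vx ^ (r * i) * vy ^ (r * n)) + mp_const (c M n) * vx ^ (r * M) * vy ^ (r * n))"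
        unfolding G_def sum.lessThan_Suc sum.distrib by simp
      then show ?thesis
        by (simp add: H_def B_def right_diff_distrib sum_subtractf sum_negf mult.assoc)
    qed
    moreover have "- (mp_const (c i n) * vx ^ (r * i) * (y_orbit ^ (r * k) - vy ^ (r * n))) \<in> ylow n" if "i < M" for i
    proof (cases "CARD('a) dvd n")
      case True
      then have n: "n = CARD('a) * k" by (simp add: k_def)
      have "mp_const (c i n) * vx ^ (r * i) \<in> ylow (Suc 0)"
        using ylow.monomial[of 0 "Suc 0" "c i n" i] by (simp add: r_def)
      from ylow_mult[OF this ylow_y_orbit[of k]] show ?thesis
        by (intro ylow_uminus) (simp add: n r_def)
    next
      case False
      then show ?thesis using div[OF that] by (simp add: ylow.zero)
    qed
    moreover have "(\<Sum>i\<le>M. \<Sum>j<n. mp_const (c i j) * vx ^ (r * i) * vy ^ (r * j)) \<in> ylow n"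
      unfolding r_def by (intro ylow_sum ylow.monomial) auto
    ultimately show ?thesis by (auto intro!: ylow.add ylow_sum)
  qed
  moreover have "lin_subst 1 0 1 1 H - H \<in> trunc ?N"
  proof -
    have "lin_subst 1 0 1 1 H - H = (lin_subst 1 0 1 1 G - G) - mp_const (c M n) * (lin_subst 1 0 1 1 (?T n) - ?T n)"
      unfolding H_def lin_subst_hom(2) lin_subst_hom(4)[of 1 0 1 1 "mp_const (c M n)"] invB lin_subst_simps(3)
      by (simp add: right_diff_distrib del: lin_subst_simps(1,2))
    then show ?thesis using inv invT[of n] by (simp only: trunc_diff trunc_mult)
  qed
  ultimately obtain B' d where B': "B' \<in> borel_ring"
    "H - B' - (\<Sum>k\<le>M. mp_const (d k) * ?T k) \<in> trunc ?N"
    using Suc.IH[of H] \<open>n \<le> M\<close> unfolding r_def by auto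
  define d' where "d' = (\<lambda>k. d k + (if k = n then c M n else 0))"
  have "(\<Sum>k\<le>M. mp_const (d' k) * ?T k)
      = (\<Sum>k\<le>M. mp_const (d k) * ?T k) + (\<Sum>k\<le>M. if k = n then mp_const (c M n) * ?T k else 0)"
    unfolding sum.distrib[symmetric] by (intro sum.cong refl) (auto simp: d'_def mp_const_add distrib_right)
  also have "(\<Sum>k\<le>M. if k = n then mp_const (c M n) * ?T k else 0) = mp_const (c M n) * ?T n"
    using \<open>n \<le> M\<close> by simp
  finally have d': "(\<Sum>k\<le>M. mp_const (d' k) * ?T k) = (\<Sum>k\<le>M. mp_const (d k) * ?T k) + mp_const (c M n) * ?T n" .
  have "F - (B + B') - (\<Sum>k\<le>M. mp_const (d' k) * ?T k)
      = (F - G) + (H - B' - (\<Sum>k\<le>M. mp_const (d k) * ?T k))"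
    unfolding d' H_def by (simp add: algebra_simps)
  then have "F - (B + B') - (\<Sum>k\<le>M. mp_const (d' k) * ?T k) \<in> trunc ?N"
    using FG B'(2) by (simp only: trunc_add)
  then show ?case using B B'(1) unfolding r_def by (blast intro: borel_ring.add)
qed

text \<open>
  The trace over the \<open>q + 1\<close> lines fixes an invariant class, because each summand is congruent to \<open>F\<close> and
  \<open>q = 0\<close> in the field. It is applied to the Borel decomposition of \<open>F\<close>.
\<close>

theorem invariants_lift:
  fixes F :: "'a::{field,finite} mp"
  assumes M: "Suc ((CARD('a) - 1) * M) = CARD('a) ^ m" "1 \<le> M"
    and F: "F \<in> carrier (mp_ring 2)" "inv_mod m F"
  shows "\<exists>p\<in>dickson_ring. \<exists>d. F - p - (\<Sum>e=1..<M. mp_const (d e) * dsum M e vx vy)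
      - mp_const (d M) * (vx ^ ((CARD('a) - 1) * M) * vy ^ ((CARD('a) - 1) * M)) \<in> trunc (CARD('a) ^ m)"
proof -
  let ?N = "CARD('a) ^ m"
  define r where "r = CARD('a) - 1"
  have M': "Suc (r * M) = ?N" using M by (simp add: r_def)
  let ?T = "\<lambda>k. vx ^ (r * M) * vy ^ (r * k) :: 'a mp"
  let ?G = "\<Sum>i<?N. \<Sum>j<?N. mp_const (coef F i j) * vx ^ i * vy ^ j"
  have "?G \<in> ylow (Suc M)"
  proof (intro ylow_sum)
    fix i j assume ij: "i \<in> {..<?N}" "j \<in> {..<?N}"
    show "mp_const (coef F i j) * vx ^ i * vy ^ j \<in> ylow (Suc M)"
    proof (cases "coef F i j = 0")
      case False
      then have "r dvd i" "r dvd j" using torus_exponents[OF F, of i j] ij by (auto simp: r_def)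
      then obtain i' j' where [simp]: "i = r * i'" "j = r * j'" by (auto elim!: dvdE)
      have "0 < r" using card_field_gt_1[where 'a='a] by (simp add: r_def)
      moreover have "r * j' \<le> r * M"
      proof -
        have "r * j' < Suc (r * M)" using ij unfolding M' by simp
        then show ?thesis by (simp only: less_Suc_eq_le)
      qed
      ultimately have "j' < Suc M" by simp
      then show ?thesis unfolding \<open>i = _\<close> \<open>j = _\<close> r_def by (rule ylow.monomial)
    qed (simp add: ylow.zero)
  qed
  moreover have FG: "F - ?G \<in> trunc ?N" using reduce_mod_trunc[OF F(1)] .
  moreover have "lin_subst 1 0 1 1 ?G - ?G \<in> trunc ?N"
  proof -
    have "lin_subst 1 0 1 1 ?G - ?G = (lin_subst 1 0 1 1 F - F) - lin_subst 1 0 1 1 (F - ?G) + (F - ?G)"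
      unfolding lin_subst_hom(2) by simp
    moreover have "lin_subst 1 0 1 1 F - F \<in> trunc ?N" using F(2) by (rule inv_modD) simp
    ultimately show ?thesis using FG lin_subst_trunc[OF FG] by (simp only: trunc_add trunc_diff)
  qed
  ultimately obtain B d where B: "B \<in> borel_ring"
    and BG: "?G - B - (\<Sum>k\<le>M. mp_const (d k) * ?T k) \<in> trunc ?N"
    using borel_decomposition[OF M(1), of ?G "Suc M"] unfolding r_def by auto
  have "p - B - q = (p - p') + (p' - B - q)" for p p' q by simp
  from trunc_add[OF FG BG, folded this] have E: "F - B - (\<Sum>k\<le>M. mp_const (d k) * ?T k) \<in> trunc ?N" .
  define E where "E = F - B - (\<Sum>k\<le>M. mp_const (d k) * ?T k)"
  have "line_trace F - F = (\<Sum>c\<in>UNIV. lin_subst c 1 1 0 F - F)"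
    by (simp add: line_trace_def sum_subtractf mp_of_nat_card)
  moreover have "lin_subst c 1 1 0 F - F \<in> trunc ?N" for c using F(2) by (rule inv_modD) simp
  ultimately have trF: "line_trace F - F \<in> trunc ?N" by (simp only: trunc_sum)
  have trE: "line_trace E \<in> trunc ?N"
    using E unfolding line_trace_def E_def by (intro trunc_add trunc_sum lin_subst_trunc)
  define S where "S = (\<lambda>k. if k = M then ?T M else - dsum M (k + 1) vx vy)"
  have trT: "line_trace (?T k) - S k \<in> trunc ?N" if kM: "k \<le> M" for k
  proof -
    obtain h where "?T k + (\<Sum>c\<in>UNIV. (mp_const c * vx + vy) ^ (r * M) * vx ^ (r * k)) = S k + vx ^ ?N * h"
      using line_trace_top[OF M kM, of vx vy] unfolding S_def r_def by blast
    then have "line_trace (?T k) - S k = vx ^ ?N * h"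
      by (simp add: line_trace_def lin_subst_hom)
    then show ?thesis by (simp only: trunc_mult_right vx_power_trunc order_refl)
  qed
  have lin: "line_trace (\<Sum>k\<le>M. mp_const (d k) * ?T k) = (\<Sum>k\<le>M. mp_const (d k) * line_trace (?T k))"
  proof -
    have "line_trace (sum f A) = (\<Sum>x\<in>A. line_trace (f x))" for f :: "nat \<Rightarrow> 'a mp" and A
      by (induction A rule: infinite_finite_induct) (simp_all add: line_trace_add)
    then show ?thesis by (simp add: line_trace_dickson_ring_mult dickson_ring_const)
  qed
  have "line_trace F = line_trace B + line_trace (\<Sum>k\<le>M. mp_const (d k) * ?T k) + line_trace E"
    by (simp add: E_def flip: line_trace_add)
  then have eq: "F - line_trace B - (\<Sum>k\<le>M. mp_const (d k) * S k)
      = line_trace E - (line_trace F - F) + (\<Sum>k\<le>M. mp_const (d k) * (line_trace (?T k) - S k))"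
    by (simp add: lin right_diff_distrib sum_subtractf)
  have main: "F - line_trace B - (\<Sum>k\<le>M. mp_const (d k) * S k) \<in> trunc ?N"
    unfolding eq by (intro trunc_add trunc_diff trunc_sum trunc_mult trE trF trT) simp
  define d' where "d' = (\<lambda>e. if e = M then d M else - d (e - 1))"
  have "(\<Sum>k\<le>M. mp_const (d k) * S k) = mp_const (d M) * ?T M + (\<Sum>k<M. mp_const (d k) * S k)"
  proof -
    have "(\<Sum>k\<le>M. f k) = f M + (\<Sum>k<M. f k)" for f :: "nat \<Rightarrow> 'a mp"
      by (simp add: add.commute flip: lessThan_Suc_atMost)
    then show ?thesis by (simp add: S_def)
  qed
  also have "(\<Sum>k<M. mp_const (d k) * S k) = (\<Sum>k<M. mp_const (- d k) * dsum M (k + 1) vx vy)"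
    by (intro sum.cong refl) (auto simp: S_def mp_const_uminus)
  also have "\<dots> = (\<Sum>e=1..<Suc M. mp_const (- d (e - 1)) * dsum M e vx vy)"
    by (rule sum.reindex_bij_witness[of _ "\<lambda>e. e - 1" "\<lambda>k. k + 1"]) auto
  \<comment> \<open>For \<open>e = M\<close> the sum \<open>dsum\<close> is empty.\<close>
  also have "\<dots> = (\<Sum>e=1..<M. mp_const (- d (e - 1)) * dsum M e vx vy)"
    using \<open>1 \<le> M\<close> by (simp add: dsum_def)
  also have "\<dots> = (\<Sum>e=1..<M. mp_const (d' e) * dsum M e vx vy)"
    by (intro sum.cong refl) (auto simp: d'_def)
  finally have "F - line_trace B - (\<Sum>e=1..<M. mp_const (d' e) * dsum M e vx vy) - mp_const (d' M) * ?T M \<in> trunc ?N"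
    using main by (simp add: d'_def algebra_simps)
  then show ?thesis using line_trace_borel_ring[OF B] unfolding r_def by blast
qed

section \<open>The annihilator of the product of the linear forms\<close>

text \<open>
  The swap, the diagonal matrices and the shears generate the linear group; the decomposition of the matrix
  depends on whether its entry \<open>a\<close> vanishes. The expression \<open>D\<close> takes arbitrary arguments because the shears
  in this decomposition act on linear forms other than \<open>x\<close> and \<open>y\<close>.
\<close>

lemma inv_modI_bivariate:
  fixes D :: "'a::{field,finite} mp \<Rightarrow> 'a mp \<Rightarrow> 'a mp"
  assumes lin_subst: "\<And>a b c d. lin_subst a b c d (D vx vy)
        = D (mp_const a * vx + mp_const b * vy) (mp_const c * vx + mp_const d * vy)"
    and swap: "\<And>P Q. D P Q = D Q P"
    and scale: "\<And>P Q s t. s \<noteq> 0 \<Longrightarrow> t \<noteq> 0 \<Longrightarrow> D (mp_const s * P) (mp_const t * Q) = D P Q"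
    and shear: "\<And>P Q t. \<exists>h. D P (mp_const t * P + Q) - D P Q = P ^ (CARD('a) ^ m) * h"
  shows "inv_mod m (D vx vy)"
  unfolding inv_mod_def
proof (intro allI impI)
  fix a b c d :: 'a assume det: "a * d - b * c \<noteq> 0"
  let ?N = "CARD('a) ^ m"
  have shear': "D (mp_const e * vx + mp_const f * vy) (mp_const t * (mp_const e * vx + mp_const f * vy) + Q)
      - D (mp_const e * vx + mp_const f * vy) Q \<in> trunc ?N" for e f t Q
    using shear[of "mp_const e * vx + mp_const f * vy" t Q] linear_form_power_trunc[of e f m]
    by (auto simp: trunc_mult_right)
  let ?P = "mp_const a * vx + mp_const b * vy" and ?Q = "mp_const c * vx + mp_const d * vy"
  have "D ?P ?Q - D vx vy \<in> trunc ?N"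
  proof (cases "a = 0")
    case False
    have "c = c / a * a" "d = c / a * b + (a * d - b * c) / a" using False by (auto simp: field_simps)
    then have "?Q = mp_const (c / a * a) * vx + mp_const (c / a * b + (a * d - b * c) / a) * vy" by simp
    then have Q: "?Q = mp_const (c / a) * ?P + mp_const ((a * d - b * c) / a) * vy"
      by (simp only: mp_const_add mp_const_mult distrib_left distrib_right mult.assoc add.assoc)
    have "D ?P ?Q - D ?P (mp_const ((a * d - b * c) / a) * vy) \<in> trunc ?N"
      unfolding Q by (rule shear')
    moreover have "D ?P (mp_const ((a * d - b * c) / a) * vy) = D vy (mp_const b * vy + mp_const a * vx)"
      using scale[of 1 "(a * d - b * c) / a" ?P vy] det False by (simp add: swap[of _ vy] add.commute)
    moreover have "D vy (mp_const b * vy + mp_const a * vx) - D vy (mp_const a * vx) \<in> trunc ?N"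
      using shear'[of 0 1 b "mp_const a * vx"] by simp
    moreover have "D vy (mp_const a * vx) = D vx vy"
      using scale[of 1 a vy vx] False by (simp add: swap[of vy])
    ultimately show ?thesis using trunc_trans by metis
  next
    case True
    then have nz: "b \<noteq> 0" "c \<noteq> 0" using det by auto
    have "?Q = mp_const (d / b) * ?P + mp_const c * vx"
      using True nz by (simp add: add.commute flip: mp_const_mult mult.assoc)
    then have "D ?P ?Q - D ?P (mp_const c * vx) \<in> trunc ?N" using shear' by metis
    moreover have "D ?P (mp_const c * vx) = D vx vy"
      using scale[OF nz, of vy vx] True by (simp add: swap[of vy])
    ultimately show ?thesis by simp
  qed
  then show "lin_subst a b c d (D vx vy) - D vx vy \<in> trunc ?N" by (simp only: lin_subst)
qed

lemma power_shear:
  fixes P Q :: "'a::comm_ring_1 mp"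
  shows "\<exists>h. P ^ n * (mp_const t * P + Q) ^ k - P ^ n * Q ^ k = P ^ Suc n * h"
proof -
  have "(mp_const t * P + Q) ^ k - Q ^ k = mp_const t * P * (\<Sum>i<k. Q ^ (k - Suc i) * (mp_const t * P + Q) ^ i)"
    by (subst power_diff_sumr2) simp
  then have "P ^ n * ((mp_const t * P + Q) ^ k - Q ^ k)
      = P ^ Suc n * (mp_const t * (\<Sum>i<k. Q ^ (k - Suc i) * (mp_const t * P + Q) ^ i))"
    by (simp add: mult_ac)
  then show ?thesis unfolding right_diff_distrib by blast
qed

lemma const_power_multiple:
  fixes s :: "'a::{field,finite}"
  assumes "s \<noteq> 0"
  shows "(mp_const s * P) ^ ((CARD('a) - 1) * i) = P ^ ((CARD('a) - 1) * i)"
proof -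
  have "mp_const s ^ ((CARD('a) - 1) * i) = 1"
    unfolding power_mult mp_const_power[symmetric] power_card_minus_1_eq[OF assms] by simp
  then show ?thesis by (simp add: power_mult_distrib)
qed

lemma inv_mod_top:
  assumes M: "Suc ((CARD('a) - 1) * M) = CARD('a) ^ m"
  shows "inv_mod m (vx ^ ((CARD('a) - 1) * M) * (vy :: 'a::{field,finite} mp) ^ ((CARD('a) - 1) * M))"
proof (rule inv_modI_bivariate[where D = "\<lambda>P Q. P ^ ((CARD('a) - 1) * M) * Q ^ ((CARD('a) - 1) * M)"])
  show "\<exists>h. P ^ ((CARD('a) - 1) * M) * (mp_const t * P + Q) ^ ((CARD('a) - 1) * M)
      - P ^ ((CARD('a) - 1) * M) * Q ^ ((CARD('a) - 1) * M) = P ^ (CARD('a) ^ m) * h" for P Q :: "'a mp" and t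
    unfolding M[symmetric] by (rule power_shear)
  show "(mp_const s * P) ^ ((CARD('a) - 1) * M) * (mp_const t * Q) ^ ((CARD('a) - 1) * M)
      = P ^ ((CARD('a) - 1) * M) * Q ^ ((CARD('a) - 1) * M)" if "s \<noteq> 0" "t \<noteq> 0" for P Q :: "'a mp" and s t
    unfolding const_power_multiple[OF that(1)] const_power_multiple[OF that(2)] ..
qed (simp_all only: lin_subst_hom lin_subst_simps mult.commute)

text \<open>
  By \<open>line_trace_top\<close> the sum is, up to sign and multiples of \<open>P^N\<close>, the trace of \<open>P^(N - 1) Q^((q - 1) k)\<close>, and the
  shear \<open>Q \<mapsto> t P + Q\<close> permutes the lines other than that of \<open>P\<close>.
\<close>

lemma inv_mod_dsum_Suc:
  assumes M: "Suc ((CARD('a) - 1) * M) = CARD('a) ^ m" and k: "k < M"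
  shows "inv_mod m (dsum M (Suc k) vx (vy :: 'a::{field,finite} mp))"
proof (rule inv_modI_bivariate[where D = "dsum M (Suc k)"])
  show "lin_subst a b c d (dsum M (Suc k) vx vy)
      = dsum M (Suc k) (mp_const a * vx + mp_const b * vy) (mp_const c * vx + mp_const d * vy)" for a b c d :: 'a
    by (simp add: lin_subst_def)
  show "dsum M (Suc k) P Q = dsum M (Suc k) Q P" for P Q :: "'a mp"
    unfolding dsum_def
    by (rule sum.reindex_bij_witness[of _ "\<lambda>i. M + Suc k - 1 - i" "\<lambda>i. M + Suc k - 1 - i"])
      (auto simp: mult.commute)
  show "dsum M (Suc k) (mp_const s * P) (mp_const t * Q) = dsum M (Suc k) P Q"
    if "s \<noteq> 0" "t \<noteq> 0" for P Q :: "'a mp" and s t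
    unfolding dsum_def const_power_multiple[OF that(1)] const_power_multiple[OF that(2)] ..
  show "\<exists>h. dsum M (Suc k) P (mp_const t * P + Q) - dsum M (Suc k) P Q = P ^ (CARD('a) ^ m) * h"
    for P Q :: "'a mp" and t
  proof -
    define r where "r = CARD('a) - 1"
    define N where "N = CARD('a) ^ m"
    let ?S = "\<lambda>Q. \<Sum>c\<in>UNIV. (mp_const c * P + Q) ^ (r * M) * P ^ (r * k)"
    have "1 \<le> M" "k \<le> M" "k \<noteq> M" "k + 1 = Suc k" using k by auto
    note top = line_trace_top[OF M \<open>1 \<le> M\<close> \<open>k \<le> M\<close>, folded r_def N_def, unfolded if_not_P[OF \<open>k \<noteq> M\<close>] \<open>k + 1 = Suc k\<close>]
    obtain h1 where h1: "P ^ (r * M) * Q ^ (r * k) + ?S Q = - dsum M (Suc k) P Q + P ^ N * h1"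
      using top[of P Q] by blast
    obtain h2 where h2: "P ^ (r * M) * (mp_const t * P + Q) ^ (r * k) + ?S (mp_const t * P + Q)
        = - dsum M (Suc k) P (mp_const t * P + Q) + P ^ N * h2"
      using top[of P "mp_const t * P + Q"] by blast
    obtain h3 where h3: "P ^ (r * M) * (mp_const t * P + Q) ^ (r * k) - P ^ (r * M) * Q ^ (r * k) = P ^ N * h3"
      using power_shear[of P "r * M" t Q "r * k"] M unfolding r_def N_def by metis
    have "?S (mp_const t * P + Q) = ?S Q"
      by (rule sum.reindex_bij_witness[of _ "\<lambda>c. c - t" "\<lambda>c. c + t"])
        (auto simp: mp_const_add mp_const_diff algebra_simps)
    note h2 = h2[unfolded this]
    have "d2 - d1 = c2 - c1 - (t2 - t1)" if "t1 + S = - d1 + c1" "t2 + S = - d2 + c2"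
      for d1 d2 c1 c2 t1 t2 S :: "'a mp"
    proof -
      have d1: "d1 = c1 - (t1 + S)" unfolding that(1) by simp
      have d2: "d2 = c2 - (t2 + S)" unfolding that(2) by simp
      show ?thesis unfolding d1 d2 by (simp add: algebra_simps)
    qed
    from this[OF h1 h2] have "dsum M (Suc k) P (mp_const t * P + Q) - dsum M (Suc k) P Q = P ^ N * h2 - P ^ N * h1 - P ^ N * h3"
      unfolding h3 .
    then show ?thesis unfolding N_def by (metis right_diff_distrib)
  qed
qed

lemma moore_mult_dsum_trunc:
  assumes M: "Suc ((CARD('a) - 1) * M) = CARD('a) ^ m" and "e \<le> M"
  shows "moore 1 vx vy * dsum M e vx (vy :: 'a::{field,finite} mp) \<in> trunc (CARD('a) ^ m)"
proof -
  let ?r = "CARD('a) - 1" and ?N = "CARD('a) ^ m"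
  have "moore 1 vx vy * dsum M e vx (vy :: 'a mp)
      = vy ^ ?N * (vx * vx ^ (?r * e)) - vx ^ ?N * (vy * vy ^ (?r * e))"
    unfolding moore_mult_dsum[OF \<open>e \<le> M\<close>] M[symmetric] by (simp add: right_diff_distrib mult_ac)
  then show ?thesis by (simp only: trunc_diff trunc_mult_right vx_power_trunc vy_power_trunc order_refl)
qed

lemma moore_mult_top_trunc:
  fixes Q :: "'a::{field,finite} mp"
  assumes M: "Suc ((CARD('a) - 1) * M) = CARD('a) ^ m"
  shows "moore 1 vx vy * (vx ^ ((CARD('a) - 1) * M) * Q) \<in> trunc (CARD('a) ^ m)"
proof -
  have "moore 1 vx vy * (vx ^ ((CARD('a) - 1) * M) * Q)
      = vx ^ (CARD('a) ^ m) * (vy * (vy ^ (CARD('a) - 1) - vx ^ (CARD('a) - 1)) * Q)"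
    unfolding moore_1_alt M[symmetric] by (simp add: mult_ac)
  then show ?thesis by (simp only: trunc_mult_right vx_power_trunc order_refl)
qed

lemma coef_monomial_mult:
  assumes "p \<in> carrier (mp_ring 2)"
  shows "coef (vx ^ s * vy ^ t * p) a b = (if s \<le> a \<and> t \<le> b then coef p (a - s) (b - t) else 0)"
  using assms
proof (induction rule: mp2_induct)
  case (monomial c i j)
  have "vx ^ s * vy ^ t * (mp_const c * vx ^ i * vy ^ j) = mp_const c * vx ^ (s + i) * vy ^ (t + j)"
    by (simp add: power_add mult_ac)
  then show ?case by (simp only: coef_monomial) auto
qed (simp_all add: distrib_left coef_add)

text \<open>
  The support of \<open>d\<^sub>e\<close> is a single antidiagonal, and different \<open>e\<close> belong to different antidiagonals.
\<close>

lemma coef_dsum: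
  assumes "e < M"
  shows "coef (dsum M e vx vy) ((CARD('a) - 1) * i) ((CARD('a) - 1) * j)
    = (if i < M \<and> j < M \<and> i + j + 1 = M + e then 1 else (0 :: 'a::{field,finite}))"
proof -
  have r: "0 < CARD('a) - 1" using card_field_gt_1[where 'a='a] by simp
  have "coef (vx ^ ((CARD('a) - 1) * k) * vy ^ ((CARD('a) - 1) * l)) ((CARD('a) - 1) * i) ((CARD('a) - 1) * j)
      = (if k = i \<and> l = j then 1 else (0 :: 'a))" for k l
    using coef_monomial[of "1 :: 'a" "(CARD('a) - 1) * k" "(CARD('a) - 1) * l"] r by simp
  then have "coef (dsum M e vx vy) ((CARD('a) - 1) * i) ((CARD('a) - 1) * j)
      = (\<Sum>k=e..<M. if k = i \<and> M + e - 1 - k = j then 1 else (0 :: 'a))"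
    by (simp only: dsum_def coef_sum)
  also have "\<dots> = (\<Sum>k=e..<M. if k = i then (if M + e - 1 - i = j then 1 else 0) else 0)"
    by (intro sum.cong) auto
  also have "\<dots> = (if i \<in> {e..<M} \<and> M + e - 1 - i = j then 1 else 0)" by auto
  also have "\<dots> = (if i < M \<and> j < M \<and> i + j + 1 = M + e then 1 else 0)"
    using assms by auto
  finally show ?thesis .
qed

lemma dsum_closed: "dsum M e vx vy \<in> carrier (mp_ring 2)"
  unfolding dsum_def by (intro mp_ring_intros vx_vy_closed)

lemma coef_non_multiple:
  assumes "\<not> (CARD('a) - 1 dvd i \<and> CARD('a) - 1 dvd j)"
  shows "coef (dsum M e vx vy) i j = (0 :: 'a::{field,finite})"
    "coef (vx ^ ((CARD('a) - 1) * k) * vy ^ ((CARD('a) - 1) * l)) i j = (0 :: 'a)"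
proof -
  show *: "coef (vx ^ ((CARD('a) - 1) * k) * vy ^ ((CARD('a) - 1) * l)) i j = (0 :: 'a)" for k l
    using coef_monomial[of "1 :: 'a" "(CARD('a) - 1) * k" "(CARD('a) - 1) * l"] assms by auto
  show "coef (dsum M e vx vy) i j = (0 :: 'a)" by (simp only: dsum_def coef_sum *) simp
qed

text \<open>
  Multiplication by \<open>L = x y (v - u)\<close> takes differences of neighbouring coefficients along the antidiagonals.
  So, among the coefficients of \<open>u^i v^j\<close> with \<open>i, j < M\<close>, those of an element of the annihilator are constant along
  the antidiagonals; they are zero if \<open>i + j < M - 1\<close>, where the last difference on the antidiagonal is the end
  coefficient itself. The product does not determine the edges \<open>i = M\<close> and \<open>j = M\<close>; apart from the corner
  \<open>i = j = M\<close>, the coefficients there vanish by the invariance under \<open>y \<mapsto> y + x\<close>.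
\<close>

lemma annihilator_of_moore:
  fixes p :: "'a::{field,finite} mp"
  assumes M: "Suc ((CARD('a) - 1) * M) = CARD('a) ^ m" "1 \<le> M"
    and p: "p \<in> carrier (mp_ring 2)" "inv_mod m p" "moore 1 vx vy * p \<in> trunc (CARD('a) ^ m)"
    and dsum0: "inv_mod m (dsum M 0 vx (vy :: 'a mp))"
  shows "\<exists>d. p - (\<Sum>e<M. mp_const (d e) * dsum M e vx vy)
      - mp_const (d M) * (vx ^ ((CARD('a) - 1) * M) * vy ^ ((CARD('a) - 1) * M)) \<in> trunc (CARD('a) ^ m)"
proof -
  define r where "r = CARD('a) - 1"
  define N where "N = CARD('a) ^ m"
  have r: "1 \<le> r" "CARD('a) = Suc r" using card_field_gt_1[where 'a='a] by (auto simp: r_def)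
  have M': "Suc (r * M) = N" using M by (simp add: r_def N_def)
  have lt: "r * i < N" if "i \<le> M" for i using mult_le_mono2[OF that, of r] M' by linarith
  define c where "c = (\<lambda>i j. coef p (r * i) (r * j))"
  have sym: "c i j = c j i" if "i \<le> M" "j \<le> M" for i j
  proof -
    have "lin_subst 0 1 1 0 p - p \<in> trunc N" unfolding N_def using p(2) by (rule inv_modD) simp
    then have "coef (lin_subst 0 1 1 0 p - p) (r * i) (r * j) = 0"
      by (rule coef_trunc[OF _ lt[OF that(1)] lt[OF that(2)]])
    then show ?thesis by (simp add: coef_diff coef_swap[OF p(1)] c_def)
  qed
  have step: "(if 1 \<le> j then c i (j - 1) else 0) = (if 1 \<le> i then c (i - 1) j else 0)" if "i < M" "j < M" for i j
  proof -
    have le: "r * i + 1 < N" if "i < M" for i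
      using mult_le_mono2[of "Suc i" M r] that M' r(1) by simp
    have "moore 1 vx vy * p = vx ^ 1 * vy ^ CARD('a) * p - vx ^ CARD('a) * vy ^ 1 * p"
      by (simp add: moore_def left_diff_distrib)
    moreover have "coef (moore 1 vx vy * p) (r * i + 1) (r * j + 1) = 0"
      using p(3) le[OF that(1)] le[OF that(2)] unfolding N_def[symmetric] by (intro coef_trunc)
    ultimately have "coef (vx ^ 1 * vy ^ CARD('a) * p) (r * i + 1) (r * j + 1)
        = coef (vx ^ CARD('a) * vy ^ 1 * p) (r * i + 1) (r * j + 1)"
      by (simp only: coef_diff right_minus_eq)
    moreover have le_iff: "CARD('a) \<le> r * k + 1 \<longleftrightarrow> 1 \<le> k" for k using r by (cases k) auto
    moreover have diff: "r * k + 1 - CARD('a) = r * (k - 1)" for k using r by (cases k) auto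
    moreover have "1 \<le> r * k + 1 \<longleftrightarrow> True" "r * k + 1 - 1 = r * k" for k by simp_all
    ultimately show ?thesis
      by (simp only: coef_monomial_mult[OF p(1)] le_iff diff c_def simp_thms)
  qed
  have antidiagonal: "c i j = (if M \<le> i + j + 1 then c (M - 1) (i + j + 1 - M) else 0)" if "i < M" "j < M" for i j
  proof (cases "M \<le> i + j + 1")
    case True
    have "c i j = c (i + k) (j - k)" if "k \<le> j" "i + k < M" for k
      using that
    proof (induction k)
      case (Suc k)
      have "c (i + k) (j - k) = c (i + Suc k) (j - Suc k)"
      proof -
        have "i + Suc k < M" "j - k < M" "1 \<le> j - k" "j - k - 1 = j - Suc k" "1 \<le> i + Suc k" "i + Suc k - 1 = i + k"
          using Suc.prems \<open>j < M\<close> by auto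
        then show ?thesis using step[of "i + Suc k" "j - k"] by (simp only: if_True)
      qed
      then show ?case using Suc by simp
    qed simp
    from this[of "M - 1 - i"] show ?thesis using True that by (simp add: algebra_simps)
  next
    case False
    have "c i j = c (i - k) (j + k)" if "k \<le> i" for k
      using that
    proof (induction k)
      case (Suc k)
      have "c (i - k) (j + k) = c (i - Suc k) (j + Suc k)"
      proof -
        have "i - k < M" "j + Suc k < M" "1 \<le> i - k" "i - k - 1 = i - Suc k" "1 \<le> j + Suc k" "j + Suc k - 1 = j + k"
          using Suc.prems False by auto
        then show ?thesis using step[of "i - k" "j + Suc k"] by (simp only: if_True)
      qed
      then show ?case using Suc by simp
    qed simp
    from this[of i] have "c i j = c 0 (i + j)" by (simp add: add.commute)
    also have "c 0 (i + j) = 0" using step[of 0 "i + j + 1"] False by simp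
    finally show ?thesis using False by simp
  qed
  let ?top = "vx ^ (r * M) * vy ^ (r * M) :: 'a mp"
  let ?T = "\<lambda>i j. mp_const (c M (if i = M then j else i)) * vx ^ (r * i) * vy ^ (r * j) :: 'a mp"
  define S where "S = (\<Sum>e<M. mp_const (c (M - 1) e) * dsum M e vx vy) + mp_const (c M M) * ?top"
  define H where "H = (\<Sum>k<M. mp_const (c M k) * vx ^ (r * M) * vy ^ (r * k) + mp_const (c M k) * vx ^ (r * k) * vy ^ (r * M))"
  have "p - S - H \<in> trunc N"
  proof (rule truncI_coef)
    show "p - S - H \<in> carrier (mp_ring 2)"
      unfolding S_def H_def by (intro mp_ring_intros vx_vy_closed p dsum_closed)
    fix a b assume ab: "a < N" "b < N"
    show "coef (p - S - H) a b = 0"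
    proof (cases "r dvd a \<and> r dvd b")
      case False
      then have "coef p a b = 0" using torus_exponents[OF p(1,2), of a b] ab by (auto simp: r_def N_def)
      moreover have "coef (dsum M e vx vy) a b = (0 :: 'a)" for e
        using False unfolding r_def by (rule coef_non_multiple(1))
      moreover have "coef (vx ^ (r * k) * vy ^ (r * l)) a b = (0 :: 'a)" for k l
        using False unfolding r_def by (rule coef_non_multiple(2))
      ultimately have "coef p a b = 0" "coef S a b = 0" "coef H a b = 0"
        unfolding S_def H_def by (simp_all add: coef_add coef_sum coef_const_mult mult.assoc)
      then show ?thesis by (simp add: coef_diff)
    next
      case True
      then obtain i j where [simp]: "a = r * i" "b = r * j" by (auto elim!: dvdE)
      have ij: "i \<le> M" "j \<le> M"
      proof -
        have "r * i < Suc (r * M)" "r * j < Suc (r * M)" using ab unfolding M' by simp_all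
        then have "r * i \<le> r * M" "r * j \<le> r * M" by (simp_all only: less_Suc_eq_le)
        then show "i \<le> M" "j \<le> M" using r(1) by simp_all
      qed
      have r0: "r * k = r * l \<longleftrightarrow> k = l" for k l using r(1) by simp
      have mono: "coef (mp_const e * vx ^ (r * k) * vy ^ (r * l)) (r * i) (r * j) = (if k = i \<and> l = j then e else 0)" for k l e
        by (simp only: coef_monomial r0)
      have S: "coef S (r * i) (r * j) = (if i < M \<and> j < M \<and> M \<le> i + j + 1 then c (M - 1) (i + j + 1 - M) else 0)
          + (if M = i \<and> M = j then c M M else 0)"
      proof -
        have "coef (\<Sum>e<M. mp_const (c (M - 1) e) * dsum M e vx vy) (r * i) (r * j)
            = (\<Sum>e<M. if i < M \<and> j < M \<and> i + j + 1 = M + e then c (M - 1) e else 0)"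
          unfolding coef_sum coef_const_mult r_def by (intro sum.cong refl) (subst coef_dsum, auto)
        also have "\<dots> = (\<Sum>e<M. if e = i + j + 1 - M then (if i < M \<and> j < M \<and> M \<le> i + j + 1 then c (M - 1) (i + j + 1 - M) else 0) else 0)"
          by (intro sum.cong) auto
        also have "\<dots> = (if i < M \<and> j < M \<and> M \<le> i + j + 1 then c (M - 1) (i + j + 1 - M) else 0)"
          by auto
        finally show ?thesis unfolding S_def coef_add mult.assoc[symmetric] mono by simp
      qed
      have H: "coef H (r * i) (r * j) = (if i = M \<and> j < M then c M j else 0) + (if j = M \<and> i < M then c M i else 0)"
      proof -
        have "coef H (r * i) (r * j) = (\<Sum>k<M. if k = j then (if i = M then c M j else 0) else 0)
            + (\<Sum>k<M. if k = i then (if j = M then c M i else 0) else 0)"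
          unfolding H_def coef_sum coef_add mono sum.distrib by (intro arg_cong2[where f = "(+)"] sum.cong) auto
        then show ?thesis by auto
      qed
      have "coef p (r * i) (r * j) = c i j" by (simp add: c_def)
      then show ?thesis
        using ij antidiagonal[of i j] sym[of i j] by (auto simp: coef_diff S H)
    qed
  qed
  moreover have "c M k = 0" if k: "k < M" for k
  proof -
    have invS: "inv_mod m S"
      unfolding S_def
    proof (intro inv_mod_add inv_mod_sum inv_mod_const_mult)
      show "inv_mod m ?top" using inv_mod_top[OF M(1)] by (simp add: r_def)
      fix e assume "e \<in> {..<M}"
      then show "inv_mod m (dsum M e vx (vy :: 'a mp))" using dsum0 inv_mod_dsum_Suc[OF M(1)] by (cases e) auto
    qed
    have "lin_subst 1 0 1 1 H - H = (lin_subst 1 0 1 1 p - p) - (lin_subst 1 0 1 1 S - S)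
        - lin_subst 1 0 1 1 (p - S - H) + (p - S - H)"
      unfolding lin_subst_hom(2) by simp
    moreover have "lin_subst 1 0 1 1 p - p \<in> trunc N" "lin_subst 1 0 1 1 S - S \<in> trunc N"
      unfolding N_def using inv_modD[OF p(2), of 1 1 0 1] inv_modD[OF invS, of 1 1 0 1] by auto
    moreover note \<open>p - S - H \<in> trunc N\<close>
    moreover have "lin_subst 1 0 1 1 (p - S - H) \<in> trunc N"
      using \<open>p - S - H \<in> trunc N\<close> lin_subst_trunc unfolding N_def by blast
    ultimately have inv: "lin_subst 1 0 1 1 H - H \<in> trunc N" by (simp only: trunc_add trunc_diff)
    \<comment> \<open>The term of \<open>u^k (x + y)^(N - 1)\<close> with a single new factor \<open>x\<close>; its coefficient is \<open>N - 1 = - 1\<close>.\<close>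
    define a where "a = r * k + 1"
    define b where "b = r * M - 1"
    have rM: "1 \<le> r * M" using mult_le_mono[OF r(1) M(2)] by simp
    have rk: "r * k + r \<le> r * M" using mult_le_mono2[of "Suc k" M r] k by simp
    have ab: "a < N" "b < N" using rk r(1) rM M' by (simp_all add: a_def b_def)
    have sum_ab: "a + b = r * (M + k)" using rM by (simp add: a_def b_def distrib_left)
    have eq: "lin_subst 1 0 1 1 H - H = (\<Sum>k<M.
        (mp_const (c M k) * vx ^ (r * M) * (vx + vy) ^ (r * k) - mp_const (c M k) * vx ^ (r * M) * vy ^ (r * k))
        + (mp_const (c M k) * vx ^ (r * k) * (vx + vy) ^ (r * M) - mp_const (c M k) * vx ^ (r * k) * vy ^ (r * M)))"
      by (simp add: H_def lin_subst_hom sum.distrib sum_subtractf algebra_simps)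
    have coeff: "coef ((mp_const (c M k') * vx ^ (r * M) * (vx + vy) ^ (r * k') - mp_const (c M k') * vx ^ (r * M) * vy ^ (r * k'))
        + (mp_const (c M k') * vx ^ (r * k') * (vx + vy) ^ (r * M) - mp_const (c M k') * vx ^ (r * k') * vy ^ (r * M))) a b
        = (if k' = k then - c M k else 0)" for k'
    proof -
      have s1: "r * M + r * k' = a + b \<longleftrightarrow> k' = k" and s2: "r * k' + r * M = a + b \<longleftrightarrow> k' = k"
        unfolding sum_ab using r(1) by (auto simp flip: distrib_left)
      have "of_nat (r * k choose b) = (if r * k = b then 1 else 0 :: 'a)"
      proof (cases "r * k = b")
        case False
        then have "r * k < b" using rk r(1) by (simp add: b_def)
        then show ?thesis using False by (simp add: binomial_eq_0)
      qed simp
      moreover have "r * M = a \<longleftrightarrow> r * k = b" if "k' = k" using sum_ab by (simp add: distrib_left) linarith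
      moreover have "of_nat (r * M choose b) = (-1 :: 'a)"
      proof -
        have "r * M choose b = r * M choose 1"
          unfolding b_def using rM by (subst binomial_symmetric) auto
        moreover have "CARD('a) ^ m - 1 = r * M" using M' by (simp add: N_def)
        then have "of_nat (r * M choose 1) = ((-1) ^ 1 :: 'a)"
          using rM by (subst (1) \<open>_ = r * M\<close>[symmetric], intro binomial_power_minus_1) simp
        ultimately show ?thesis by (simp only: power_one_right)
      qed
      moreover have "r * M \<noteq> b" using rM unfolding b_def by linarith
      moreover have "\<not> (r * M = a \<and> r * k' = b)" if "k' \<noteq> k" using s1 that by auto
      ultimately show ?thesis
        unfolding coef_add coef_diff coef_shear coef_monomial s1 s2 by (cases "k' = k", simp_all) blast
    qed
    have "coef (lin_subst 1 0 1 1 H - H) a b = (\<Sum>k'<M. if k' = k then - c M k else 0)"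
      unfolding eq coef_sum by (intro sum.cong refl coeff)
    then have "coef (lin_subst 1 0 1 1 H - H) a b = - c M k" using k by simp
    then show ?thesis using coef_trunc[OF inv ab] by simp
  qed
  ultimately have "p - S \<in> trunc N" by (simp add: H_def)
  then show ?thesis
    unfolding N_def S_def r_def
    by (intro exI[of _ "\<lambda>e. if e = M then c M M else c (M - 1) e"]) (simp add: diff_diff_eq)
qed

section \<open>The Dickson algebra modulo the annihilator\<close>

text \<open>
  For \<open>s = \<lambda>\<^sub>2\<close>, the intervals \<open>[\<lambda>\<^sub>1] - [s] \<le> a < [\<lambda>\<^sub>1 + 1] - [s]\<close> that are allowed for \<open>s \<le> \<lambda>\<^sub>1 \<le> m - 2\<close> fit together to the
  single condition \<open>a < [m - 1] - [s]\<close>.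
\<close>

definition dickson_exps :: "nat \<Rightarrow> nat \<Rightarrow> (nat \<times> nat) set" where
  "dickson_exps q m = {(a, b). \<exists>s. s + 2 \<le> m \<and> qnum q s \<le> b \<and> b < qnum q (s + 1) \<and> a + qnum q s < qnum q (m - 1)}"

lemma finite_dickson_exps [simp]: "finite (dickson_exps q m)"
proof (rule finite_subset)
  show "dickson_exps q m \<subseteq> {..<qnum q (m - 1)} \<times> {..<qnum q (m - 1)}"
  proof
    fix ab assume "ab \<in> dickson_exps q m"
    then obtain a b s where ab: "ab = (a, b)" "s + 2 \<le> m" "b < qnum q (s + 1)" "a + qnum q s < qnum q (m - 1)"
      by (auto simp: dickson_exps_def)
    have "qnum q (s + 1) \<le> qnum q (m - 1)" using ab(2) by (intro qnum_mono) simp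
    then show "ab \<in> {..<qnum q (m - 1)} \<times> {..<qnum q (m - 1)}" using ab by simp
  qed
qed simp

lemma qnum_interval: "b < qnum q n \<Longrightarrow> \<exists>s<n. qnum q s \<le> b \<and> b < qnum q (s + 1)"
proof (induction n)
  case (Suc n)
  then show ?case by (cases "b < qnum q n") (auto intro: less_SucI)
qed simp

lemma qnum_interval_unique:
  assumes "qnum q s \<le> b" "b < qnum q (s + 1)" "qnum q s' \<le> b" "b < qnum q (s' + 1)"
  shows "s = s'"
proof (rule ccontr)
  assume "s \<noteq> s'"
  then consider "s + 1 \<le> s'" | "s' + 1 \<le> s" by linarith
  then show False
    using qnum_mono[of "s + 1" s' q] qnum_mono[of "s' + 1" s q] assms by cases auto
qed

lemma moore_power_trunc:
  assumes "s + k = m"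
  shows "moore k vx (vy :: 'a mp) ^ (CARD('a) ^ s) \<in> trunc (CARD('a::{field,finite}) ^ m)"
proof -
  have "CARD('a) ^ k * CARD('a) ^ s = CARD('a) ^ m" using assms by (metis power_add add.commute)
  then have "(vx :: 'a mp) ^ (CARD('a) ^ k * CARD('a) ^ s) \<in> trunc (CARD('a) ^ m)"
    "(vy :: 'a mp) ^ (CARD('a) ^ k * CARD('a) ^ s) \<in> trunc (CARD('a) ^ m)"
    by (simp_all add: vx_power_trunc vy_power_trunc)
  then show ?thesis
    unfolding moore_def mp_frobenius_diff power_mult_distrib power_mult[symmetric]
    by (intro trunc_diff trunc_mult trunc_mult_right)
qed

text \<open>
  The summand \<open>k\<close> is annihilated by \<open>L\<close> in the quotient, so that \<open>annihilator_of_moore\<close> applies to it.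
\<close>

definition dickson_span :: "nat \<Rightarrow> 'a::{field,finite} mp set" where
  "dickson_span m = {p. \<exists>c. \<exists>k\<in>dickson_ring. moore 1 vx vy * k \<in> trunc (CARD('a) ^ m) \<and>
     p = (\<Sum>(a, b)\<in>dickson_exps CARD('a) m. mp_const (c (a, b)) * q1 ^ a * q0 ^ b) + k}"

lemma dickson_span_annihilated:
  fixes k :: "'a::{field,finite} mp"
  assumes "k \<in> dickson_ring" "moore 1 vx vy * k \<in> trunc (CARD('a) ^ m)"
  shows "k \<in> dickson_span m"
  unfolding dickson_span_def using assms
  by (intro CollectI exI[of _ "\<lambda>_. 0"] bexI[of _ k]) (auto intro!: sum.neutral)

lemma dickson_span_add:
  fixes p p' :: "'a::{field,finite} mp"
  assumes "p \<in> dickson_span m" "p' \<in> dickson_span m"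
  shows "p + p' \<in> dickson_span m"
proof -
  let ?S = "\<lambda>c :: nat \<times> nat \<Rightarrow> 'a. \<Sum>(a, b)\<in>dickson_exps CARD('a) m. mp_const (c (a, b)) * q1 ^ a * q0 ^ b"
  from assms obtain c k c' k' where
    k: "k \<in> dickson_ring" "moore 1 vx vy * k \<in> trunc (CARD('a) ^ m)" "p = ?S c + k" and
    k': "k' \<in> dickson_ring" "moore 1 vx vy * k' \<in> trunc (CARD('a) ^ m)" "p' = ?S c' + k'"
    unfolding dickson_span_def by blast
  have "?S (\<lambda>ab. c ab + c' ab) = ?S c + ?S c'"
    by (simp add: mp_const_add distrib_right sum.distrib case_prod_beta)
  then have "p + p' = ?S (\<lambda>ab. c ab + c' ab) + (k + k')" using k(3) k'(3) by simp
  moreover have "k + k' \<in> dickson_ring" "moore 1 vx vy * (k + k') \<in> trunc (CARD('a) ^ m)"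
    using k k' by (simp_all add: dickson_ring.add distrib_left trunc_add)
  ultimately show ?thesis
    unfolding dickson_span_def
    by (intro CollectI exI[of _ "\<lambda>ab. c ab + c' ab"] bexI[of _ "k + k'"]) auto
qed

lemma dickson_span_monomial:
  assumes "(a, b) \<in> dickson_exps CARD('a::{field,finite}) m"
  shows "mp_const (c :: 'a) * q1 ^ a * q0 ^ b \<in> dickson_span m"
proof -
  have "(\<Sum>(a', b')\<in>dickson_exps CARD('a) m. mp_const (if (a', b') = (a, b) then c else 0) * q1 ^ a' * q0 ^ b')
      = (\<Sum>ab\<in>dickson_exps CARD('a) m. if ab = (a, b) then mp_const c * q1 ^ a * q0 ^ b else 0)"
  proof (rule sum.cong[OF refl])
    fix ab
    show "(case ab of (a', b') \<Rightarrow> mp_const (if (a', b') = (a, b) then c else 0) * q1 ^ a' * q0 ^ b')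
        = (if ab = (a, b) then mp_const c * q1 ^ a * q0 ^ b else 0)"
    proof (cases "ab = (a, b)")
      case False
      then show ?thesis
        by (cases ab) (simp only: prod.case if_False mp_const_0 mult_zero_left simp_thms)
    qed simp
  qed
  also have "\<dots> = mp_const c * q1 ^ a * q0 ^ b" using assms by simp
  finally show ?thesis
    unfolding dickson_span_def
    by (intro CollectI exI[of _ "\<lambda>ab. if ab = (a, b) then c else 0"] bexI[of _ 0]) (auto intro: dickson_ring.zero)
qed

lemma moore_mult_q0_power:
  assumes "qnum CARD('a) s \<le> b"
  shows "moore 1 vx vy * q0 ^ b
    = moore 1 vx (vy :: 'a::{field,finite} mp) ^ (CARD('a) ^ s) * q0 ^ (b - qnum CARD('a) s)"
proof -
  have "moore 1 vx vy * q0 ^ qnum CARD('a) s = moore 1 vx (vy :: 'a mp) ^ ((CARD('a) - 1) * qnum CARD('a) s + 1)"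
    unfolding q0_def power_mult[symmetric] by simp
  also have "(CARD('a) - 1) * qnum CARD('a) s + 1 = CARD('a) ^ s" by (rule qnum_power) simp
  finally have "moore 1 vx vy * q0 ^ qnum CARD('a) s * q0 ^ (b - qnum CARD('a) s)
      = moore 1 vx (vy :: 'a mp) ^ (CARD('a) ^ s) * q0 ^ (b - qnum CARD('a) s)" by simp
  then show ?thesis using assms by (simp add: mult.assoc flip: power_add)
qed

text \<open>
  By downward induction on the power of \<open>q0\<close>. On the layer \<open>[s] \<le> b < [s + 1]\<close> the product of the
  linear forms times \<open>q0\<^sup>b\<close> is a multiple of its \<open>q\<^sup>s\<close>-th power, which is killed by a power of a quotient
  of Moore determinants with leading term a power of \<open>q1\<close>; so this power of \<open>q1\<close> can be
  replaced by terms that have more factors \<open>q0\<close>.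
\<close>

lemma q0_power_mult_dickson_span:
  fixes p :: "'a::{field,finite} mp"
  assumes "1 \<le> m"
  shows "p \<in> dickson_ring \<Longrightarrow> q0 ^ b * p \<in> dickson_span m"
proof (induction "qnum CARD('a) (m - 1) - b" arbitrary: b p)
  case 0
  then have "qnum CARD('a) (m - 1) \<le> b" by simp
  have "moore 1 vx (vy :: 'a mp) ^ (CARD('a) ^ (m - 1)) \<in> trunc (CARD('a) ^ m)"
    using assms by (intro moore_power_trunc) simp
  then have "moore 1 vx vy * (q0 ^ b * p) \<in> trunc (CARD('a) ^ m)"
    unfolding mult.assoc[symmetric] moore_mult_q0_power[OF \<open>qnum CARD('a) (m - 1) \<le> b\<close>]
    by (intro trunc_mult_right)
  then show ?case using 0 by (intro dickson_span_annihilated dickson_ring_intros)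
next
  case (Suc n)
  have IH: "q0 ^ (b + 1) * r \<in> dickson_span m" if "r \<in> dickson_ring" for r :: "'a mp"
    using Suc.hyps(1)[of "b + 1" r] Suc.hyps(2) that by simp
  have "b < qnum CARD('a) (m - 1)" using Suc.hyps(2) by simp
  then obtain s where s: "s < m - 1" "qnum CARD('a) s \<le> b" "b < qnum CARD('a) (s + 1)"
    using qnum_interval by blast
  define k where "k = m - 1 - s"
  have k: "s + Suc k = m" "s + k = m - 1" using s(1) by (auto simp: k_def)
  define X where "X = CARD('a) ^ s * qnum CARD('a) k"
  have X: "qnum CARD('a) (m - 1) = qnum CARD('a) s + X" using qnum_add[of "CARD('a)" s k] k by (simp add: X_def)
  define \<beta> where "\<beta> = dsum (qnum CARD('a) (Suc k)) 0 vx (vy :: 'a mp)"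
  obtain w where w: "w \<in> dickson_ring" "\<beta> = q1 ^ qnum CARD('a) k + q0 * w"
    using beta_leading_term[of k, where 'a='a] unfolding \<beta>_def by blast
  have "\<beta> ^ (CARD('a) ^ s) = q1 ^ X + q0 ^ (CARD('a) ^ s) * w ^ (CARD('a) ^ s)"
    unfolding w(2) mp_frobenius_add power_mult_distrib by (simp add: X_def mult.commute flip: power_mult)
  also have "q0 ^ (CARD('a) ^ s) = q0 * (q0 :: 'a mp) ^ (CARD('a) ^ s - 1)"
    by (simp flip: power_Suc)
  finally have q1X: "q1 ^ X = \<beta> ^ (CARD('a) ^ s) - q0 * (q0 ^ (CARD('a) ^ s - 1) * w ^ (CARD('a) ^ s))"
    by (simp add: mult.assoc)
  have \<beta>: "\<beta> \<in> dickson_ring" unfolding w(2) using w(1) by (intro dickson_ring_intros)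
  have killed: "moore 1 vx vy * (q0 ^ b * (\<beta> ^ (CARD('a) ^ s) * r)) \<in> trunc (CARD('a) ^ m)" for r
  proof -
    have "moore 1 vx vy * (q0 ^ b * (\<beta> ^ (CARD('a) ^ s) * r))
        = (moore 1 vx vy * \<beta>) ^ (CARD('a) ^ s) * (q0 ^ (b - qnum CARD('a) s) * r)"
      unfolding mult.assoc[symmetric] moore_mult_q0_power[OF s(2)] power_mult_distrib by (simp add: mult_ac)
    also have "moore 1 vx vy * \<beta> = moore (Suc k) vx vy"
      unfolding \<beta>_def by (rule moore_eq_beta[symmetric])
    finally have eq: "moore 1 vx vy * (q0 ^ b * (\<beta> ^ (CARD('a) ^ s) * r))
        = moore (Suc k) vx vy ^ (CARD('a) ^ s) * (q0 ^ (b - qnum CARD('a) s) * r)" .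
    show ?thesis unfolding eq by (intro trunc_mult_right moore_power_trunc k(1))
  qed
  from \<open>p \<in> dickson_ring\<close> show ?case
  proof induction
    case zero
    then show ?case by (auto intro!: dickson_span_annihilated dickson_ring.zero)
  next
    case (add p p')
    then show ?case by (simp add: distrib_left dickson_span_add)
  next
    case (monomial c a b')
    show ?case
    proof (cases b')
      case (Suc b'')
      then have eq: "q0 ^ b * (mp_const c * q1 ^ a * q0 ^ b') = q0 ^ (b + 1) * (mp_const c * q1 ^ a * q0 ^ b'')"
        by (simp add: mult_ac)
      show ?thesis unfolding eq by (rule IH[OF dickson_ring.monomial])
    next
      case 0
      show ?thesis
      proof (cases "a < X")
        case True
        then have "(a, b) \<in> dickson_exps CARD('a) m"
          unfolding dickson_exps_def mem_Collect_eq prod.case using s X by (intro exI[of _ s]) auto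
        from dickson_span_monomial[OF this, of c] show ?thesis by (simp add: 0 mult_ac)
      next
        case False
        then have "q1 ^ a = q1 ^ X * (q1 :: 'a mp) ^ (a - X)" by (simp flip: power_add)
        then have eq: "q0 ^ b * (mp_const c * q1 ^ a * q0 ^ b')
            = q0 ^ b * (\<beta> ^ (CARD('a) ^ s) * (mp_const c * q1 ^ (a - X)))
            + q0 ^ (b + 1) * (mp_const (- c) * (q1 ^ (a - X) * (q0 ^ (CARD('a) ^ s - 1) * w ^ (CARD('a) ^ s))))"
          by (simp add: 0 q1X mp_const_uminus left_diff_distrib right_diff_distrib mult_ac)
        have "mp_const (- c) * (q1 ^ (a - X) * (q0 ^ (CARD('a) ^ s - 1) * w ^ (CARD('a) ^ s))) \<in> dickson_ring"
          using w(1) by (intro dickson_ring_intros)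
        note 2 = IH[OF this]
        have 1: "q0 ^ b * (\<beta> ^ (CARD('a) ^ s) * (mp_const c * q1 ^ (a - X))) \<in> dickson_span m"
          using \<beta> killed by (intro dickson_span_annihilated dickson_ring_intros)
        show ?thesis unfolding eq by (rule dickson_span_add[OF 1 2])
      qed
    qed
  qed
qed

section \<open>Linear independence\<close>

lemma subst_single_var:
  fixes p P :: "'a::comm_ring_1 mp"
  shows "(mp_var i - P) dvd (p - mp_subst (mp_var(i := P)) p)"
proof (induction p rule: mp_induct)
  case (add p p')
  have "p + p' - mp_subst (mp_var(i := P)) (p + p')
      = (p - mp_subst (mp_var(i := P)) p) + (p' - mp_subst (mp_var(i := P)) p')"
    by (simp add: mp_subst_add)
  then show ?case using add by (simp only: dvd_add)
next
  case (mult p p')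
  have "p * p' - mp_subst (mp_var(i := P)) (p * p')
      = (p - mp_subst (mp_var(i := P)) p) * p' + mp_subst (mp_var(i := P)) p * (p' - mp_subst (mp_var(i := P)) p')"
    by (simp add: mp_subst_mult algebra_simps)
  then show ?case using mult by (simp only: dvd_add dvd_mult dvd_mult2)
qed auto

text \<open>
  The divisor \<open>d\<close> is coprime to the pair \<open>x^N\<close>, \<open>y^N\<close>. In place of unique factorization, this is proved for linear
  forms by substitution and then extended to products.
\<close>

definition cancels :: "nat \<Rightarrow> 'a::{field,finite} mp \<Rightarrow> bool" where
  "cancels N d \<longleftrightarrow> (\<forall>F. d dvd vx ^ N * F \<longrightarrow> d dvd vy ^ N * F \<longrightarrow> d dvd F)"

lemma cancels_mult:
  assumes "cancels N d" "cancels N d'" "d \<noteq> 0"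
  shows "cancels N (d * d')"
  unfolding cancels_def
proof (intro allI impI)
  fix F assume *: "d * d' dvd vx ^ N * F" "d * d' dvd vy ^ N * F"
  have "d dvd vx ^ N * F" "d dvd vy ^ N * F" using dvd_mult_left[OF *(1)] dvd_mult_left[OF *(2)] .
  then have "d dvd F" using assms(1) unfolding cancels_def by blast
  then obtain F' where F: "F = d * F'" ..
  have "d' dvd z * F'" if "d * d' dvd z * F" for z
    using that assms(3) unfolding F mult.left_commute[of z d F'] by simp
  from this[OF *(1)] this[OF *(2)] have "d' dvd F'" using assms(2) unfolding cancels_def by blast
  then show "d * d' dvd F" by (simp add: F)
qed

lemma cancels_1: "cancels N 1" by (simp add: cancels_def)

text \<open>
  Substituting \<open>P\<close> for the variable \<open>i\<close> is the reduction modulo the linear form. Its target is a domain, in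
  which \<open>x\<close> and \<open>y\<close> are not both zero.
\<close>

lemma cancels_linear:
  fixes P :: "'a::{field,finite} mp"
  assumes P: "mp_subst (mp_var(i := P)) P = P"
    and nz: "mp_subst (mp_var(i := P)) vx \<noteq> 0 \<or> mp_subst (mp_var(i := P)) vy \<noteq> 0"
  shows "cancels N (mp_var i - P)"
  unfolding cancels_def
proof (intro allI impI)
  let ?h = "mp_subst (mp_var(i := P))"
  fix F assume *: "mp_var i - P dvd vx ^ N * F" "mp_var i - P dvd vy ^ N * F"
  have "?h (mp_var i - P) = 0" by (simp add: mp_subst_diff P)
  then have "?h G = 0" if "mp_var i - P dvd G" for G
    using that by (auto elim!: dvdE simp: mp_subst_mult)
  from this[OF *(1)] this[OF *(2)] have "?h F = 0"
    using nz by (auto simp: mp_subst_mult mp_subst_power)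
  then show "mp_var i - P dvd F" using subst_single_var[of i P F] by simp
qed

lemma cancels_moore: "cancels N (moore 1 vx (vy :: 'a::{field,finite} mp))"
proof -
  have x: "cancels N (vx :: 'a mp)"
    using cancels_linear[of 1 0 N] vy_neq_0 by (simp add: mp_subst_0 vx_def vy_def)
  have y: "cancels N (vy + mp_const c * vx)" for c :: 'a
  proof -
    have "cancels N (mp_var 2 - (- (mp_const c * vx)))"
      using vx_neq_0 by (intro cancels_linear) (auto simp: mp_subst_hom vx_def vy_def)
    then show ?thesis by (simp add: vy_def)
  qed
  have nz: "vy + mp_const c * vx \<noteq> 0" for c :: 'a
  proof
    assume "vy + mp_const c * vx = 0"
    then have "subst2 0 vy (vy + mp_const c * vx) = 0" by simp
    then show False by (simp add: subst2_hom vy_neq_0)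
  qed
  have "cancels N (\<Prod>c\<in>A. vy + mp_const c * vx)" if "finite A" for A :: "'a set"
    using that by (induction A rule: finite_induct) (simp_all add: cancels_1 cancels_mult y nz)
  then show ?thesis unfolding moore_1_prod by (simp add: cancels_mult x vx_neq_0)
qed

lemma cancels_power: "cancels N d \<Longrightarrow> d \<noteq> 0 \<Longrightarrow> cancels N (d ^ k)"
  by (induction k) (simp_all add: cancels_1 cancels_mult)

lemma subst2_vx_0:
  "subst2 vx 0 q0 = (0 :: 'a::{field,finite} mp)" "subst2 vx 0 (moore 1 vx vy) = (0 :: 'a mp)"
  "subst2 vx 0 q1 = (vx :: 'a mp) ^ ((CARD('a) - 1) * CARD('a))"
proof -
  show moore: "subst2 vx 0 (moore 1 vx vy) = (0 :: 'a mp)"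
    unfolding subst2_moore by (simp add: moore_def power_0_left)
  show "subst2 vx 0 q0 = (0 :: 'a mp)"
    using card_field_gt_1[where 'a='a] by (simp only: q0_def subst2_hom moore) simp
  show "subst2 vx 0 q1 = (vx :: 'a mp) ^ ((CARD('a) - 1) * CARD('a))"
    using card_field_gt_1[where 'a='a] unfolding q1_alt y_orbit_def by (simp add: subst2_hom power_0_left)
qed

text \<open>
  Write \<open>P = q^s\<close>. The power \<open>x^P y^N - x^N y^P\<close> of a Moore determinant is divisible by \<open>L^P\<close>. If
  \<open>L^w H = x^N A\<^sub>1 + y^N A\<^sub>2\<close>, multiplication by \<open>x^P\<close> or by \<open>y^P\<close> therefore leads to multiples \<open>x^N \<Psi>\<close> and \<open>y^N \<Psi>\<close>
  with the same factor \<open>\<Psi>\<close>, up to multiples of \<open>L^P\<close>. Hence \<open>L^w\<close> divides \<open>\<Psi>\<close> and can be cancelled. The remaining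
  error is a multiple of \<open>L\<close>, since \<open>w < P\<close>, and vanishes on the line \<open>y = 0\<close>.
\<close>

lemma moore_power_mult_trunc:
  fixes H :: "'a::{field,finite} mp"
  assumes "moore 1 vx vy ^ w * H \<in> trunc (CARD('a) ^ m)" "w < CARD('a) ^ s" "s \<le> m"
  shows "vx ^ (CARD('a) ^ s) * subst2 vx 0 H \<in> trunc (CARD('a) ^ m)"
proof -
  let ?L = "moore 1 vx vy :: 'a mp"
  define P where "P = CARD('a) ^ s"
  define N where "N = CARD('a) ^ m"
  obtain A1 A2 where A: "?L ^ w * H = vx ^ N * A1 + vy ^ N * A2"
    using assms(1) by (auto simp: trunc_def N_def)
  define \<beta> where "\<beta> = dsum (qnum CARD('a) (m - s)) 0 vx (vy :: 'a mp)"
  have "N = CARD('a) ^ (m - s) * P" using assms(3) by (simp add: N_def P_def flip: power_add)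
  then have "vx ^ P * vy ^ N - vx ^ N * vy ^ P = (moore (m - s) vx vy :: 'a mp) ^ P"
    unfolding moore_def P_def mp_frobenius_diff by (simp add: power_mult_distrib power_mult)
  also have "\<dots> = ?L ^ P * \<beta> ^ P" unfolding \<beta>_def moore_eq_beta[of "m - s"] power_mult_distrib ..
  finally have E: "vx ^ P * vy ^ N = vx ^ N * vy ^ P + ?L ^ P * \<beta> ^ P" by (simp add: algebra_simps)
  have LP: "?L ^ P = ?L ^ w * ?L ^ (P - w)" using assms(2) by (simp add: P_def flip: power_add)
  define \<Psi> where "\<Psi> = vx ^ P * A1 + vy ^ P * A2"
  have x: "?L ^ w * (vx ^ P * H) = vx ^ N * \<Psi> + ?L ^ w * (?L ^ (P - w) * \<beta> ^ P * A2)"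
  proof -
    have "?L ^ w * (vx ^ P * H) = vx ^ P * (?L ^ w * H)" by (simp add: mult_ac)
    also have "\<dots> = vx ^ N * (vx ^ P * A1) + vx ^ P * vy ^ N * A2"
      unfolding A by (simp add: distrib_left mult_ac)
    also have "\<dots> = vx ^ N * \<Psi> + ?L ^ P * \<beta> ^ P * A2"
      unfolding E \<Psi>_def by (simp add: distrib_left distrib_right mult_ac)
    finally show ?thesis unfolding LP by (simp add: mult.assoc)
  qed
  have y: "?L ^ w * (vy ^ P * H) = vy ^ N * \<Psi> - ?L ^ w * (?L ^ (P - w) * \<beta> ^ P * A1)"
  proof -
    have "?L ^ w * (vy ^ P * H) = vy ^ P * (?L ^ w * H)" by (simp add: mult_ac)
    also have "\<dots> = vx ^ N * vy ^ P * A1 + vy ^ N * (vy ^ P * A2)"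
      unfolding A by (simp add: distrib_left mult_ac)
    also have "vx ^ N * vy ^ P = vx ^ P * vy ^ N - ?L ^ P * \<beta> ^ P" unfolding E by simp
    also have "(vx ^ P * vy ^ N - ?L ^ P * \<beta> ^ P) * A1 + vy ^ N * (vy ^ P * A2) = vy ^ N * \<Psi> - ?L ^ P * \<beta> ^ P * A1"
      unfolding \<Psi>_def by (simp add: distrib_left left_diff_distrib right_diff_distrib mult_ac)
    finally show ?thesis unfolding LP by (simp add: mult.assoc)
  qed
  have "?L ^ w dvd vx ^ N * \<Psi>"
    using x by (metis add_diff_cancel_right' dvd_diff dvd_triv_left)
  moreover have "?L ^ w dvd vy ^ N * \<Psi>"
    using y by (metis diff_add_cancel dvd_add dvd_triv_left)
  ultimately have "?L ^ w dvd \<Psi>"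
    using cancels_power[OF cancels_moore moore_neq_0, of N w] by (auto simp: cancels_def)
  then obtain \<Psi>' where "\<Psi> = ?L ^ w * \<Psi>'" ..
  with x have "?L ^ w * (vx ^ P * H) = ?L ^ w * (vx ^ N * \<Psi>' + ?L ^ (P - w) * \<beta> ^ P * A2)"
    by (simp add: distrib_left mult_ac)
  then have "vx ^ P * H = vx ^ N * \<Psi>' + ?L ^ (P - w) * \<beta> ^ P * A2"
    using moore_neq_0[where 'a='a] by (metis mult_left_cancel power_not_zero)
  then have "subst2 vx 0 (vx ^ P * H) = subst2 vx 0 (vx ^ N * \<Psi>' + ?L ^ (P - w) * \<beta> ^ P * A2)" by simp
  then have "vx ^ P * subst2 vx 0 H = vx ^ N * subst2 vx 0 \<Psi>' + subst2 vx 0 ?L ^ (P - w) * subst2 vx 0 \<beta> ^ P * subst2 vx 0 A2"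
    by (simp only: subst2_hom subst2_vx)
  then have "vx ^ P * subst2 vx 0 H = vx ^ N * subst2 vx 0 \<Psi>'"
    using assms(2) unfolding subst2_vx_0 by (simp add: P_def power_0_left)
  then show ?thesis unfolding P_def N_def by (simp only: trunc_mult_right vx_power_trunc order_refl)
qed

text \<open>
  In a relation, let \<open>Q\<^sub>0^b\<close> be the least power of \<open>Q\<^sub>0\<close> with a nonzero coefficient. By \<open>moore_power_mult_trunc\<close> the
  coefficient of \<open>Q\<^sub>0^b\<close>, a polynomial in \<open>Q\<^sub>1\<close>, may be restricted to the line \<open>y = 0\<close>. The bound on the exponent of
  \<open>Q\<^sub>1\<close> is exactly what keeps the resulting powers of \<open>x\<close> below \<open>x^N\<close>.
\<close>

lemma dickson_independent:
  fixes c :: "nat \<times> nat \<Rightarrow> 'a::{field,finite}"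
  assumes "moore 1 vx vy * (\<Sum>(a, b)\<in>dickson_exps CARD('a) m. mp_const (c (a, b)) * q1 ^ a * q0 ^ b)
      \<in> trunc (CARD('a) ^ m)"
  shows "\<forall>ab\<in>dickson_exps CARD('a) m. c ab = 0"
proof (rule ccontr)
  let ?D = "dickson_exps CARD('a) m"
  assume "\<not> ?thesis"
  define P where "P = (\<lambda>b. \<exists>a. (a, b) \<in> ?D \<and> c (a, b) \<noteq> 0)"
  from \<open>\<not> ?thesis\<close> have "\<exists>b. P b" by (auto simp: P_def)
  define b where "b = (LEAST b. P b)"
  have "P b" unfolding b_def by (rule LeastI_ex) fact
  then obtain a0 where a0: "(a0, b) \<in> ?D" "c (a0, b) \<noteq> 0" unfolding P_def by blast
  have min: "c (a, b') = 0" if "(a, b') \<in> ?D" "b' < b" for a b'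
  proof -
    have "\<not> P b'" using that(2) unfolding b_def by (rule not_less_Least)
    then show ?thesis using that(1) unfolding P_def by blast
  qed
  from a0(1) obtain s where s: "s + 2 \<le> m" "qnum CARD('a) s \<le> b" "b < qnum CARD('a) (s + 1)"
    unfolding dickson_exps_def mem_Collect_eq prod.case by blast
  define X where "X = qnum CARD('a) (m - 1) - qnum CARD('a) s"
  have X: "(a, b) \<in> ?D \<longleftrightarrow> a < X" for a
  proof
    assume "(a, b) \<in> ?D"
    then obtain s' where s': "qnum CARD('a) s' \<le> b" "b < qnum CARD('a) (s' + 1)" "a + qnum CARD('a) s' < qnum CARD('a) (m - 1)"
      unfolding dickson_exps_def mem_Collect_eq prod.case by blast
    then have "s' = s" using qnum_interval_unique s(2,3) by blast
    then show "a < X" using s'(3) by (simp add: X_def)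
  next
    assume "a < X"
    then have "a + qnum CARD('a) s < qnum CARD('a) (m - 1)" by (simp add: X_def)
    then show "(a, b) \<in> ?D" unfolding dickson_exps_def mem_Collect_eq prod.case using s by blast
  qed
  have q: "1 < CARD('a)" by (rule card_field_gt_1)
  define H where "H = (\<Sum>a<X. mp_const (c (a, b)) * q1 ^ a)"
  define R where "R = (\<Sum>(a, b')\<in>{ab \<in> ?D. b < snd ab}. mp_const (c (a, b')) * q1 ^ a * q0 ^ (b' - b - 1))"
  have "(\<Sum>(a, b)\<in>?D. mp_const (c (a, b)) * q1 ^ a * q0 ^ b)
      = (\<Sum>(a, b')\<in>{ab \<in> ?D. snd ab = b} \<union> {ab \<in> ?D. b < snd ab}. mp_const (c (a, b')) * q1 ^ a * q0 ^ b')"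
    using min by (intro sum.mono_neutral_right) (auto simp: not_less_iff_gr_or_eq)
  also have "\<dots> = (\<Sum>(a, b')\<in>{ab \<in> ?D. snd ab = b}. mp_const (c (a, b')) * q1 ^ a * q0 ^ b')
      + (\<Sum>(a, b')\<in>{ab \<in> ?D. b < snd ab}. mp_const (c (a, b')) * q1 ^ a * q0 ^ b')"
    by (rule sum.union_disjoint) auto
  also have "(\<Sum>(a, b')\<in>{ab \<in> ?D. snd ab = b}. mp_const (c (a, b')) * q1 ^ a * q0 ^ b') = q0 ^ b * H"
  proof -
    have "{ab \<in> ?D. snd ab = b} = (\<lambda>a. (a, b)) ` {..<X}" using X by force
    then show ?thesis
      unfolding H_def sum_distrib_left
      by (simp only:) (subst sum.reindex, auto simp: inj_on_def mult_ac)
  qed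
  also have "(\<Sum>(a, b')\<in>{ab \<in> ?D. b < snd ab}. mp_const (c (a, b')) * q1 ^ a * q0 ^ b') = q0 ^ b * (q0 * R)"
  proof -
    have "q0 ^ b' = q0 ^ b * (q0 * (q0 :: 'a mp) ^ (b' - b - 1))" if "b < b'" for b'
    proof -
      have "b' = b + Suc (b' - b - 1)" using that by simp
      then show ?thesis by (metis power_add power_Suc)
    qed
    then show ?thesis
      unfolding R_def sum_distrib_left case_prod_beta
      by (intro sum.cong refl) (simp only: mem_Collect_eq mult_ac)
  qed
  finally have mem: "moore 1 vx vy * (q0 ^ b * (H + q0 * R)) \<in> trunc (CARD('a) ^ m)"
    using assms by (simp only: distrib_left)
  have w: "moore 1 vx vy * (q0 ^ b * (H + q0 * R)) = moore 1 vx vy ^ ((CARD('a) - 1) * b + 1) * (H + q0 * R)"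
    unfolding q0_def power_mult[symmetric] by simp
  have lt: "(CARD('a) - 1) * b + 1 < CARD('a) ^ (s + 1)"
  proof -
    have "(CARD('a) - 1) * (b + 1) \<le> (CARD('a) - 1) * qnum CARD('a) (s + 1)" using s by (intro mult_le_mono2) simp
    then show ?thesis using qnum_power[of "CARD('a)" "s + 1"] q by simp
  qed
  have "vx ^ (CARD('a) ^ (s + 1)) * subst2 vx 0 (H + q0 * R) \<in> trunc (CARD('a) ^ m)"
    using s(1) by (intro moore_power_mult_trunc[OF mem[unfolded w] lt]) simp
  moreover have "vx ^ (CARD('a) ^ (s + 1)) * subst2 vx 0 (H + q0 * R)
      = (\<Sum>a<X. mp_const (c (a, b)) * vx ^ (CARD('a) ^ (s + 1) + (CARD('a) - 1) * CARD('a) * a) * vy ^ 0)"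
  proof -
    have "subst2 vx 0 (H + q0 * R) = (\<Sum>a<X. mp_const (c (a, b)) * vx ^ ((CARD('a) - 1) * CARD('a) * a))"
      unfolding H_def subst2_hom subst2_vx_0 subst2_const power_mult[symmetric] mult_zero_left add_0_right ..
    then show ?thesis
      by (simp only: sum_distrib_left power_add power_0 mult_1_right mult.left_commute)
  qed
  ultimately have "(\<Sum>a<X. mp_const (c (a, b)) * vx ^ (CARD('a) ^ (s + 1) + (CARD('a) - 1) * CARD('a) * a) * vy ^ 0)
      \<in> trunc (CARD('a) ^ m)" by (simp only:)
  then have "coef (\<Sum>a<X. mp_const (c (a, b)) * vx ^ (CARD('a) ^ (s + 1) + (CARD('a) - 1) * CARD('a) * a) * vy ^ 0)
      (CARD('a) ^ (s + 1) + (CARD('a) - 1) * CARD('a) * a0) 0 = 0"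
  proof (rule coef_trunc)
    have "a0 < X" using a0 X by simp
    then have "(CARD('a) - 1) * (a0 + 1) \<le> (CARD('a) - 1) * X" by (intro mult_le_mono2) simp
    then have "(CARD('a) - 1) * a0 + 1 \<le> (CARD('a) - 1) * X" using q by simp
    also have "(CARD('a) - 1) * X = CARD('a) ^ (m - 1) - CARD('a) ^ s"
      using qnum_power[of "CARD('a)" "m - 1"] qnum_power[of "CARD('a)" s] q unfolding X_def diff_mult_distrib2 by linarith
    finally have "CARD('a) ^ s + (CARD('a) - 1) * a0 < CARD('a) ^ (m - 1)" by linarith
    then have "CARD('a) * (CARD('a) ^ s + (CARD('a) - 1) * a0) < CARD('a) * CARD('a) ^ (m - 1)"
      using q by (intro mult_less_mono2) simp_all
    also have "CARD('a) * CARD('a) ^ (m - 1) = CARD('a) ^ m"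
      using s(1) by (cases m) simp_all
    also have "CARD('a) * (CARD('a) ^ s + (CARD('a) - 1) * a0) = CARD('a) ^ (s + 1) + (CARD('a) - 1) * CARD('a) * a0"
      by (simp add: distrib_left)
    finally show "CARD('a) ^ (s + 1) + (CARD('a) - 1) * CARD('a) * a0 < CARD('a) ^ m" .
  qed simp
  moreover have "coef (\<Sum>a<X. mp_const (c (a, b)) * vx ^ (CARD('a) ^ (s + 1) + (CARD('a) - 1) * CARD('a) * a) * vy ^ 0)
      (CARD('a) ^ (s + 1) + (CARD('a) - 1) * CARD('a) * a0) 0 = (\<Sum>a<X. if a = a0 then c (a, b) else 0)"
    unfolding coef_sum coef_monomial using q by (intro sum.cong) auto
  moreover have "a0 < X" using a0 X by simp
  ultimately show False using a0 by simp
qed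

section \<open>The basis\<close>

text \<open>
  The left summand indexes the Dickson monomials. In the right summand, \<open>e < [m]\<close> stands for \<open>d\<^sub>e\<close>, and the one
  further value \<open>[m]\<close> for the top monomial.
\<close>

definition basis_index :: "nat \<Rightarrow> nat \<Rightarrow> (nat \<times> nat + nat) set" where
  "basis_index q m = dickson_exps q m <+> {..qnum q m}"

definition basis_elt :: "nat \<Rightarrow> nat \<times> nat + nat \<Rightarrow> 'a::{field,finite} mp" where
  "basis_elt m j = (case j of
     Inl (a, b) \<Rightarrow> q1 ^ a * q0 ^ b
   | Inr e \<Rightarrow> if e < qnum CARD('a) m then dsum (qnum CARD('a) m) e vx vy
       else vx ^ (CARD('a) ^ m - 1) * vy ^ (CARD('a) ^ m - 1))"

lemma qnum_eq: "Suc ((CARD('a::{field,finite}) - 1) * qnum CARD('a) m) = CARD('a) ^ m"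
  using qnum_power[of "CARD('a)" m] by simp

lemma qnum_pos: "1 \<le> m \<Longrightarrow> 1 \<le> qnum q m"
  using qnum_mono[of 1 m q] by simp

lemma power_minus_1_eq: "CARD('a::{field,finite}) ^ m - 1 = (CARD('a) - 1) * qnum CARD('a) m"
  using qnum_eq[of m, where 'a='a] by (metis diff_Suc_1)

lemma finite_basis_index [simp]: "finite (basis_index q m)"
  by (simp add: basis_index_def)

lemma inv_mod_dsum:
  assumes "1 \<le> m" "e < qnum CARD('a) m"
  shows "inv_mod m (dsum (qnum CARD('a) m) e vx (vy :: 'a::{field,finite} mp))"
proof (cases e)
  case 0
  obtain k where k: "m = Suc k" using assms(1) by (cases m) auto
  obtain w where "w \<in> dickson_ring" "dsum (qnum CARD('a) m) 0 vx (vy :: 'a mp) = q1 ^ qnum CARD('a) k + q0 * w"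
    using beta_leading_term[of k, where 'a='a] unfolding k by blast
  then have "dsum (qnum CARD('a) m) 0 vx (vy :: 'a mp) \<in> dickson_ring" by (simp add: dickson_ring_intros)
  then show ?thesis unfolding 0 by (rule inv_mod_dickson_ring)
next
  case (Suc k)
  then show ?thesis using inv_mod_dsum_Suc[OF qnum_eq, of k m, where 'a='a] assms by simp
qed

lemma basis_elt_closed: "basis_elt m j \<in> carrier (mp_ring 2 :: 'a::{field,finite} mp ring)"
proof -
  have "q1 \<in> carrier (mp_ring 2 :: 'a mp ring)" "q0 \<in> carrier (mp_ring 2 :: 'a mp ring)"
    by (simp_all add: dickson_ring_closed dickson_ring_q0 dickson_ring_q1)
  then show ?thesis
    unfolding basis_elt_def
    by (auto split: sum.splits prod.splits intro!: mp_ring_intros vx_vy_closed dsum_closed)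
qed

lemma inv_mod_basis_elt:
  assumes "1 \<le> m"
  shows "inv_mod m (basis_elt m j :: 'a::{field,finite} mp)"
proof (cases j)
  case (Inl ab)
  obtain a b where "ab = (a, b)" by (cases ab)
  then have "basis_elt m j = (q1 ^ a * q0 ^ b :: 'a mp)" by (simp add: Inl basis_elt_def)
  then show ?thesis using inv_mod_dickson_ring[OF dickson_ring_mult[OF dickson_ring_power[OF dickson_ring_q1] dickson_ring_power[OF dickson_ring_q0]]] by metis
next
  case (Inr e)
  show ?thesis
  proof (cases "e < qnum CARD('a) m")
    case True
    then show ?thesis using inv_mod_dsum[OF assms True] by (simp add: Inr basis_elt_def)
  next
    case False
    then have "basis_elt m j = (vx ^ ((CARD('a) - 1) * qnum CARD('a) m) * vy ^ ((CARD('a) - 1) * qnum CARD('a) m) :: 'a mp)"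
      unfolding Inr basis_elt_def power_minus_1_eq by simp
    then show ?thesis by (simp only: inv_mod_top[OF qnum_eq])
  qed
qed

lemma sum_basis_index:
  fixes c :: "nat \<times> nat + nat \<Rightarrow> 'a::{field,finite}"
  shows "(\<Sum>j\<in>basis_index CARD('a) m. mp_const (c j) * basis_elt m j)
   = (\<Sum>(a, b)\<in>dickson_exps CARD('a) m. mp_const (c (Inl (a, b))) * q1 ^ a * q0 ^ b)
     + (\<Sum>e<qnum CARD('a) m. mp_const (c (Inr e)) * dsum (qnum CARD('a) m) e vx vy)
     + mp_const (c (Inr (qnum CARD('a) m))) *
         (vx ^ ((CARD('a) - 1) * qnum CARD('a) m) * vy ^ ((CARD('a) - 1) * qnum CARD('a) m))"
proof -
  let ?M = "qnum CARD('a) m"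
  have "(\<Sum>j\<in>basis_index CARD('a) m. mp_const (c j) * basis_elt m j)
      = (\<Sum>ab\<in>dickson_exps CARD('a) m. mp_const (c (Inl ab)) * basis_elt m (Inl ab))
        + (\<Sum>e\<le>?M. mp_const (c (Inr e)) * basis_elt m (Inr e))"
    unfolding basis_index_def by (subst sum.Plus) simp_all
  also have "(\<Sum>ab\<in>dickson_exps CARD('a) m. mp_const (c (Inl ab)) * basis_elt m (Inl ab))
      = (\<Sum>(a, b)\<in>dickson_exps CARD('a) m. mp_const (c (Inl (a, b))) * q1 ^ a * q0 ^ b)"
    by (intro sum.cong refl) (auto simp: basis_elt_def mult.assoc)
  also have "(\<Sum>e\<le>?M. mp_const (c (Inr e)) * basis_elt m (Inr e))
      = (\<Sum>e<?M. mp_const (c (Inr e)) * basis_elt m (Inr e)) + mp_const (c (Inr ?M)) * basis_elt m (Inr ?M)"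
    by (simp flip: lessThan_Suc_atMost)
  also have "(\<Sum>e<?M. mp_const (c (Inr e)) * basis_elt m (Inr e))
      = (\<Sum>e<?M. mp_const (c (Inr e)) * dsum ?M e vx vy)"
    by (intro sum.cong refl) (simp add: basis_elt_def)
  also have "basis_elt m (Inr ?M) = (vx ^ ((CARD('a) - 1) * ?M) * vy ^ ((CARD('a) - 1) * ?M) :: 'a mp)"
    unfolding basis_elt_def power_minus_1_eq by simp
  finally show ?thesis by (simp add: add.assoc)
qed

text \<open>
  Reducing the Dickson part of \<open>invariants_lift\<close> to the listed monomials leaves an element of the annihilator
  of \<open>L\<close>. It may involve \<open>d\<^sub>0\<close>, which is itself a polynomial in the Dickson invariants and does not arise as a
  trace.
\<close>

theorem basis_elt_span:
  fixes F :: "'a::{field,finite} mp"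
  assumes m: "1 \<le> m" and F: "F \<in> carrier (mp_ring 2)" "inv_mod m F"
  shows "\<exists>c. F - (\<Sum>j\<in>basis_index CARD('a) m. mp_const (c j) * basis_elt m j) \<in> trunc (CARD('a) ^ m)"
proof -
  let ?M = "qnum CARD('a) m" and ?N = "CARD('a) ^ m"
  let ?top = "vx ^ ((CARD('a) - 1) * ?M) * vy ^ ((CARD('a) - 1) * ?M) :: 'a mp"
  let ?d = "\<lambda>e. dsum ?M e vx vy :: 'a mp"
  have M: "1 \<le> ?M" using m by (rule qnum_pos)
  obtain p d where p: "p \<in> dickson_ring"
    and F': "F - p - (\<Sum>e=1..<?M. mp_const (d e) * ?d e) - mp_const (d ?M) * ?top \<in> trunc ?N"
    using invariants_lift[OF qnum_eq M F] by blast
  have "p \<in> dickson_span m" using q0_power_mult_dickson_span[OF m p, of 0] by simp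
  then obtain c k where k: "k \<in> dickson_ring" "moore 1 vx vy * k \<in> trunc ?N"
    and pk: "p = (\<Sum>(a, b)\<in>dickson_exps CARD('a) m. mp_const (c (a, b)) * q1 ^ a * q0 ^ b) + k"
    unfolding dickson_span_def by blast
  obtain d' where d': "k - (\<Sum>e<?M. mp_const (d' e) * ?d e) - mp_const (d' ?M) * ?top \<in> trunc ?N"
    using annihilator_of_moore[OF qnum_eq M dickson_ring_closed[OF k(1)] inv_mod_dickson_ring[OF k(1)] k(2) inv_mod_dsum[OF m]] M
    by auto
  define C where "C = (\<lambda>j. case j of Inl ab \<Rightarrow> c ab | Inr e \<Rightarrow> d' e + (if e = 0 then 0 else d e))"
  have "(\<Sum>e<?M. mp_const (C (Inr e)) * ?d e)
      = (\<Sum>e<?M. mp_const (d' e) * ?d e) + (\<Sum>e<?M. mp_const (if e = 0 then 0 else d e) * ?d e)"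
    by (simp add: C_def mp_const_add distrib_right sum.distrib)
  also have "(\<Sum>e<?M. mp_const (if e = 0 then 0 else d e) * ?d e) = (\<Sum>e=1..<?M. mp_const (if e = 0 then 0 else d e) * ?d e)"
    by (rule sum.mono_neutral_right) auto
  also have "\<dots> = (\<Sum>e=1..<?M. mp_const (d e) * ?d e)" by (intro sum.cong) auto
  finally have low: "(\<Sum>e<?M. mp_const (C (Inr e)) * ?d e)
      = (\<Sum>e<?M. mp_const (d' e) * ?d e) + (\<Sum>e=1..<?M. mp_const (d e) * ?d e)" .
  have top: "mp_const (C (Inr ?M)) * ?top = mp_const (d' ?M) * ?top + mp_const (d ?M) * ?top"
    using M by (simp add: C_def mp_const_add distrib_right)
  have "(\<Sum>(a, b)\<in>dickson_exps CARD('a) m. mp_const (C (Inl (a, b))) * q1 ^ a * q0 ^ b) = p - k"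
    using pk by (simp add: C_def)
  then have "F - (\<Sum>j\<in>basis_index CARD('a) m. mp_const (C j) * basis_elt m j)
     = (F - p - (\<Sum>e=1..<?M. mp_const (d e) * ?d e) - mp_const (d ?M) * ?top)
      + (k - (\<Sum>e<?M. mp_const (d' e) * ?d e) - mp_const (d' ?M) * ?top)"
    unfolding sum_basis_index low top by (simp only:) simp
  then show ?thesis using trunc_add[OF F' d'] by metis
qed

text \<open>
  Multiplication by \<open>L\<close> removes everything but the Dickson monomials; the rest have disjoint supports.
\<close>

theorem basis_elt_independent:
  fixes c :: "nat \<times> nat + nat \<Rightarrow> 'a::{field,finite}"
  assumes m: "1 \<le> m"
    and zero: "(\<Sum>j\<in>basis_index CARD('a) m. mp_const (c j) * basis_elt m j) \<in> trunc (CARD('a) ^ m)"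
  shows "\<forall>j\<in>basis_index CARD('a) m. c j = 0"
proof -
  let ?M = "qnum CARD('a) m" and ?N = "CARD('a) ^ m"
  let ?top = "vx ^ ((CARD('a) - 1) * ?M) * vy ^ ((CARD('a) - 1) * ?M) :: 'a mp"
  let ?d = "\<lambda>e. dsum ?M e vx vy :: 'a mp"
  let ?S = "\<Sum>(a, b)\<in>dickson_exps CARD('a) m. mp_const (c (Inl (a, b))) * q1 ^ a * q0 ^ b"
  let ?T = "(\<Sum>e<?M. mp_const (c (Inr e)) * ?d e) + mp_const (c (Inr ?M)) * ?top"
  have M: "1 \<le> ?M" using m by (rule qnum_pos)
  have ST: "?S + ?T \<in> trunc ?N" using zero unfolding sum_basis_index by (simp only: add.assoc)
  have LT: "moore 1 vx vy * ?T \<in> trunc ?N"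
  proof -
    have eq: "moore 1 vx vy * ?T = (\<Sum>e<?M. mp_const (c (Inr e)) * (moore 1 vx vy * ?d e))
        + mp_const (c (Inr ?M)) * (moore 1 vx vy * ?top)"
      by (simp add: distrib_left sum_distrib_left mult_ac)
    have "mp_const (c (Inr e)) * (moore 1 vx vy * ?d e) \<in> trunc ?N" if "e \<in> {..<?M}" for e
      using that by (intro trunc_mult[OF moore_mult_dsum_trunc] qnum_eq) simp
    moreover have "mp_const (c (Inr ?M)) * (moore 1 vx vy * ?top) \<in> trunc ?N"
      by (intro trunc_mult[OF moore_mult_top_trunc] qnum_eq)
    ultimately show ?thesis unfolding eq by (intro trunc_add trunc_sum)
  qed
  have "l * (s + t) - l * t = l * s" for l s t :: "'a mp" by (simp add: distrib_left)
  from trunc_diff[OF trunc_mult[OF ST, of "moore 1 vx vy"] LT, unfolded this]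
  have "moore 1 vx vy * ?S \<in> trunc ?N" .
  then have Inl: "\<forall>ab\<in>dickson_exps CARD('a) m. c (Inl ab) = 0"
    by (rule dickson_independent[where c = "\<lambda>ab. c (Inl ab)"])
  then have "?S = 0" by (intro sum.neutral) auto
  then have T: "?T \<in> trunc ?N" using ST by simp
  have r: "0 < CARD('a) - 1" using card_field_gt_1[where 'a='a] by simp
  have lt: "(CARD('a) - 1) * i < ?N" if "i \<le> ?M" for i
    using mult_le_mono2[OF that, of "CARD('a) - 1"] qnum_eq[of m, where 'a='a] by linarith
  have top: "coef ?top ((CARD('a) - 1) * i) ((CARD('a) - 1) * j) = (if ?M = i \<and> ?M = j then 1 else 0)" for i j
    using coef_monomial[of "1 :: 'a" "(CARD('a) - 1) * ?M" "(CARD('a) - 1) * ?M"] r by simp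
  have cfT: "coef ?T ((CARD('a) - 1) * i) ((CARD('a) - 1) * j)
      = (\<Sum>e<?M. if i < ?M \<and> j < ?M \<and> i + j + 1 = ?M + e then c (Inr e) else 0)
        + (if ?M = i \<and> ?M = j then c (Inr ?M) else 0)" for i j
  proof -
    have "(\<Sum>e<?M. c (Inr e) * coef (?d e) ((CARD('a) - 1) * i) ((CARD('a) - 1) * j))
        = (\<Sum>e<?M. if i < ?M \<and> j < ?M \<and> i + j + 1 = ?M + e then c (Inr e) else 0)"
      by (intro sum.cong refl) (subst coef_dsum, auto)
    then show ?thesis unfolding coef_add coef_sum coef_const_mult top by simp
  qed
  have "c (Inr e) = 0" if "e \<le> ?M" for e
  proof (cases "e = ?M")
    case True
    have "coef ?T ((CARD('a) - 1) * ?M) ((CARD('a) - 1) * ?M) = 0" by (rule coef_trunc[OF T lt lt]) auto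
    then show ?thesis unfolding cfT True by simp
  next
    case False
    then have e: "e < ?M" using that by simp
    have "coef ?T ((CARD('a) - 1) * (?M - 1)) ((CARD('a) - 1) * e) = 0"
      by (rule coef_trunc[OF T lt lt]) (use that in auto)
    then have "(\<Sum>e'<?M. if ?M - 1 < ?M \<and> e < ?M \<and> ?M - 1 + e + 1 = ?M + e' then c (Inr e') else 0) = 0"
      unfolding cfT using M e by simp
    moreover have "(\<Sum>e'<?M. if ?M - 1 < ?M \<and> e < ?M \<and> ?M - 1 + e + 1 = ?M + e' then c (Inr e') else 0)
        = (\<Sum>e'<?M. if e' = e then c (Inr e') else 0)"
      using M e by (intro sum.cong) auto
    ultimately show ?thesis using e by simp
  qed
  then show ?thesis using Inl by (auto simp: basis_index_def)
qed

lemma basis_elt_inj: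
  assumes "1 \<le> m" "i \<in> basis_index CARD('a::{field,finite}) m" "j \<in> basis_index CARD('a) m"
    and diff: "basis_elt m i - (basis_elt m j :: 'a mp) \<in> trunc (CARD('a) ^ m)"
  shows "i = j"
proof (rule ccontr)
  assume "i \<noteq> j"
  define c where "c = (\<lambda>k. (if k = i then 1 else 0) - (if k = j then 1 else 0 :: 'a))"
  have "(\<Sum>k\<in>basis_index CARD('a) m. mp_const (c k) * basis_elt m k)
      = (\<Sum>k\<in>basis_index CARD('a) m. (if k = i then basis_elt m i else 0) - (if k = j then basis_elt m j else 0))"
  proof (rule sum.cong[OF refl])
    fix k
    show "mp_const (c k) * basis_elt m k = (if k = i then basis_elt m i else 0) - (if k = j then basis_elt m j else 0)"
      using \<open>i \<noteq> j\<close> by (cases "k = i"; cases "k = j") (simp_all add: c_def mp_const_uminus)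
  qed
  also have "\<dots> = basis_elt m i - basis_elt m j"
    unfolding sum_subtractf using assms(2,3) by simp
  finally have eq: "(\<Sum>k\<in>basis_index CARD('a) m. mp_const (c k) * basis_elt m k) = basis_elt m i - basis_elt m j" .
  have "\<forall>k\<in>basis_index CARD('a) m. c k = 0"
    by (rule basis_elt_independent[OF assms(1)]) (unfold eq, rule diff)
  then have "c i = 0" using assms(2) by (rule bspec)
  then show False using \<open>i \<noteq> j\<close> by (simp add: c_def)
qed

section \<open>The listed elements\<close>

lemma det_mat_2: "det (mat 2 2 f) = f (0, 0) * f (1, 1) - f (0, 1) * (f (1, 0) :: 'b::comm_ring_1)"
proof -
  have A: "mat 2 2 f \<in> carrier_mat 2 2" by simp
  have "det (mat 2 2 f) = (\<Sum>j<2. mat 2 2 f $$ (0, j) * cofactor (mat 2 2 f) 0 j)"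
    by (rule laplace_expansion_row[OF A]) simp
  also have "\<dots> = f (0, 0) * cofactor (mat 2 2 f) 0 0 + f (0, 1) * cofactor (mat 2 2 f) 0 1"
    by (simp add: numeral_2_eq_2)
  also have "cofactor (mat 2 2 f) 0 0 = f (1, 1)"
  proof -
    have "mat_delete (mat 2 2 f) 0 0 = mat 1 1 (\<lambda>_. f (1, 1))"
      by (rule eq_matI) (auto simp: mat_delete_def)
    then show ?thesis using det_single[of "mat 1 1 (\<lambda>_. f (1, 1))"] by (simp add: cofactor_def)
  qed
  also have "cofactor (mat 2 2 f) 0 1 = - f (1, 0)"
  proof -
    have "mat_delete (mat 2 2 f) 0 1 = mat 1 1 (\<lambda>_. f (1, 0))"
      by (rule eq_matI) (auto simp: mat_delete_def)
    then show ?thesis using det_single[of "mat 1 1 (\<lambda>_. f (1, 0))"] by (simp add: cofactor_def)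
  qed
  finally show ?thesis by simp
qed

lemma to_fract_power: "to_fract (p ^ n) = to_fract p ^ n"
  by (induction n) simp_all

lemma omit_var_to_fract:
  "omit_var j (to_fract p) = to_fract (mp_subst (\<lambda>i. mp_var (if i < j then i else i + 1)) p)"
  unfolding omit_var_def to_fract_def by (subst rat_subst_Fract) simp_all

lemma delta_1: "delta 1 m f = to_fract vx ^ (CARD('a) ^ m - 1) * omit_var 1 (f :: 'a::{field,finite} mp fract)"
proof -
  have "to_fract vx \<noteq> (0 :: 'a mp fract)" using vx_neq_0[where 'a='a] by simp
  moreover have "to_fract (vx :: 'a mp) ^ (CARD('a) ^ m) = to_fract vx * to_fract vx ^ (CARD('a) ^ m - 1)"
    by (simp flip: power_Suc)
  ultimately show ?thesis
    unfolding delta_def by (subst (1 2) det_single) (auto simp: vx_def)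
qed

lemma delta_1_delta_1:
  "delta 1 m (delta 1 m 1) = to_fract (vx ^ (CARD('a) ^ m - 1) * (vy :: 'a::{field,finite} mp) ^ (CARD('a) ^ m - 1))"
proof -
  have "omit_var 1 (1 :: 'a mp fract) = 1" using omit_var_to_fract[of 1 "1 :: 'a mp"] by simp
  then have inner: "delta 1 m 1 = to_fract ((vx :: 'a mp) ^ (CARD('a) ^ m - 1))"
    unfolding delta_1 to_fract_power by simp
  have outer: "omit_var 1 (to_fract ((vx :: 'a mp) ^ (CARD('a) ^ m - 1))) = to_fract (vy ^ (CARD('a) ^ m - 1))"
    unfolding omit_var_to_fract by (simp add: mp_subst_power vx_def vy_def numeral_2_eq_2)
  show ?thesis by (subst inner, subst delta_1, subst outer) (simp add: to_fract_power)
qed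

lemma delta_2:
  assumes "e < qnum CARD('a::{field,finite}) m"
  shows "delta 2 m (to_fract (vx ^ ((CARD('a) - 1) * e))) = to_fract (dsum (qnum CARD('a) m) e vx (vy :: 'a mp))"
proof -
  let ?r = "CARD('a) - 1" and ?N = "CARD('a) ^ m" and ?M = "qnum CARD('a) m"
  have o1: "omit_var 1 (to_fract ((vx :: 'a mp) ^ (?r * e))) = to_fract (vy ^ (?r * e))"
    unfolding omit_var_to_fract by (simp add: mp_subst_power vx_def vy_def numeral_2_eq_2)
  have o2: "omit_var 2 (to_fract ((vx :: 'a mp) ^ (?r * e))) = to_fract (vx ^ (?r * e))"
    unfolding omit_var_to_fract by (simp add: mp_subst_power vx_def)
  have N: "?N = Suc (?r * ?M)" using qnum_eq[of m, where 'a='a] by simp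
  have num: "det (mat 2 2 (\<lambda>(i, j). if i < 2 - 1 then to_fract (mp_var (j + 1)) ^ (CARD('a) ^ i)
       else to_fract (mp_var (j + 1)) ^ ?N * omit_var (j + 1) (to_fract ((vx :: 'a mp) ^ (?r * e)))))
      = to_fract (moore 1 vx vy * dsum ?M e vx vy)"
  proof -
    have "moore 1 vx vy * dsum ?M e vx (vy :: 'a mp) = vx * (vy ^ ?N * vx ^ (?r * e)) - vy * (vx ^ ?N * vy ^ (?r * e))"
      using assms by (subst moore_mult_dsum) (simp_all add: N algebra_simps)
    moreover have "omit_var (1 + 1) (to_fract ((vx :: 'a mp) ^ (?r * e))) = to_fract (vx ^ (?r * e))"
      "omit_var (0 + 1) (to_fract ((vx :: 'a mp) ^ (?r * e))) = to_fract (vy ^ (?r * e))"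
      using o1 o2 by (simp_all add: numeral_2_eq_2)
    moreover have "mp_var (0 + 1) = (vx :: 'a mp)" "mp_var (1 + 1) = (vy :: 'a mp)"
      by (simp_all add: vx_def vy_def numeral_2_eq_2)
    ultimately show ?thesis
      unfolding det_mat_2 prod.case by (simp only: to_fract_power to_fract_mult to_fract_diff) simp
  qed
  have den: "det (mat 2 2 (\<lambda>(i, j). to_fract (mp_var (j + 1)) ^ (CARD('a) ^ i))) = to_fract (moore 1 vx (vy :: 'a mp))"
  proof -
    have "mp_var (0 + 1) = (vx :: 'a mp)" "mp_var (1 + 1) = (vy :: 'a mp)"
      by (simp_all add: vx_def vy_def numeral_2_eq_2)
    then show ?thesis unfolding det_mat_2 prod.case by (simp add: moore_def to_fract_power mult.commute)
  qed
  show ?thesis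
    unfolding delta_def num den using moore_neq_0[where 'a='a] by simp
qed

lemma power_diff_div:
  assumes "1 < q" "b \<le> a"
  shows "(q ^ a - q ^ b) div (q - 1) = qnum q a - qnum q b"
proof -
  have "(q - 1) * qnum q a = (q - 1) * (qnum q a - qnum q b) + (q - 1) * qnum q b"
    using qnum_mono[OF assms(2), of q] by (simp flip: distrib_left)
  then have "q ^ a - q ^ b = (q - 1) * (qnum q a - qnum q b)"
    using qnum_power[of q a] qnum_power[of q b] assms(1) by linarith
  then show ?thesis using assms(1) by simp
qed

lemma Delta_set_1:
  assumes "1 \<le> m"
  shows "Delta_set m 1 = {(vx :: 'a::{field,finite} mp) ^ ((CARD('a) - 1) * e) | e. e < qnum CARD('a) m}"
    (is "_ = ?R")
proof -
  have q: "1 < CARD('a)" by (rule card_field_gt_1)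
  have prod: "(\<Prod>i\<in>{1..1}. dickson 1 (1 - i) ^ e i) = (vx :: 'a mp) ^ ((CARD('a) - 1) * e 1)" for e :: "nat \<Rightarrow> nat"
    using dickson_1_0[where 'a='a] by (simp add: power_mult)
  show ?thesis
  proof (intro subset_antisym subsetI)
    fix p :: "'a mp" assume "p \<in> Delta_set m 1"
    then obtain e :: "nat \<Rightarrow> nat" and l :: "nat \<Rightarrow> nat" where p: "p = (\<Prod>i\<in>{1..1}. dickson 1 (1 - i) ^ e i)"
      and l: "l 1 \<le> m - 1" "l (1 + 1) = 0"
        "\<forall>i\<in>{1..1}. (CARD('a) ^ l i - CARD('a) ^ l (i + 1)) div (CARD('a) - 1) \<le> e i \<and>
             e i < (CARD('a) ^ (l i + 1) - CARD('a) ^ l (i + 1)) div (CARD('a) - 1)"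
      unfolding Delta_set_def by blast
    have "1 \<in> {1..1::nat}" by simp
    note l = l(1,2) conjunct2[OF bspec[OF l(3) this]]
    have "e 1 < qnum CARD('a) (l 1 + 1)" using l(3) power_diff_div[OF q, of 0 "l 1 + 1"] unfolding l(2) by simp
    also have "\<dots> \<le> qnum CARD('a) m" using l(1) assms by (intro qnum_mono) simp
    finally show "p \<in> ?R" using p unfolding prod by blast
  next
    fix p :: "'a mp" assume "p \<in> ?R"
    then obtain e where p: "p = vx ^ ((CARD('a) - 1) * e)" "e < qnum CARD('a) m" by blast
    then obtain s where s: "s < m" "qnum CARD('a) s \<le> e" "e < qnum CARD('a) (s + 1)" using qnum_interval by blast
    define l where "l = (\<lambda>i :: nat. if i = 1 then s else (0 :: nat))"
    define f where "f = (\<lambda>_ :: nat. e)"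
    have "p = (\<Prod>i\<in>{1..1}. dickson 1 (1 - i) ^ f i)" unfolding prod p f_def ..
    moreover have "l 1 \<le> m - 1" "\<forall>i\<in>{1..1}. l (i + 1) \<le> l i" "l (1 + 1) = 0"
      "\<forall>i\<in>{1..1}. (CARD('a) ^ l i - CARD('a) ^ l (i + 1)) div (CARD('a) - 1) \<le> f i \<and>
             f i < (CARD('a) ^ (l i + 1) - CARD('a) ^ l (i + 1)) div (CARD('a) - 1)"
      using s power_diff_div[OF q, of 0 s] power_diff_div[OF q, of 0 "s + 1"] by (simp_all add: l_def f_def)
    ultimately show "p \<in> Delta_set m 1" unfolding Delta_set_def by blast
  qed
qed

lemma Delta_set_2:
  assumes "2 \<le> m"
  shows "Delta_set m 2 = {q1 ^ a * q0 ^ b :: 'a::{field,finite} mp | a b. (a, b) \<in> dickson_exps CARD('a) m}"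
    (is "_ = ?R")
proof -
  have q: "1 < CARD('a)" by (rule card_field_gt_1)
  have ivl: "{1..2} = {1, 2 :: nat}" by auto
  have prod: "(\<Prod>i\<in>{1..2}. dickson 2 (2 - i) ^ e i) = (q1 ^ e 1 * q0 ^ e 2 :: 'a mp)" for e :: "nat \<Rightarrow> nat"
    unfolding ivl using dickson_2[where 'a='a] by simp
  show ?thesis
  proof (intro subset_antisym subsetI)
    fix p :: "'a mp" assume "p \<in> Delta_set m 2"
    then obtain e :: "nat \<Rightarrow> nat" and l :: "nat \<Rightarrow> nat" where p: "p = (\<Prod>i\<in>{1..2}. dickson 2 (2 - i) ^ e i)"
      and l: "l 1 \<le> m - 2" "l (2 + 1) = 0" "\<forall>i\<in>{1..2}. l (i + 1) \<le> l i"
      and e: "\<forall>i\<in>{1..2}. (CARD('a) ^ l i - CARD('a) ^ l (i + 1)) div (CARD('a) - 1) \<le> e i \<and>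
             e i < (CARD('a) ^ (l i + 1) - CARD('a) ^ l (i + 1)) div (CARD('a) - 1)"
      unfolding Delta_set_def by blast
    have l2: "l 2 \<le> l 1" "l 3 = 0" using l(2,3) unfolding ivl by (simp_all add: numeral_2_eq_2 numeral_3_eq_3)
    have e1: "e 1 < (CARD('a) ^ (l 1 + 1) - CARD('a) ^ l 2) div (CARD('a) - 1)"
      and e2: "(CARD('a) ^ l 2 - CARD('a) ^ l 3) div (CARD('a) - 1) \<le> e 2"
        "e 2 < (CARD('a) ^ (l 2 + 1) - CARD('a) ^ l 3) div (CARD('a) - 1)"
      using e unfolding ivl by (simp_all add: numeral_2_eq_2 numeral_3_eq_3)
    have "e 1 + qnum CARD('a) (l 2) < qnum CARD('a) (l 1 + 1)"
      using e1 power_diff_div[OF q, of "l 2" "l 1 + 1"] l2(1) by simp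
    also have "\<dots> \<le> qnum CARD('a) (m - 1)" using l(1) assms by (intro qnum_mono) simp
    finally have "e 1 + qnum CARD('a) (l 2) < qnum CARD('a) (m - 1)" .
    moreover have "qnum CARD('a) (l 2) \<le> e 2" "e 2 < qnum CARD('a) (l 2 + 1)"
      using e2 power_diff_div[OF q, of 0 "l 2"] power_diff_div[OF q, of 0 "l 2 + 1"] unfolding l2(2) by simp_all
    moreover have "l 2 + 2 \<le> m" using l2 l(1) assms by simp
    ultimately have "(e 1, e 2) \<in> dickson_exps CARD('a) m" unfolding dickson_exps_def by blast
    then show "p \<in> ?R" using p unfolding prod by blast
  next
    fix p :: "'a mp" assume "p \<in> ?R"
    then obtain a b where p: "p = q1 ^ a * q0 ^ b" "(a, b) \<in> dickson_exps CARD('a) m" by blast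
    then obtain s where s: "s + 2 \<le> m" "qnum CARD('a) s \<le> b" "b < qnum CARD('a) (s + 1)" "a + qnum CARD('a) s < qnum CARD('a) (m - 1)"
      unfolding dickson_exps_def by blast
    obtain t where t: "t < m - 1" "qnum CARD('a) t \<le> a + qnum CARD('a) s" "a + qnum CARD('a) s < qnum CARD('a) (t + 1)"
      using qnum_interval[OF s(4)] by blast
    have st: "s \<le> t"
    proof (rule ccontr)
      assume "\<not> s \<le> t"
      then have "qnum CARD('a) (t + 1) \<le> qnum CARD('a) s" by (intro qnum_mono) simp
      then show False using t(3) by simp
    qed
    define l where "l = (\<lambda>i :: nat. if i = 1 then t else if i = 2 then s else (0 :: nat))"
    define e where "e = (\<lambda>i :: nat. if i = 1 then a else b)"
    have "p = (\<Prod>i\<in>{1..2}. dickson 2 (2 - i) ^ e i)" unfolding prod p by (simp add: e_def)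
    moreover have "l 1 \<le> m - 2" using t(1) by (simp add: l_def)
    moreover have "\<forall>i\<in>{1..2}. l (i + 1) \<le> l i" "l (2 + 1) = 0" using st unfolding ivl by (simp_all add: l_def)
    moreover have "\<forall>i\<in>{1..2}. (CARD('a) ^ l i - CARD('a) ^ l (i + 1)) div (CARD('a) - 1) \<le> e i \<and>
             e i < (CARD('a) ^ (l i + 1) - CARD('a) ^ l (i + 1)) div (CARD('a) - 1)"
    proof -
      have "(CARD('a) ^ t - CARD('a) ^ s) div (CARD('a) - 1) \<le> a \<and>
             a < (CARD('a) ^ (t + 1) - CARD('a) ^ s) div (CARD('a) - 1)"
        using power_diff_div[OF q st] power_diff_div[OF q, of s "t + 1"] st t(2,3)
        by (simp add: le_diff_conv less_diff_conv)
      moreover have "(CARD('a) ^ s - CARD('a) ^ 0) div (CARD('a) - 1) \<le> b \<and>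
             b < (CARD('a) ^ (s + 1) - CARD('a) ^ 0) div (CARD('a) - 1)"
        using power_diff_div[OF q, of 0 s] power_diff_div[OF q, of 0 "s + 1"] s(2,3) by simp
      ultimately show ?thesis unfolding ivl by (simp add: l_def e_def)
    qed
    ultimately show "p \<in> Delta_set m 2" unfolding Delta_set_def by blast
  qed
qed

lemma listed_elements:
  assumes "2 \<le> m"
  shows "{delta 1 m (delta 1 m 1)} \<union> (\<lambda>f. delta 2 m (to_fract f)) ` Delta_set m 1 \<union> to_fract ` Delta_set m 2
    = (to_fract \<circ> basis_elt m :: _ \<Rightarrow> 'a::{field,finite} mp fract) ` basis_index CARD('a) m"
proof -
  let ?M = "qnum CARD('a) m"
  have index: "basis_index CARD('a) m = insert (Inr ?M) (Inr ` {..<?M} \<union> Inl ` dickson_exps CARD('a) m)"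
    unfolding basis_index_def Plus_def lessThan_Suc_atMost[symmetric] lessThan_Suc by auto
  have D1: "Delta_set m 1 = (\<lambda>e. (vx :: 'a mp) ^ ((CARD('a) - 1) * e)) ` {..<?M}"
    using assms by (subst Delta_set_1) auto
  have 2: "(\<lambda>f. delta 2 m (to_fract f)) ` Delta_set m 1 = (to_fract \<circ> basis_elt m :: _ \<Rightarrow> 'a mp fract) ` Inr ` {..<?M}"
    unfolding D1 image_image by (intro image_cong refl) (subst delta_2, auto simp: basis_elt_def)
  have D2: "Delta_set m 2 = (\<lambda>(a, b). q1 ^ a * q0 ^ b :: 'a mp) ` dickson_exps CARD('a) m"
    using assms by (subst Delta_set_2) auto
  have 3: "to_fract ` Delta_set m 2 = (to_fract \<circ> basis_elt m :: _ \<Rightarrow> 'a mp fract) ` Inl ` dickson_exps CARD('a) m"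
    unfolding D2 image_image by (intro image_cong refl) (auto simp: basis_elt_def)
  have 1: "delta 1 m (delta 1 m 1) = (to_fract \<circ> basis_elt m :: _ \<Rightarrow> 'a mp fract) (Inr ?M)"
    by (subst delta_1_delta_1) (simp add: basis_elt_def)
  show ?thesis
    unfolding index image_insert image_Un 1 2 3 by (simp only: Un_assoc Un_insert_left Un_empty_left)
qed

section \<open>The quotient algebra as a vector space\<close>

lemma ideal_pow_ideal: "ideal (pow_ideal m n) (mp_ring n :: 'a::{field,finite} mp ring)"
proof -
  interpret cring "mp_ring n :: 'a mp ring" by (rule cring_mp_ring)
  show ?thesis
    unfolding pow_ideal_def by (rule genideal_ideal) (auto intro!: mp_ring_intros)
qed

lemma cls_2: "cls m 2 p = {i + p | i. i \<in> trunc (CARD('a::{field,finite}) ^ m) \<and> i \<in> carrier (mp_ring 2 :: 'a mp ring)}"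
  unfolding cls_def pow_ideal_eq a_r_coset_def' mp_ring_simps by auto

lemma cls_2_eq_iff:
  assumes "p \<in> carrier (mp_ring 2 :: 'a::{field,finite} mp ring)" "p' \<in> carrier (mp_ring 2)"
  shows "cls m 2 p = cls m 2 p' \<longleftrightarrow> p - p' \<in> trunc (CARD('a) ^ m)"
proof
  assume "cls m 2 p = cls m 2 p'"
  moreover have "p \<in> cls m 2 p" unfolding cls_2 by (auto intro!: exI[of _ 0] mp_ring_closed)
  ultimately show "p - p' \<in> trunc (CARD('a) ^ m)" unfolding cls_2 by auto
next
  assume diff: "p - p' \<in> trunc (CARD('a) ^ m)"
  have sub: "cls m 2 r \<subseteq> cls m 2 r'"
    if "r \<in> carrier (mp_ring 2)" "r' \<in> carrier (mp_ring 2)" "r - r' \<in> trunc (CARD('a) ^ m)" for r r' :: "'a mp"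
  proof
    fix z assume "z \<in> cls m 2 r"
    then obtain i where "i \<in> trunc (CARD('a) ^ m)" "i \<in> carrier (mp_ring 2)" "z = i + r" unfolding cls_2 by auto
    then have "z = (i + (r - r')) + r'" "i + (r - r') \<in> trunc (CARD('a) ^ m)" "i + (r - r') \<in> carrier (mp_ring 2)"
      using that by (simp_all add: trunc_add mp_ring_intros)
    then show "z \<in> cls m 2 r'" unfolding cls_2 by blast
  qed
  show "cls m 2 p = cls m 2 p'" using sub[OF assms diff] sub[OF assms(2,1) trunc_sym[OF diff]] by (rule subset_antisym)
qed

lemma Q_alg_simps:
  fixes p p' :: "'a::{field,finite} mp"
  shows "carrier (Q_alg m n) = cls m n ` carrier (mp_ring n :: 'a mp ring)"
    "\<zero>\<^bsub>Q_alg m n\<^esub> = cls m n (0 :: 'a mp)"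
    "p \<in> carrier (mp_ring n) \<Longrightarrow> p' \<in> carrier (mp_ring n) \<Longrightarrow> cls m n p \<oplus>\<^bsub>Q_alg m n\<^esub> cls m n p' = cls m n (p + p')"
    "p \<in> carrier (mp_ring n) \<Longrightarrow> c \<odot>\<^bsub>Q_alg m n\<^esub> cls m n p = cls m n (mp_const c * p)"
proof -
  let ?R = "mp_ring n :: 'a mp ring" and ?I = "pow_ideal m n :: 'a mp set"
  interpret ideal ?I ?R by (rule ideal_pow_ideal)
  have hom: "cls m n \<in> Ring.ring_hom ?R (?R Quot ?I)"
    using rcos_ring_hom by (simp add: cls_def[abs_def])
  show "carrier (Q_alg m n) = cls m n ` carrier (mp_ring n :: 'a mp ring)"
    by (auto simp: Q_alg_def Let_def FactRing_def A_RCOSETS_def' cls_def)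
  have "?I +>\<^bsub>?R\<^esub> 0 = ?I" by (simp add: a_r_coset_def' mp_ring_simps)
  then show "\<zero>\<^bsub>Q_alg m n\<^esub> = cls m n (0 :: 'a mp)"
    by (simp add: Q_alg_def Let_def FactRing_def cls_def)
  show "p \<in> carrier ?R \<Longrightarrow> p' \<in> carrier ?R \<Longrightarrow> cls m n p \<oplus>\<^bsub>Q_alg m n\<^esub> cls m n p' = cls m n (p + p')"
    using ring_hom_add[OF hom, of p p'] by (simp add: Q_alg_def Let_def mp_ring_simps)
  show "p \<in> carrier ?R \<Longrightarrow> c \<odot>\<^bsub>Q_alg m n\<^esub> cls m n p = cls m n (mp_const c * p)"
    using ring_hom_mult[OF hom, of "mp_const c" p] mp_ring_closed(3)[of c n]
    by (simp add: Q_alg_def Let_def mp_ring_simps)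
qed

lemma vectorspace_Q_alg: "vectorspace class_ring (Q_alg m n :: ('a::{field,finite}, 'a mp set) module)"
proof (rule vectorspace.intro)
  show "module class_ring (Q_alg m n :: ('a, 'a mp set) module)"
  proof (rule module_criteria)
    show "\<forall>v\<in>carrier (Q_alg m n :: ('a, 'a mp set) module). \<exists>neg_v\<in>carrier (Q_alg m n). v \<oplus>\<^bsub>Q_alg m n\<^esub> neg_v = \<zero>\<^bsub>Q_alg m n\<^esub>"
    proof
      fix v :: "'a mp set" assume "v \<in> carrier (Q_alg m n)"
      then obtain p where p: "p \<in> carrier (mp_ring n)" "v = cls m n p" unfolding Q_alg_simps by blast
      then have "cls m n (- p) \<in> carrier (Q_alg m n)" "v \<oplus>\<^bsub>Q_alg m n\<^esub> cls m n (- p) = \<zero>\<^bsub>Q_alg m n\<^esub>"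
        by (simp_all add: Q_alg_simps mp_ring_intros)
      then show "\<exists>neg_v\<in>carrier (Q_alg m n). v \<oplus>\<^bsub>Q_alg m n\<^esub> neg_v = \<zero>\<^bsub>Q_alg m n\<^esub>" by blast
    qed
  qed (auto simp: Q_alg_simps mp_ring_intros class_cring.is_cring mp_const_add mp_const_mult
      algebra_simps intro!: class_cring.cring_axioms)
  show "field (class_ring :: 'a ring)" by (rule class_field.field_axioms)
qed

section \<open>Invariant classes\<close>

lemma act_eq_lin_subst:
  assumes "p \<in> carrier (mp_ring 2)"
  shows "act 2 g p = lin_subst (g $$ (0, 0)) (g $$ (1, 0)) (g $$ (0, 1)) (g $$ (1, 1)) (p :: 'a::{field,finite} mp)"
proof -
  have sum2: "(\<Sum>i\<in>{1..2::nat}. f i) = f 1 + f 2" for f :: "nat \<Rightarrow> 'a mp"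
    by (simp add: numeral_2_eq_2)
  show ?thesis
    unfolding act_def mp_subst_eq_subst2[OF assms] lin_subst_def sum2 by (simp add: vx_def vy_def)
qed

lemma GL_2:
  "g \<in> GL 2 \<longleftrightarrow> g \<in> carrier_mat 2 2 \<and> g $$ (0, 0) * g $$ (1, 1) - g $$ (1, 0) * g $$ (0, 1) \<noteq> (0 :: 'a::{field,finite})"
proof (cases "g \<in> carrier_mat 2 2")
  case g: True
  have "g = mat 2 2 (\<lambda>ij. g $$ ij)" using g by (intro eq_matI) auto
  then have det: "det g = g $$ (0, 0) * g $$ (1, 1) - g $$ (0, 1) * g $$ (1, 0)" by (metis det_mat_2)
  have "invertible_mat g \<longleftrightarrow> det g \<noteq> 0"
  proof
    assume "invertible_mat g"
    then obtain h where h: "g * h = 1\<^sub>m (dim_row g)" "h * g = 1\<^sub>m (dim_row h)"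
      unfolding invertible_mat_def inverts_mat_def by blast
    have "h \<in> carrier_mat 2 2"
      using g arg_cong[OF h(1), of dim_col] arg_cong[OF h(2), of dim_col] by auto
    then have "det g * det h = det (1\<^sub>m 2)" using det_mult[OF g, of h] h(1) g by simp
    then show "det g \<noteq> 0" by auto
  next
    assume "det g \<noteq> 0"
    then have "g \<in> Units (ring_mat TYPE('a) 2 ())" by (rule det_non_zero_imp_unit[OF g])
    then obtain h where "h \<in> carrier_mat 2 2" "h * g = 1\<^sub>m 2" "g * h = 1\<^sub>m 2"
      unfolding Units_def ring_mat_simps by blast
    then show "invertible_mat g" using g unfolding invertible_mat_def inverts_mat_def by auto
  qed
  then show ?thesis using g det by (auto simp: GL_def mult.commute)
qed (simp add: GL_def)

lemma lin_subst_closed: "lin_subst a b c d p \<in> carrier (mp_ring 2)"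
  unfolding lin_subst_def by (intro subst2_closed mp_ring_intros vx_vy_closed)

lemma lin_subst_inverse:
  fixes a b c d :: "'a::{field,finite}"
  assumes "p \<in> carrier (mp_ring 2)" "D = a * d - b * c" "D \<noteq> 0"
  shows "lin_subst a b c d (lin_subst (d / D) (- b / D) (- c / D) (a / D) p) = p"
proof -
  have x: "mp_const (d / D) * (mp_const a * vx + mp_const b * vy) + mp_const (- b / D) * (mp_const c * vx + mp_const d * vy)
      = mp_const (d / D * a + - b / D * c) * vx + mp_const (d / D * b + - b / D * d) * (vy :: 'a mp)"
    by (simp only: mp_const_add mp_const_mult distrib_left distrib_right ac_simps)
  have y: "mp_const (- c / D) * (mp_const a * vx + mp_const b * vy) + mp_const (a / D) * (mp_const c * vx + mp_const d * vy)
      = mp_const (- c / D * a + a / D * c) * vx + mp_const (- c / D * b + a / D * d) * (vy :: 'a mp)"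
    by (simp only: mp_const_add mp_const_mult distrib_left distrib_right ac_simps)
  have "d / D * a + - b / D * c = (a * d - b * c) / D" "- c / D * b + a / D * d = (a * d - b * c) / D"
    by (simp_all add: diff_divide_distrib mult.commute)
  then have scalars: "d / D * a + - b / D * c = 1" "- c / D * b + a / D * d = 1"
    "d / D * b + - b / D * d = 0" "- c / D * a + a / D * c = 0"
    using assms(2,3) by simp_all
  have "lin_subst a b c d (lin_subst (d / D) (- b / D) (- c / D) (a / D) p) = subst2 vx vy p"
    unfolding lin_subst_def subst2_subst2 subst2_hom subst2_const subst2_vx subst2_vy x y scalars by simp
  then show ?thesis using subst2_vx_vy[OF assms(1)] by simp
qed

text \<open>
  Invariance of a class asks for an equality of sets. The substitutions map the coset into itself as soon as
  the representative is invariant modulo the ideal, and the inverse matrix gives the other inclusion.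
\<close>

lemma cls_in_invariants_iff:
  fixes p :: "'a::{field,finite} mp"
  assumes p: "p \<in> carrier (mp_ring 2)"
  shows "cls m 2 p \<in> invariants m 2 \<longleftrightarrow> inv_mod m p"
proof
  assume inv: "cls m 2 p \<in> invariants m 2"
  show "inv_mod m p"
    unfolding inv_mod_def
  proof (intro allI impI)
    fix a b c d :: 'a assume det: "a * d - b * c \<noteq> 0"
    define g where "g = mat 2 2 (\<lambda>(i, j). if i = 0 then (if j = 0 then a else c) else (if j = 0 then b else d))"
    have entries: "g $$ (0, 0) = a" "g $$ (1, 0) = b" "g $$ (0, 1) = c" "g $$ (1, 1) = d" by (simp_all add: g_def)
    have "g \<in> carrier_mat 2 2" by (simp add: g_def)
    then have "g \<in> GL 2" unfolding GL_2 entries using det by simp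
    then have "act 2 g ` cls m 2 p = cls m 2 p" using inv by (simp add: invariants_def)
    moreover have "p \<in> cls m 2 p" unfolding cls_2 by (auto intro!: exI[of _ 0] mp_ring_closed)
    ultimately have "act 2 g p \<in> cls m 2 p" by blast
    then have "lin_subst a b c d p \<in> cls m 2 p" unfolding act_eq_lin_subst[OF p] entries .
    then show "lin_subst a b c d p - p \<in> trunc (CARD('a) ^ m)" unfolding cls_2 by auto
  qed
next
  assume inv: "inv_mod m p"
  have "act 2 g ` cls m 2 p = cls m 2 p" if g: "g \<in> GL 2" for g :: "'a mat"
  proof -
    define a b c d where "a = g $$ (0, 0)" and "b = g $$ (1, 0)" and "c = g $$ (0, 1)" and "d = g $$ (1, 1)"
    define D where "D = a * d - b * c"
    have D: "D \<noteq> 0" using g unfolding GL_2 D_def a_def b_def c_def d_def by simp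
    have act: "act 2 g z = lin_subst a b c d z" if "z \<in> carrier (mp_ring 2)" for z
      using act_eq_lin_subst[OF that, of g] unfolding a_def b_def c_def d_def .
    have closed: "z \<in> carrier (mp_ring 2)" if "z \<in> cls m 2 p" for z
      using that p unfolding cls_2 by (auto intro: mp_ring_closed)
    have lin_subst_cls: "lin_subst a' b' c' d' z \<in> cls m 2 p" if z: "z \<in> cls m 2 p" and det: "a' * d' - b' * c' \<noteq> 0" for a' b' c' d' z
    proof -
      have "z - p \<in> trunc (CARD('a) ^ m)" using z unfolding cls_2 by auto
      then have "lin_subst a' b' c' d' (z - p) + (lin_subst a' b' c' d' p - p) \<in> trunc (CARD('a) ^ m)"
        using inv_modD[OF inv det] by (intro trunc_add lin_subst_trunc)
      then have "lin_subst a' b' c' d' z - p \<in> trunc (CARD('a) ^ m)" by (simp add: lin_subst_hom)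
      moreover have "lin_subst a' b' c' d' z - p \<in> carrier (mp_ring 2)" using p by (intro mp_ring_intros lin_subst_closed)
      moreover have "lin_subst a' b' c' d' z = (lin_subst a' b' c' d' z - p) + p" by simp
      ultimately show ?thesis unfolding cls_2 by blast
    qed
    show ?thesis
    proof (rule subset_antisym)
      show "act 2 g ` cls m 2 p \<subseteq> cls m 2 p"
      proof (rule image_subsetI)
        fix z assume z: "z \<in> cls m 2 p"
        show "act 2 g z \<in> cls m 2 p"
          unfolding act[OF closed[OF z]] using z D unfolding D_def by (rule lin_subst_cls)
      qed
      show "cls m 2 p \<subseteq> act 2 g ` cls m 2 p"
      proof
        fix z assume z: "z \<in> cls m 2 p"
        let ?z = "lin_subst (d / D) (- b / D) (- c / D) (a / D) z"
        have "d / D * (a / D) - - b / D * (- c / D) = D / (D * D)" by (simp add: D_def diff_divide_distrib mult.commute)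
        then have "d / D * (a / D) - - b / D * (- c / D) \<noteq> 0" using D by simp
        then have z': "?z \<in> cls m 2 p" using lin_subst_cls[OF z] by blast
        moreover have "act 2 g ?z = z"
          unfolding act[OF closed[OF z']] using closed[OF z] D_def D by (rule lin_subst_inverse)
        ultimately show "z \<in> act 2 g ` cls m 2 p" by (metis imageI)
      qed
    qed
  qed
  then show "cls m 2 p \<in> invariants m 2" using p by (simp add: invariants_def Q_alg_simps)
qed

lemma invariants_eq: "invariants m 2 = cls m 2 ` {p \<in> carrier (mp_ring 2 :: 'a::{field,finite} mp ring). inv_mod m p}"
proof (rule subset_antisym)
  show "invariants m 2 \<subseteq> cls m 2 ` {p \<in> carrier (mp_ring 2 :: 'a mp ring). inv_mod m p}"
  proof
    fix A :: "'a mp set" assume A: "A \<in> invariants m 2"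
    then have "A \<in> carrier (Q_alg m 2)" by (simp add: invariants_def)
    then obtain p where "p \<in> carrier (mp_ring 2)" "A = cls m 2 p" unfolding Q_alg_simps by blast
    then show "A \<in> cls m 2 ` {p \<in> carrier (mp_ring 2). inv_mod m p}" using A cls_in_invariants_iff by blast
  qed
  show "cls m 2 ` {p \<in> carrier (mp_ring 2 :: 'a mp ring). inv_mod m p} \<subseteq> invariants m 2"
    using cls_in_invariants_iff by blast
qed

lemma subspace_invariants: "subspace class_ring (invariants m 2) (Q_alg m 2 :: ('a::{field,finite}, 'a mp set) module)"
proof (rule subspace.intro)
  show vs: "vectorspace class_ring (Q_alg m 2 :: ('a, 'a mp set) module)" by (rule vectorspace_Q_alg)
  interpret vectorspace class_ring "Q_alg m 2 :: ('a, 'a mp set) module" by (rule vs)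
  show "submodule class_ring (invariants m 2) (Q_alg m 2 :: ('a, 'a mp set) module)"
  proof (rule submodule.intro)
    show "module class_ring (Q_alg m 2 :: ('a, 'a mp set) module)" by (rule module_axioms)
    show "invariants m 2 \<subseteq> carrier (Q_alg m 2 :: ('a, 'a mp set) module)" by (auto simp: invariants_def)
    show "v \<oplus>\<^bsub>Q_alg m 2\<^esub> w \<in> invariants m 2" if "v \<in> invariants m 2" "w \<in> invariants m 2" for v w :: "'a mp set"
    proof -
      from that obtain p p' where "p \<in> carrier (mp_ring 2)" "inv_mod m p" "v = cls m 2 p"
        "p' \<in> carrier (mp_ring 2)" "inv_mod m p'" "w = cls m 2 p'" unfolding invariants_eq by blast
      then show ?thesis by (simp add: Q_alg_simps cls_in_invariants_iff mp_ring_intros inv_mod_add)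
    qed
    have "inv_mod m (0 :: 'a mp)" by (rule inv_mod_dickson_ring[OF dickson_ring.zero])
    then show "\<zero>\<^bsub>Q_alg m 2\<^esub> \<in> (invariants m 2 :: 'a mp set set)"
      by (simp add: Q_alg_simps cls_in_invariants_iff mp_ring_intros)
    show "c \<odot>\<^bsub>Q_alg m 2\<^esub> v \<in> invariants m 2" if "v \<in> invariants m 2" for c :: 'a and v :: "'a mp set"
    proof -
      from that obtain p where "p \<in> carrier (mp_ring 2)" "inv_mod m p" "v = cls m 2 p" unfolding invariants_eq by blast
      then show ?thesis by (simp add: Q_alg_simps cls_in_invariants_iff mp_ring_intros inv_mod_const_mult)
    qed
  qed
qed

lemma inj_on_cls_basis_elt:
  assumes "1 \<le> m"
  shows "inj_on (\<lambda>j. cls m 2 (basis_elt m j :: 'a::{field,finite} mp)) (basis_index CARD('a) m)"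
  by (rule inj_onI) (simp add: cls_2_eq_iff basis_elt_closed basis_elt_inj[OF assms])

lemma basis_invariants:
  assumes m: "1 \<le> m"
  shows "vectorspace.basis class_ring ((Q_alg m 2)\<lparr>carrier := invariants m 2\<rparr>)
    ((\<lambda>j. cls m 2 (basis_elt m j :: 'a::{field,finite} mp)) ` basis_index CARD('a) m)"
proof -
  let ?W = "(Q_alg m 2 :: ('a, 'a mp set) module)\<lparr>carrier := invariants m 2\<rparr>"
  let ?J = "basis_index CARD('a) m"
  let ?f = "\<lambda>j. cls m 2 (basis_elt m j :: 'a mp)"
  interpret V: vectorspace class_ring "Q_alg m 2 :: ('a, 'a mp set) module" by (rule vectorspace_Q_alg)
  interpret W: vectorspace class_ring ?W
    by (rule V.subspace_is_vs[OF subspace_invariants])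
  have f_in: "?f j \<in> carrier ?W" for j
    by (simp add: cls_in_invariants_iff basis_elt_closed inv_mod_basis_elt[OF m])
  have inj: "inj_on ?f ?J" by (rule inj_on_cls_basis_elt[OF m])
  have closed: "(\<Sum>j\<in>K. mp_const (c j) * basis_elt m j) \<in> carrier (mp_ring 2 :: 'a mp ring)" for c and K :: "(nat \<times> nat + nat) set"
    by (intro mp_ring_intros basis_elt_closed)
  have lincomb: "W.lincomb a (?f ` K) = cls m 2 (\<Sum>j\<in>K. mp_const (a (?f j)) * basis_elt m j)"
    if "K \<subseteq> ?J" for a :: "'a mp set \<Rightarrow> 'a" and K
  proof -
    have "finite K" using that finite_basis_index finite_subset by blast
    then show ?thesis using that
    proof (induction K rule: finite_induct)
      case empty
      show ?case by (simp add: W.lincomb_def Q_alg_simps)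
    next
      case (insert j K)
      have notin: "?f j \<notin> ?f ` K" using insert inj by (auto simp: inj_on_def)
      have smult: "c \<odot>\<^bsub>?W\<^esub> ?f i \<in> carrier ?W" for c :: 'a and i
        by (simp add: Q_alg_simps basis_elt_closed cls_in_invariants_iff mp_ring_intros
            inv_mod_const_mult inv_mod_basis_elt[OF m])
      have "(\<lambda>v. a v \<odot>\<^bsub>?W\<^esub> v) \<in> ?f ` K \<rightarrow> carrier ?W" "a (?f j) \<odot>\<^bsub>?W\<^esub> ?f j \<in> carrier ?W"
        using smult by blast+
      then have "W.lincomb a (?f ` insert j K) = a (?f j) \<odot>\<^bsub>?W\<^esub> ?f j \<oplus>\<^bsub>?W\<^esub> W.lincomb a (?f ` K)"
        unfolding W.lincomb_def image_insert using insert.hyps(1) notin by (intro W.finsum_insert) auto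
      then show ?case
        using insert closed[of "\<lambda>j. a (?f j)" K]
        by (simp add: Q_alg_simps basis_elt_closed mp_ring_intros)
    qed
  qed
  have "\<not> W.lin_dep (?f ` ?J)"
  proof
    assume "W.lin_dep (?f ` ?J)"
    then obtain A a v where A: "finite A" "A \<subseteq> ?f ` ?J" and zero: "W.lincomb a A = \<zero>\<^bsub>?W\<^esub>"
      and v: "v \<in> A" "a v \<noteq> (0 :: 'a)"
      unfolding W.lin_dep_def by auto
    define K where "K = {j \<in> ?J. ?f j \<in> A}"
    have AK: "A = ?f ` K" using A(2) by (auto simp: K_def)
    have K: "K \<subseteq> ?J" by (auto simp: K_def)
    have "cls m 2 (\<Sum>j\<in>K. mp_const (a (?f j)) * basis_elt m j) = cls m 2 0"
      using zero lincomb[OF K, of a] unfolding AK by (simp add: Q_alg_simps)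
    then have "(\<Sum>j\<in>K. mp_const (a (?f j)) * basis_elt m j) - 0 \<in> trunc (CARD('a) ^ m)"
      by (rule iffD1[OF cls_2_eq_iff[OF closed mp_ring_closed(1)]])
    moreover have "(\<Sum>j\<in>K. mp_const (a (?f j)) * basis_elt m j)
        = (\<Sum>j\<in>?J. mp_const (if j \<in> K then a (?f j) else 0) * (basis_elt m j :: 'a mp))"
      using K by (intro sum.mono_neutral_cong_left) auto
    ultimately have coeff_0: "\<forall>j\<in>?J. (if j \<in> K then a (?f j) else 0) = 0"
      by (intro basis_elt_independent[OF m]) simp
    have "a (?f j) = 0" if "j \<in> K" for j using bspec[OF coeff_0 subsetD[OF K that]] that by simp
    then show False using v unfolding AK by auto
  qed
  moreover have "W.span (?f ` ?J) = carrier ?W"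
  proof (rule subset_antisym)
    show "W.span (?f ` ?J) \<subseteq> carrier ?W"
      by (rule W.span_is_subset2) (use f_in in blast)
    show "carrier ?W \<subseteq> W.span (?f ` ?J)"
    proof
      fix A assume "A \<in> carrier ?W"
      then obtain F where F: "F \<in> carrier (mp_ring 2)" "inv_mod m F" "A = cls m 2 F"
        unfolding partial_object.simps invariants_eq by auto
      obtain c where c: "F - (\<Sum>j\<in>?J. mp_const (c j) * basis_elt m j) \<in> trunc (CARD('a) ^ m)"
        using basis_elt_span[OF m F(1,2)] by blast
      define a where "a = (\<lambda>v. c (inv_into ?J ?f v))"
      have "(\<Sum>j\<in>?J. mp_const (a (?f j)) * basis_elt m j) = (\<Sum>j\<in>?J. mp_const (c j) * (basis_elt m j :: 'a mp))"
        by (intro sum.cong refl) (simp add: a_def inv_into_f_f[OF inj])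
      then have "W.lincomb a (?f ` ?J) = cls m 2 (\<Sum>j\<in>?J. mp_const (c j) * basis_elt m j)"
        using lincomb[OF subset_refl, of a] by simp
      also have "\<dots> = A" unfolding F(3) by (rule sym, rule iffD2[OF cls_2_eq_iff[OF F(1) closed] c])
      finally show "A \<in> W.span (?f ` ?J)" unfolding W.span_def by force
    qed
  qed
  ultimately show ?thesis using f_in unfolding W.basis_def by blast
qed

theorem proposition1p6:
  fixes m :: nat and E :: "'a::{field,finite} mp fract set" and B :: "'a mp set"
  assumes "m \<ge> 2"
    and "E = {delta 1 m (delta 1 m 1)}
           \<union> (\<lambda>f. delta 2 m (to_fract f)) ` Delta_set m 1
           \<union> to_fract ` Delta_set m 2"
    and "B = {p \<in> carrier (mp_ring 2). to_fract p \<in> E}"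
  shows "delta 1 m (delta 1 m (1 :: 'a mp fract))
           = to_fract (mp_var 1 ^ (CARD('a) ^ m - 1) * mp_var 2 ^ (CARD('a) ^ m - 1))
       \<and> E \<subseteq> to_fract ` carrier (mp_ring 2)
       \<and> subspace class_ring (invariants m 2) (Q_alg m 2)
       \<and> inj_on (cls m 2) B
       \<and> vectorspace.basis class_ring ((Q_alg m 2)\<lparr>carrier := invariants m 2\<rparr>) (cls m 2 ` B)"
proof -
  let ?J = "basis_index CARD('a) m"
  have m: "1 \<le> m" using assms(1) by simp
  have E: "E = to_fract ` basis_elt m ` ?J"
    unfolding assms(2) listed_elements[OF assms(1)] by (simp add: image_comp)
  have sub: "basis_elt m ` ?J \<subseteq> carrier (mp_ring 2 :: 'a mp ring)" using basis_elt_closed by auto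
  have B: "B = basis_elt m ` ?J" unfolding assms(3) E using sub by auto
  have inj: "inj_on (cls m 2) B"
    unfolding B using inj_on_imageI[of "cls m 2" "basis_elt m" ?J] inj_on_cls_basis_elt[OF m, where 'a='a]
    by (simp add: comp_def)
  have basis: "vectorspace.basis class_ring ((Q_alg m 2)\<lparr>carrier := invariants m 2\<rparr>) (cls m 2 ` B)"
    using basis_invariants[OF m, where 'a='a] unfolding B image_image .
  have E_sub: "E \<subseteq> to_fract ` carrier (mp_ring 2)" unfolding E using sub by (rule image_mono)
  show ?thesis
    by (intro conjI delta_1_delta_1[unfolded vx_def vy_def] E_sub subspace_invariants inj basis)
qed

end
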